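(* Suppose the estimation-quality assumption (see context) holds for the class of data distributions $\mathcal{P}$. Let $\alpha\in(0,1)$, let $c_\alpha$ be the $\alpha$-quantile of $\inf_{g\in\mathcal{G}}G_P^B(g)/\Sigma_P^B(g,g)^{1/2}$, and let $$\hat{\mathcal{G}}_\alpha=\left\{g\in\mathcal{G}:\ \frac{\sqrt{n}\,\bigl(\widehat{B}_n(g)-k\bigr)}{\widehat{\Sigma}^B(g,g)^{1/2}}\le c_\alpha\right\}.$$ Then $$\limsup_{n\to\infty}\sup_{P\in\mathcal{P}}\Pr_{P^n}\bigl\{\hat{\mathcal{G}}_\alpha\cap\mathcal{G}^+\neq\emptyset\bigr\}\le\alpha,$$ where $\mathcal{G}^+=\{g\in\mathcal{G}:B(g;P)>k\}$ is the set of infeasible policies under $P$.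
   Context: $P$ is the joint distribution of $(\tau,C,X)$ with $X\in\mathcal{X}\subset\mathbb{R}^p$; $\mathcal{G}$ is a class of policies $g:\mathcal{X}\to\{0,1\}$; $k\in\mathbb{R}$ is a known budget threshold; $W(g;P)=\mathbb{E}_P[\tau g(X)]$, $B(g;P)=\mathbb{E}_P[C g(X)]$. From a sample of size $n$ (with distribution $P^n$ induced by $P$) one has $X_i$ and individual estimates $(\tau_i^{\ast},C_i^{\ast})$, $i=1,\dots,n$, and sets $\widehat{W}_n(g)=\frac1n\sum_i\tau_i^{\ast}g(X_i)$, $\widehat{B}_n(g)=\frac1n\sum_i C_i^{\ast}g(X_i)$. Estimation-quality assumption: as processes indexed by $g\in\mathcal{G}$, $\{\sqrt{n}(\widehat{W}_n(g)-W(g;P))\}_{g\in\mathcal{G}}\to_d G_P^W$ and $\{\sqrt{n}(\widehat{B}_n(g)-B(g;P))\}_{g\in\mathcal{G}}\to_d G_P^B$ (weak convergence in $\ell^\infty(\mathcal{G})$), where $G_P^W,G_P^B$ are mean-zero Gaussian processes with covariance functions $\Sigma_P^W(\cdot,\cdot)$, $\Sigma_P^B(\cdot,\cdot)$; the convergence holds uniformly over $P\in\mathcal{P}$ (in bounded-Lipschitz distance); the covariance functions are uniformly bounded, with diagonal entries bounded away from zero, uniformly over $g\in\mathcal{G}$ and $P\in\mathcal{P}$; and there is an estimator $\widehat{\Sigma}^B(\cdot,\cdot)$ of $\Sigma_P^B(\cdot,\cdot)$ that is uniformly consistent (over $\mathcal{G}\times\mathcal{G}$ and $P\in\mathcal{P}$).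 The quantile $c_\alpha$ in general depends on $P$. *)

theory Defs
  imports "HOL-Probability.Probability"
begin

text \<open>
  A policy is a measurable map into \<open>{0, 1}\<close> on the covariate set \<open>\<X>\<close>. Policies are
  taken extensional, so that two policies are equal iff they agree on \<open>\<X>\<close>.
\<close>

type_synonym 'p policy = "real ^ 'p \<Rightarrow> real"
type_synonym 'p datum = "real \<times> real \<times> (real ^ 'p)"

definition policies :: "(real ^ 'p) set \<Rightarrow> 'p policy set" where
  "policies \<X> = (\<X> \<rightarrow>\<^sub>E {0, 1}) \<inter> borel_measurable (restrict_space borel \<X>)"

text \<open>Data \<open>(\<tau>, C, X)\<close> with \<open>X\<close> in \<open>\<X>\<close>.\<close>

definition datum_space :: "(real ^ 'p) set \<Rightarrow> 'p datum measure" where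
  "datum_space \<X> = borel \<Otimes>\<^sub>M borel \<Otimes>\<^sub>M restrict_space borel \<X>"

abbreviation benefit_of :: "'p datum \<Rightarrow> real" where "benefit_of z \<equiv> fst z"
abbreviation cost_of :: "'p datum \<Rightarrow> real" where "cost_of z \<equiv> fst (snd z)"
abbreviation covariate_of :: "'p datum \<Rightarrow> real ^ 'p" where "covariate_of z \<equiv> snd (snd z)"

definition welfare :: "('p::finite) policy \<Rightarrow> 'p datum measure \<Rightarrow> real" where
  "welfare g P = (\<integral>z. benefit_of z * g (covariate_of z) \<partial>P)"

definition budget :: "('p::finite) policy \<Rightarrow> 'p datum measure \<Rightarrow> real" where
  "budget g P = (\<integral>z. cost_of z * g (covariate_of z) \<partial>P)"

text \<open>Integrability is what is needed for the two expectations above to exist.\<close>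

definition data_distribution :: "(real ^ 'p) set \<Rightarrow> 'p policy set \<Rightarrow> 'p datum measure \<Rightarrow> bool" where
  "data_distribution \<X> G P \<longleftrightarrow>
     prob_space P \<and> sets P = sets (datum_space \<X>) \<and>
     (\<forall>g\<in>G. integrable P (\<lambda>z. benefit_of z * g (covariate_of z))
           \<and> integrable P (\<lambda>z. cost_of z * g (covariate_of z)))"

text \<open>
  For every \<open>n\<close> there is one measurable space \<open>S n\<close> of sample outcomes, carrying a probability
  \<open>Pn P n\<close> for every \<open>P\<close>; \<open>dat n i\<close> is the \<open>i\<close>-th of \<open>n\<close> independent draws from \<open>P\<close>.
  A sample outcome may contain more than these draws (treatment assignments, observed outcomes,
  ...), on which the estimates of individual benefits and costs may depend; but the estimates are
  functions of the outcome that do not depend on \<open>P\<close>.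
\<close>

definition iid_sampling ::
  "(real ^ 'p) set \<Rightarrow> 'p datum measure set \<Rightarrow> (nat \<Rightarrow> 's measure) \<Rightarrow>
   ('p datum measure \<Rightarrow> nat \<Rightarrow> 's measure) \<Rightarrow> (nat \<Rightarrow> nat \<Rightarrow> 's \<Rightarrow> 'p datum) \<Rightarrow> bool" where
  "iid_sampling \<X> \<P> S Pn dat \<longleftrightarrow>
     (\<forall>n. \<forall>i<n. dat n i \<in> S n \<rightarrow>\<^sub>M datum_space \<X>) \<and>
     (\<forall>P\<in>\<P>. \<forall>n. prob_space (Pn P n) \<and> sets (Pn P n) = sets (S n) \<and>
        distr (Pn P n) (PiM {..<n} (\<lambda>_. P)) (\<lambda>\<omega>. \<lambda>i\<in>{..<n}. dat n i \<omega>) = PiM {..<n} (\<lambda>_. P))"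

definition policy_average ::
  "(nat \<Rightarrow> nat \<Rightarrow> 's \<Rightarrow> real) \<Rightarrow> (nat \<Rightarrow> nat \<Rightarrow> 's \<Rightarrow> ('p::finite) datum) \<Rightarrow> nat \<Rightarrow> 'p policy \<Rightarrow> 's \<Rightarrow> real" where
  "policy_average v dat n g \<omega> = (\<Sum>i<n. v n i \<omega> * g (covariate_of (dat n i \<omega>))) / real n"

section \<open>Weak convergence of bounded processes\<close>

text \<open>The space of bounded real functions on \<open>T\<close> with the supremum distance.\<close>

definition linf :: "'a set \<Rightarrow> ('a \<Rightarrow> real) metric" where
  "linf T = funspace T euclidean_metric"

definition linf_borel :: "'a set \<Rightarrow> ('a \<Rightarrow> real) measure" where
  "linf_borel T = sigma (mspace (linf T)) {U. openin (mtopology_of (linf T)) U}"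

definition sample_path :: "'a set \<Rightarrow> ('a \<Rightarrow> 'w \<Rightarrow> real) \<Rightarrow> 'w \<Rightarrow> 'a \<Rightarrow> real" where
  "sample_path T Y \<omega> = (\<lambda>t\<in>T. Y t \<omega>)"

definition tight_random_element :: "'a set \<Rightarrow> 'w measure \<Rightarrow> ('a \<Rightarrow> 'w \<Rightarrow> real) \<Rightarrow> bool" where
  "tight_random_element T M Z \<longleftrightarrow>
     prob_space M \<and> sample_path T Z \<in> M \<rightarrow>\<^sub>M linf_borel T \<and>
     (\<forall>\<epsilon>>0. \<exists>K. compactin (mtopology_of (linf T)) K \<and>
        measure M {\<omega> \<in> space M. sample_path T Z \<omega> \<in> K} \<ge> 1 - \<epsilon>)"

text \<open>
  The processes to which weak convergence is applied need not be Borel measurable maps into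
  the space of bounded functions, hence outer expectations (Hoffmann-Jorgensen). The definition
  is meant for bounded \<open>f\<close> and probability measures \<open>M\<close>.
\<close>

definition outer_expectation :: "'w measure \<Rightarrow> ('w \<Rightarrow> real) \<Rightarrow> real" where
  "outer_expectation M f =
     Inf {(\<integral>\<omega>. U \<omega> \<partial>M) | U. integrable M U \<and> (\<forall>\<omega>\<in>space M. f \<omega> \<le> U \<omega>)}"

definition BL1 :: "'a set \<Rightarrow> (('a \<Rightarrow> real) \<Rightarrow> real) set" where
  "BL1 T = {h. (\<forall>y\<in>mspace (linf T). \<bar>h y\<bar> \<le> 1) \<and>
               (\<forall>y\<in>mspace (linf T). \<forall>z\<in>mspace (linf T). \<bar>h y - h z\<bar> \<le> mdist (linf T) y z)}"

definition bl_distance ::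
  "'a set \<Rightarrow> 'w measure \<Rightarrow> ('a \<Rightarrow> 'w \<Rightarrow> real) \<Rightarrow> 'v measure \<Rightarrow> ('a \<Rightarrow> 'v \<Rightarrow> real) \<Rightarrow> real" where
  "bl_distance T M Y N Z =
     (SUP h\<in>BL1 T.
        \<bar>outer_expectation M (\<lambda>\<omega>. h (sample_path T Y \<omega>)) - (\<integral>v. h (sample_path T Z v) \<partial>N)\<bar>)"

definition uniform_weak_convergence ::
  "'a set \<Rightarrow> 'i set \<Rightarrow> ('i \<Rightarrow> nat \<Rightarrow> 'w measure) \<Rightarrow> ('i \<Rightarrow> nat \<Rightarrow> 'a \<Rightarrow> 'w \<Rightarrow> real) \<Rightarrow>
   ('i \<Rightarrow> 'v measure) \<Rightarrow> ('i \<Rightarrow> 'a \<Rightarrow> 'v \<Rightarrow> real) \<Rightarrow> bool" where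
  "uniform_weak_convergence T I M Y N Z \<longleftrightarrow>
     (\<forall>P\<in>I. (\<forall>n. sample_path T (Y P n) ` space (M P n) \<subseteq> mspace (linf T)) \<and>
             tight_random_element T (N P) (Z P)) \<and>
     uniform_limit I (\<lambda>n P. bl_distance T (M P n) (Y P n) (N P) (Z P)) (\<lambda>_. 0) sequentially"

section \<open>Gaussian processes\<close>

text \<open>Normal laws include the point masses (variance zero).\<close>

definition gaussian_rv :: "'w measure \<Rightarrow> ('w \<Rightarrow> real) \<Rightarrow> bool" where
  "gaussian_rv M Y \<longleftrightarrow> Y \<in> borel_measurable M \<and>
     (\<exists>\<mu>. distr M borel Y = return borel \<mu> \<or>
        (\<exists>\<sigma>>0. distr M borel Y = density lborel (\<lambda>x. ennreal (normal_density \<mu> \<sigma> x))))"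

definition centered_gaussian_process ::
  "'a set \<Rightarrow> 'w measure \<Rightarrow> ('a \<Rightarrow> 'w \<Rightarrow> real) \<Rightarrow> ('a \<Rightarrow> 'a \<Rightarrow> real) \<Rightarrow> bool" where
  "centered_gaussian_process T M Z \<Sigma> \<longleftrightarrow>
     prob_space M \<and>
     (\<forall>J a. finite J \<longrightarrow> J \<subseteq> T \<longrightarrow> gaussian_rv M (\<lambda>\<omega>. \<Sum>t\<in>J. a t * Z t \<omega>)) \<and>
     (\<forall>t\<in>T. (\<integral>\<omega>. Z t \<omega> \<partial>M) = 0) \<and>
     (\<forall>s\<in>T. \<forall>t\<in>T. (\<integral>\<omega>. Z s \<omega> * Z t \<omega> \<partial>M) = \<Sigma> s t)"

definition quantile :: "real measure \<Rightarrow> real \<Rightarrow> real" where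
  "quantile \<mu> \<alpha> = Inf {x. \<alpha> \<le> measure \<mu> {..x}}"

section \<open>The estimation-quality assumption\<close>

definition bounded_nondegenerate_covariances ::
  "'a set \<Rightarrow> 'i set \<Rightarrow> ('i \<Rightarrow> 'a \<Rightarrow> 'a \<Rightarrow> real) \<Rightarrow> bool" where
  "bounded_nondegenerate_covariances T I \<Sigma> \<longleftrightarrow>
     (\<exists>K. \<forall>P\<in>I. \<forall>s\<in>T. \<forall>t\<in>T. \<bar>\<Sigma> P s t\<bar> \<le> K) \<and>
     (\<exists>l>0. \<forall>P\<in>I. \<forall>t\<in>T. l \<le> \<Sigma> P t t)"

text \<open>
  The supremum over \<open>T \<times> T\<close> need not be measurable, hence the outer measure. It is
  taken in the extended reals because it may be infinite.
\<close>

definition uniformly_consistent ::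
  "'a set \<Rightarrow> 'i set \<Rightarrow> ('i \<Rightarrow> nat \<Rightarrow> 's measure) \<Rightarrow> (nat \<Rightarrow> 'a \<Rightarrow> 'a \<Rightarrow> 's \<Rightarrow> real) \<Rightarrow>
   ('i \<Rightarrow> 'a \<Rightarrow> 'a \<Rightarrow> real) \<Rightarrow> bool" where
  "uniformly_consistent T I M \<Sigma>h \<Sigma> \<longleftrightarrow>
     (\<forall>\<epsilon>>0. uniform_limit I
        (\<lambda>n P. enn2real (outer_measure_of (M P n)
           {\<omega> \<in> space (M P n). (SUP (s, t)\<in>T \<times> T. ereal \<bar>\<Sigma>h n s t \<omega> - \<Sigma> P s t\<bar>) > ereal \<epsilon>}))
        (\<lambda>_. 0) sequentially)"

text \<open>
  \<open>\<tau>s\<close>, \<open>Cs\<close> are the individual estimates, \<open>\<Sigma>h\<close> the estimator of the covariance \<open>\<Sigma>B\<close>, and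
  \<open>GW P\<close>, \<open>GB P\<close> the limit processes, living on the probability spaces \<open>NW P\<close>, \<open>NB P\<close>.
\<close>

definition estimation_quality ::
  "('p::finite) policy set \<Rightarrow> 'p datum measure set \<Rightarrow> (nat \<Rightarrow> 's measure) \<Rightarrow>
   ('p datum measure \<Rightarrow> nat \<Rightarrow> 's measure) \<Rightarrow> (nat \<Rightarrow> nat \<Rightarrow> 's \<Rightarrow> 'p datum) \<Rightarrow>
   (nat \<Rightarrow> nat \<Rightarrow> 's \<Rightarrow> real) \<Rightarrow> (nat \<Rightarrow> nat \<Rightarrow> 's \<Rightarrow> real) \<Rightarrow>
   (nat \<Rightarrow> 'p policy \<Rightarrow> 'p policy \<Rightarrow> 's \<Rightarrow> real) \<Rightarrow>
   ('p datum measure \<Rightarrow> 'u measure) \<Rightarrow> ('p datum measure \<Rightarrow> 'p policy \<Rightarrow> 'u \<Rightarrow> real) \<Rightarrow>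
   ('p datum measure \<Rightarrow> 'p policy \<Rightarrow> 'p policy \<Rightarrow> real) \<Rightarrow>
   ('p datum measure \<Rightarrow> 'v measure) \<Rightarrow> ('p datum measure \<Rightarrow> 'p policy \<Rightarrow> 'v \<Rightarrow> real) \<Rightarrow>
   ('p datum measure \<Rightarrow> 'p policy \<Rightarrow> 'p policy \<Rightarrow> real) \<Rightarrow> bool" where
  "estimation_quality G \<P> S Pn dat \<tau>s Cs \<Sigma>h NW GW \<Sigma>W NB GB \<Sigma>B \<longleftrightarrow>
     (\<forall>n. \<forall>i<n. \<tau>s n i \<in> borel_measurable (S n) \<and> Cs n i \<in> borel_measurable (S n)) \<and>
     (\<forall>n. \<forall>g\<in>G. \<forall>h\<in>G. \<Sigma>h n g h \<in> borel_measurable (S n)) \<and>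
     (\<forall>P\<in>\<P>. centered_gaussian_process G (NW P) (GW P) (\<Sigma>W P)) \<and>
     (\<forall>P\<in>\<P>. centered_gaussian_process G (NB P) (GB P) (\<Sigma>B P)) \<and>
     uniform_weak_convergence G \<P> Pn
       (\<lambda>P n g \<omega>. sqrt (real n) * (policy_average \<tau>s dat n g \<omega> - welfare g P)) NW GW \<and>
     uniform_weak_convergence G \<P> Pn
       (\<lambda>P n g \<omega>. sqrt (real n) * (policy_average Cs dat n g \<omega> - budget g P)) NB GB \<and>
     bounded_nondegenerate_covariances G \<P> \<Sigma>W \<and>
     bounded_nondegenerate_covariances G \<P> \<Sigma>B \<and>
     uniformly_consistent G \<P> Pn \<Sigma>h \<Sigma>B"

section \<open>The estimated class of policies\<close>

definition critical_value ::
  "('p::finite) policy set \<Rightarrow> 'v measure \<Rightarrow> ('p policy \<Rightarrow> 'v \<Rightarrow> real) \<Rightarrow> ('p policy \<Rightarrow> 'p policy \<Rightarrow> real) \<Rightarrow>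
   real \<Rightarrow> real" where
  "critical_value G N Z \<Sigma> \<alpha> = quantile (distr N borel (\<lambda>v. INF g\<in>G. Z g v / sqrt (\<Sigma> g g))) \<alpha>"

definition estimated_class ::
  "('p::finite) policy set \<Rightarrow> real \<Rightarrow> (nat \<Rightarrow> nat \<Rightarrow> 's \<Rightarrow> 'p datum) \<Rightarrow> (nat \<Rightarrow> nat \<Rightarrow> 's \<Rightarrow> real) \<Rightarrow>
   (nat \<Rightarrow> 'p policy \<Rightarrow> 'p policy \<Rightarrow> 's \<Rightarrow> real) \<Rightarrow> real \<Rightarrow> nat \<Rightarrow> 's \<Rightarrow> 'p policy set" where
  "estimated_class G k dat Cs \<Sigma>h c n \<omega> =
     {g \<in> G. sqrt (real n) * (policy_average Cs dat n g \<omega> - k) / sqrt (\<Sigma>h n g g \<omega>) \<le> c}"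

definition infeasible_class :: "('p::finite) policy set \<Rightarrow> real \<Rightarrow> 'p datum measure \<Rightarrow> 'p policy set" where
  "infeasible_class G k P = {g \<in> G. budget g P > k}"

end

theory Submission
  imports Defs
begin

text \<open>
  If the estimated class contains an infeasible policy \<open>g\<close>, then, as \<open>B(g) > k\<close>, the studentized
  process of centred estimates falls below \<open>c\<^sub>\<alpha>\<close> at \<open>g\<close>, hence so does its infimum, up to the error
  of the variance estimate. The infimum is a Lipschitz functional of the path, so the probability
  of this event is, up to the bounded Lipschitz distance, at most the probability that the infimum
  of the limit process lies below \<open>c\<^sub>\<alpha> + \<eta>\<close>, which is at most \<open>\<alpha>\<close> plus the mass that its law gives
  to \<open>[c\<^sub>\<alpha>, c\<^sub>\<alpha> + \<eta>)\<close>. That mass must be small uniformly over \<open>\<P>\<close>.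

  The maximum of a Gaussian process with unit variances has a density \<open>f\<close> such that \<open>f\<close> divided by the
  normal density is nondecreasing; so \<open>f\<close> is bounded on \<open>(-\<infinity>, b]\<close> by a constant depending on \<open>b\<close> only,
  and it suffices to bound \<open>c\<^sub>\<alpha>\<close> uniformly. For this, uniform tightness of the limits is needed.
  For a fixed sample of size \<open>n\<close> the estimate takes at most \<open>2^n\<close> values over the policies, so a limit
  process close to it in law takes few values up to small errors and a deterministic shift, which
  the symmetry of the Gaussian law removes. A Gaussian process that reaches a high level with
  probability \<open>\<alpha>\<close> reaches, by Fernique's inequality, each lower level with probability at least
  \<open>\<alpha>/2\<close>, and so takes many separated values.
\<close>

section \<open>Joint laws and characteristic functions\<close>

text \<open>Bounded variances do not bound the supremum of a Gaussian process: the limits for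
  different \<open>P\<close> could contain longer and longer families of independent normal
  variables, and \<open>c\<^sub>\<alpha>\<close> would drift to minus infinity over
  \<open>\<P>\<close>. A lower bound on \<open>c\<^sub>\<alpha>\<close> enters the density estimate,
  whose constant is the inverse of the normal tail beyond \<open>-c\<^sub>\<alpha>\<close>; a
  two-sided one is needed because the error of the variance estimate is multiplied by
  \<open>c\<^sub>\<alpha>\<close>. Since the convergence is uniform, one \<open>n\<close> serves all
  \<open>P\<close>; the bound that it gives is enormous but finite, which is enough. Infima over the
  class are replaced by minima over finite subfamilies, chosen by the tightness of one limit at a
  time. These may depend on \<open>P\<close>, as none of the Gaussian estimates depends on the
  number of coordinates. The definition of a Gaussian process speaks only of the laws of linear
  combinations, while regression and rotation need joint laws: hence the uniqueness theorem for
  joint characteristic functions at the beginning.\<close>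

lemma weighted_char_unique:
  fixes W1 Y1 :: "'a \<Rightarrow> real" and W2 Y2 :: "'b \<Rightarrow> real"
  assumes "prob_space M1" "prob_space M2"
    and [measurable]: "W1 \<in> borel_measurable M1" "Y1 \<in> borel_measurable M1"
      "W2 \<in> borel_measurable M2" "Y2 \<in> borel_measurable M2"
    and W1: "\<And>x. 0 \<le> W1 x" "\<And>x. W1 x \<le> B" and W2: "\<And>x. 0 \<le> W2 x" "\<And>x. W2 x \<le> B"
    and eq: "\<And>t. (CLINT x|M1. W1 x * iexp (t * Y1 x)) = (CLINT x|M2. W2 x * iexp (t * Y2 x))"
    and [measurable]: "A \<in> sets borel"
  shows "(\<integral>x. W1 x * indicator A (Y1 x) \<partial>M1) = (\<integral>x. W2 x * indicator A (Y2 x) \<partial>M2)"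
proof -
  interpret M1: prob_space M1 by fact
  interpret M2: prob_space M2 by fact
  have i1: "integrable M1 W1" by (rule M1.integrable_const_bound[where B=B]) (use W1 in auto)
  have i2: "integrable M2 W2" by (rule M2.integrable_const_bound[where B=B]) (use W2 in auto)
  have "complex_of_real (\<integral>x. W1 x \<partial>M1) = complex_of_real (\<integral>x. W2 x \<partial>M2)"
    using eq[of 0] by simp
  then have same: "(\<integral>x. W1 x \<partial>M1) = (\<integral>x. W2 x \<partial>M2)"
    by (simp only: of_real_eq_iff)
  \<comment> \<open>Division by the common total weight turns both weights into probability
    densities, so that Levy's uniqueness theorem applies to the laws of \<open>Y1\<close> and
    \<open>Y2\<close> under them. If the total is 0, the weights vanish almost everywhere.\<close>
  define c where "c = (\<integral>x. W1 x \<partial>M1)"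
  have "c \<ge> 0" unfolding c_def using W1 by simp
  have ind: "(\<integral>x. W x * indicator A (Y x) \<partial>M) = 0"
    if "integrable M W" "\<And>x. 0 \<le> W x" "(\<integral>x. W x \<partial>M) = 0" for W Y :: "'c \<Rightarrow> real" and M
  proof -
    have "AE x in M. W x = 0"
      using integral_nonneg_eq_0_iff_AE[OF that(1)] that(2,3) by simp
    then have "AE x in M. W x * indicator A (Y x) = 0" by eventually_elim simp
    then show ?thesis by (rule integral_eq_zero_AE)
  qed
  have D: "real_distribution (distr (density M (\<lambda>x. ennreal (W x / c))) borel Y)"
    "char (distr (density M (\<lambda>x. ennreal (W x / c))) borel Y) t = (CLINT x|M. W x * iexp (t * Y x)) / c"
    "measure (distr (density M (\<lambda>x. ennreal (W x / c))) borel Y) A = (\<integral>x. W x * indicator A (Y x) \<partial>M) / c"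
    if "c > 0" "integrable M W" "\<And>x. 0 \<le> W x" "(\<integral>x. W x \<partial>M) = c"
      and [measurable]: "W \<in> borel_measurable M" "Y \<in> borel_measurable M"
    for W Y :: "'c \<Rightarrow> real" and M t
  proof -
    let ?D = "density M (\<lambda>x. ennreal (W x / c))"
    have "emeasure ?D (space ?D) = (\<integral>\<^sup>+x. ennreal (W x / c) \<partial>M)"
      by (subst emeasure_density) (auto intro!: nn_integral_cong)
    also have "\<dots> = ennreal (\<integral>x. W x / c \<partial>M)"
      by (rule nn_integral_eq_integral) (use that in auto)
    also have "\<dots> = 1" using that by simp
    finally have "prob_space ?D" by (rule prob_spaceI)
    then interpret D: prob_space ?D .
    show "real_distribution (distr ?D borel Y)"
      by (rule D.real_distribution_distr) simp
    then interpret R: real_distribution "distr ?D borel Y" .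
    have "char (distr ?D borel Y) t = (CLINT x|?D. iexp (t * Y x))"
      unfolding char_def by (subst integral_distr) auto
    also have "\<dots> = (CLINT x|M. (W x / c) *\<^sub>R iexp (t * Y x))"
      by (subst integral_density) (use that in auto)
    also have "\<dots> = (CLINT x|M. (W x * iexp (t * Y x)) / c)"
      by (rule Bochner_Integration.integral_cong) (auto simp: scaleR_conv_of_real)
    also have "\<dots> = (CLINT x|M. W x * iexp (t * Y x)) / c" by simp
    finally show "char (distr ?D borel Y) t = (CLINT x|M. W x * iexp (t * Y x)) / c" .
    have "measure (distr ?D borel Y) A = (\<integral>y. indicator A y \<partial>distr ?D borel Y)" by simp
    also have "\<dots> = (\<integral>x. indicator A (Y x) \<partial>?D)"
      by (subst integral_distr) auto
    also have "\<dots> = (\<integral>x. (W x / c) *\<^sub>R indicator A (Y x) \<partial>M)"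
      by (subst integral_density) (use that in auto)
    also have "\<dots> = (\<integral>x. W x * indicator A (Y x) \<partial>M) / c" by simp
    finally show "measure (distr ?D borel Y) A = (\<integral>x. W x * indicator A (Y x) \<partial>M) / c" .
  qed
  show ?thesis
  proof (cases "c = 0")
    case True
    then show ?thesis using ind[OF i1 W1(1)] ind[OF i2 W2(1)] same c_def by simp
  next
    case False
    with \<open>c \<ge> 0\<close> have c: "c > 0" by simp
    note D1 = D[OF c i1 W1(1) c_def[symmetric] assms(3,4)]
    note D2 = D[OF c i2 W2(1) same[symmetric, folded c_def] assms(5,6)]
    have "distr (density M1 (\<lambda>x. ennreal (W1 x / c))) borel Y1
        = distr (density M2 (\<lambda>x. ennreal (W2 x / c))) borel Y2"
      by (rule Levy_uniqueness[OF D1(1) D2(1)]) (rule ext, simp only: D1(2) D2(2) eq)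
    then have "measure (distr (density M1 (\<lambda>x. ennreal (W1 x / c))) borel Y1) A
        = measure (distr (density M2 (\<lambda>x. ennreal (W2 x / c))) borel Y2) A" by simp
    then show ?thesis using D1(3) D2(3) c by simp
  qed
qed


text \<open>Euler's formulas: a factor cos or sin of \<open>\<theta>\<close> only shifts the phase
  by \<open>\<theta>\<close> or its negative. So integrals that are known for the weight
  \<open>W\<close> and all phases are also known for the signed weights that arise from it.\<close>

lemma (in prob_space) integral_trig_weight:
  fixes W \<theta> \<eta> :: "'a \<Rightarrow> real"
  assumes [measurable]: "W \<in> borel_measurable M" "\<theta> \<in> borel_measurable M" "\<eta> \<in> borel_measurable M"
    and W: "\<And>x. \<bar>W x\<bar> \<le> B"
  shows "(CLINT x|M. of_real (W x * cos (\<theta> x)) * iexp (\<eta> x))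
      = ((CLINT x|M. W x * iexp (\<eta> x + \<theta> x)) + (CLINT x|M. W x * iexp (\<eta> x - \<theta> x))) / 2"
    and "(CLINT x|M. of_real (W x * sin (\<theta> x)) * iexp (\<eta> x))
      = ((CLINT x|M. W x * iexp (\<eta> x + \<theta> x)) - (CLINT x|M. W x * iexp (\<eta> x - \<theta> x))) / (2 * \<i>)"
proof -
  have int: "integrable M (\<lambda>x. of_real (W x) * iexp (\<zeta> x))"
    if [measurable]: "\<zeta> \<in> borel_measurable M" for \<zeta> :: "'a \<Rightarrow> real"
    by (rule integrable_const_bound[where B=B]) (use W in \<open>auto simp: norm_mult\<close>)
  have i1: "integrable M (\<lambda>x. of_real (W x) * iexp (\<eta> x + \<theta> x))"
    and i2: "integrable M (\<lambda>x. of_real (W x) * iexp (\<eta> x - \<theta> x))"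
    by (auto intro!: int[of "\<lambda>x. \<eta> x + \<theta> x", simplified] int[of "\<lambda>x. \<eta> x - \<theta> x", simplified])
  have "of_real (W x * cos (\<theta> x)) * iexp (\<eta> x)
      = (W x * iexp (\<eta> x + \<theta> x) + W x * iexp (\<eta> x - \<theta> x)) / 2" for x
    by (simp add: exp_Euler cos_add sin_add cos_diff sin_diff cos_of_real sin_of_real
        flip: of_real_add of_real_diff) (simp add: algebra_simps)
  then have "(CLINT x|M. of_real (W x * cos (\<theta> x)) * iexp (\<eta> x))
     = (CLINT x|M. (W x * iexp (\<eta> x + \<theta> x) + W x * iexp (\<eta> x - \<theta> x)) / 2)"
    by (intro Bochner_Integration.integral_cong) auto
  also have "\<dots> = ((CLINT x|M. W x * iexp (\<eta> x + \<theta> x)) + (CLINT x|M. W x * iexp (\<eta> x - \<theta> x))) / 2"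
    using i1 i2 by simp
  finally show "(CLINT x|M. of_real (W x * cos (\<theta> x)) * iexp (\<eta> x)) = \<dots>" .
  have "of_real (W x * sin (\<theta> x)) * iexp (\<eta> x)
      = (W x * iexp (\<eta> x + \<theta> x) - W x * iexp (\<eta> x - \<theta> x)) / (2 * \<i>)" for x
    by (simp add: exp_Euler cos_add sin_add cos_diff sin_diff cos_of_real sin_of_real
        flip: of_real_add of_real_diff) (simp add: field_simps)
  then have "(CLINT x|M. of_real (W x * sin (\<theta> x)) * iexp (\<eta> x))
     = (CLINT x|M. (W x * iexp (\<eta> x + \<theta> x) - W x * iexp (\<eta> x - \<theta> x)) / (2 * \<i>))"
    by (intro Bochner_Integration.integral_cong) auto
  also have "\<dots> = ((CLINT x|M. W x * iexp (\<eta> x + \<theta> x)) - (CLINT x|M. W x * iexp (\<eta> x - \<theta> x))) / (2 * \<i>)"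
    using i1 i2 by simp
  finally show "(CLINT x|M. of_real (W x * sin (\<theta> x)) * iexp (\<eta> x)) = \<dots>" .
qed

text \<open>Both \<open>W\<close> and \<open>W + U\<close> are nonnegative bounded weights, to which
  the previous uniqueness applies; the difference of the two results is the claim for
  \<open>U\<close>.\<close>

lemma signed_weighted_char_unique:
  fixes W1 U1 Y1 :: "'a \<Rightarrow> real" and W2 U2 Y2 :: "'b \<Rightarrow> real"
  assumes "prob_space M1" "prob_space M2"
    and [measurable]: "W1 \<in> borel_measurable M1" "U1 \<in> borel_measurable M1" "Y1 \<in> borel_measurable M1"
      "W2 \<in> borel_measurable M2" "U2 \<in> borel_measurable M2" "Y2 \<in> borel_measurable M2"
    and W1: "\<And>x. \<bar>U1 x\<bar> \<le> W1 x" "\<And>x. W1 x \<le> B" and W2: "\<And>x. \<bar>U2 x\<bar> \<le> W2 x" "\<And>x. W2 x \<le> B"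
    and eqW: "\<And>t. (CLINT x|M1. W1 x * iexp (t * Y1 x)) = (CLINT x|M2. W2 x * iexp (t * Y2 x))"
    and eqU: "\<And>t. (CLINT x|M1. U1 x * iexp (t * Y1 x)) = (CLINT x|M2. U2 x * iexp (t * Y2 x))"
    and A[measurable]: "A \<in> sets borel"
  shows "(\<integral>x. U1 x * indicator A (Y1 x) \<partial>M1) = (\<integral>x. U2 x * indicator A (Y2 x) \<partial>M2)"
proof -
  interpret M1: prob_space M1 by fact
  interpret M2: prob_space M2 by fact
  have b1: "\<bar>U1 x\<bar> \<le> B" "\<bar>W1 x\<bar> \<le> B" "0 \<le> W1 x" "0 \<le> W1 x + U1 x" "W1 x + U1 x \<le> 2 * B" for x
    using W1[of x] by auto
  have b2: "\<bar>U2 x\<bar> \<le> B" "\<bar>W2 x\<bar> \<le> B" "0 \<le> W2 x" "0 \<le> W2 x + U2 x" "W2 x + U2 x \<le> 2 * B" for x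
    using W2[of x] by auto
  have add: "(CLINT x|M. complex_of_real (W x + U x) * iexp (t * Y x))
     = (CLINT x|M. W x * iexp (t * Y x)) + (CLINT x|M. U x * iexp (t * Y x))"
    if "prob_space M" "\<And>x. \<bar>U x\<bar> \<le> B" "\<And>x. \<bar>W x\<bar> \<le> B" and
     [measurable]: "W \<in> borel_measurable M" "U \<in> borel_measurable M" "Y \<in> borel_measurable M"
    for W U Y :: "'c \<Rightarrow> real" and M t
  proof -
    interpret prob_space M by fact
    have "integrable M (\<lambda>x. of_real (W x) * iexp (t * Y x))" "integrable M (\<lambda>x. of_real (U x) * iexp (t * Y x))"
      by (rule integrable_const_bound[where B=B]; use that in \<open>auto simp: norm_mult\<close>)+
    then show ?thesis by (simp add: algebra_simps)
  qed
  have addr: "(\<integral>x. (W x + U x) * indicator A (Y x) \<partial>M)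
     = (\<integral>x. W x * indicator A (Y x) \<partial>M) + (\<integral>x. U x * indicator A (Y x) \<partial>M)"
    if "prob_space M" "\<And>x. \<bar>U x\<bar> \<le> B" "\<And>x. \<bar>W x\<bar> \<le> B" and
     [measurable]: "W \<in> borel_measurable M" "U \<in> borel_measurable M" "Y \<in> borel_measurable M"
    for W U Y :: "'c \<Rightarrow> real" and M
  proof -
    interpret prob_space M by fact
    have "0 \<le> B" using that(2) by (meson abs_ge_zero order_trans)
    then have "integrable M (\<lambda>x. W x * indicator A (Y x))" "integrable M (\<lambda>x. U x * indicator A (Y x))"
      by (intro integrable_const_bound[where B=B]; use that in \<open>auto simp: indicator_def\<close>)+
    then show ?thesis by (simp add: algebra_simps)
  qed
  have W: "(\<integral>x. W1 x * indicator A (Y1 x) \<partial>M1) = (\<integral>x. W2 x * indicator A (Y2 x) \<partial>M2)"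
    by (rule weighted_char_unique[where B=B]) (use assms(1,2) eqW b1(3) b2(3) W1(2) W2(2) in \<open>auto\<close>)
  have WU: "(\<integral>x. (W1 x + U1 x) * indicator A (Y1 x) \<partial>M1) = (\<integral>x. (W2 x + U2 x) * indicator A (Y2 x) \<partial>M2)"
  proof (rule weighted_char_unique[where B="2*B"])
    fix t
    show "(CLINT x|M1. complex_of_real (W1 x + U1 x) * iexp (t * Y1 x))
       = (CLINT x|M2. complex_of_real (W2 x + U2 x) * iexp (t * Y2 x))"
      by (simp only: add[OF assms(1) b1(1,2) assms(3-5)] add[OF assms(2) b2(1,2) assms(6-8)] eqW eqU)
  qed (use assms(1,2) b1 b2 in auto)
  show ?thesis
    using W WU addr[OF assms(1) b1(1,2) assms(3-5)] addr[OF assms(2) b2(1,2) assms(6-8)] by linarith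
qed

text \<open>
  The coordinates are replaced one at a time: a trigonometric factor in the other coordinates is
  treated as a weight, whose real and imaginary parts are dominated by the product of the indicators.
\<close>

lemma joint_char_unique_boxes:
  fixes Y1 :: "'i \<Rightarrow> 'a \<Rightarrow> real" and Y2 :: "'i \<Rightarrow> 'b \<Rightarrow> real"
  assumes "prob_space M1" "prob_space M2" and J: "finite J"
    and m1: "\<And>j. j \<in> J \<Longrightarrow> Y1 j \<in> borel_measurable M1"
    and m2: "\<And>j. j \<in> J \<Longrightarrow> Y2 j \<in> borel_measurable M2"
    and eq: "\<And>t. (CLINT x|M1. iexp (\<Sum>j\<in>J. t j * Y1 j x)) = (CLINT x|M2. iexp (\<Sum>j\<in>J. t j * Y2 j x))"
    and S: "\<And>j. j \<in> J \<Longrightarrow> S j \<in> sets borel" and "I \<subseteq> J"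
  shows "(CLINT x|M1. of_real (\<Prod>j\<in>I. indicator (S j) (Y1 j x)) * iexp (\<Sum>j\<in>J. t j * Y1 j x))
       = (CLINT x|M2. of_real (\<Prod>j\<in>I. indicator (S j) (Y2 j x)) * iexp (\<Sum>j\<in>J. t j * Y2 j x))"
proof -
  interpret M1: prob_space M1 by fact
  interpret M2: prob_space M2 by fact
  have "finite I" using J \<open>I \<subseteq> J\<close> finite_subset by blast
  then show ?thesis using \<open>I \<subseteq> J\<close>
  proof (induction I arbitrary: t)
    case empty
    then show ?case using eq[of t] by simp
  next
    case (insert i I)
    have [measurable]: "Y1 i \<in> borel_measurable M1" "Y2 i \<in> borel_measurable M2" "S i \<in> sets borel"
      using insert.prems m1 m2 S by auto
    define V1 where "V1 = (\<lambda>x. \<Prod>j\<in>I. indicat_real (S j) (Y1 j x))"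
    define V2 where "V2 = (\<lambda>x. \<Prod>j\<in>I. indicat_real (S j) (Y2 j x))"
    define \<theta>1 where "\<theta>1 = (\<lambda>x. \<Sum>j\<in>J. t j * Y1 j x)"
    define \<theta>2 where "\<theta>2 = (\<lambda>x. \<Sum>j\<in>J. t j * Y2 j x)"
    have [measurable]: "V1 \<in> borel_measurable M1"
      unfolding V1_def by (rule borel_measurable_prod, rule measurable_compose[OF m1])
        (use insert.prems S in auto)
    have [measurable]: "V2 \<in> borel_measurable M2"
      unfolding V2_def by (rule borel_measurable_prod, rule measurable_compose[OF m2])
        (use insert.prems S in auto)
    have [measurable]: "\<theta>1 \<in> borel_measurable M1" "\<theta>2 \<in> borel_measurable M2"
      unfolding \<theta>1_def \<theta>2_def using m1 m2 by auto
    have V: "0 \<le> V1 x" "V1 x \<le> 1" "0 \<le> V2 y" "V2 y \<le> 1" for x y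
      unfolding V1_def V2_def by (auto intro!: prod_nonneg prod_le_1)
    have Vabs: "\<bar>V1 x\<bar> \<le> 1" "\<bar>V2 y\<bar> \<le> 1" for x y by (simp_all add: V)
    have upd: "(\<Sum>j\<in>J. (if j = i then s + c * t j else c * t j) * Y j) = s * Y i + c * (\<Sum>j\<in>J. t j * Y j)"
      for s c :: real and Y :: "'i \<Rightarrow> real"
    proof -
      have "(\<Sum>j\<in>J. (if j = i then s + c * t j else c * t j) * Y j)
          = (\<Sum>j\<in>J. (if j = i then s * Y i else 0) + c * (t j * Y j))"
        by (intro sum.cong) (auto simp: algebra_simps)
      also have "\<dots> = s * Y i + c * (\<Sum>j\<in>J. t j * Y j)"
        using J insert.prems by (simp add: sum.distrib sum_distrib_left)
      finally show ?thesis .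
    qed
    \<comment> \<open>The induction hypothesis holds for every frequency vector, in particular for
      \<open>c * t\<close> with \<open>s\<close> added at \<open>i\<close>. Only
      \<open>c = 0\<close>, \<open>1\<close> and \<open>-1\<close> are used: the first for the
      dominating weight, the other two for the cosine and sine weights.\<close>
    have IH: "(CLINT x|M1. V1 x * iexp (s * Y1 i x + c * \<theta>1 x)) = (CLINT x|M2. V2 x * iexp (s * Y2 i x + c * \<theta>2 x))" for s c
      using insert.IH[of "\<lambda>j. if j = i then s + c * t j else c * t j"] insert.prems
      unfolding upd V1_def V2_def \<theta>1_def \<theta>2_def by simp
    have eqV: "(CLINT x|M1. V1 x * iexp (s * Y1 i x)) = (CLINT x|M2. V2 x * iexp (s * Y2 i x))" for s
      using IH[of s 0] by simp
    have IHp: "(CLINT x|M1. V1 x * iexp (s * Y1 i x + \<theta>1 x)) = (CLINT x|M2. V2 x * iexp (s * Y2 i x + \<theta>2 x))" for s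
      using IH[of s 1] by simp
    have IHm: "(CLINT x|M1. V1 x * iexp (s * Y1 i x - \<theta>1 x)) = (CLINT x|M2. V2 x * iexp (s * Y2 i x - \<theta>2 x))" for s
      using IH[of s "-1"] by simp
    have mY: "(\<lambda>x. s * Y1 i x) \<in> borel_measurable M1" "(\<lambda>x. s * Y2 i x) \<in> borel_measurable M2" for s
      by auto
    note tr1 = M1.integral_trig_weight[OF \<open>V1 \<in> _\<close> \<open>\<theta>1 \<in> _\<close> mY(1) Vabs(1)]
    note tr2 = M2.integral_trig_weight[OF \<open>V2 \<in> _\<close> \<open>\<theta>2 \<in> _\<close> mY(2) Vabs(2)]
    have C: "(\<integral>x. V1 x * cos (\<theta>1 x) * indicator (S i) (Y1 i x) \<partial>M1) = (\<integral>x. V2 x * cos (\<theta>2 x) * indicator (S i) (Y2 i x) \<partial>M2)"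
    proof (rule signed_weighted_char_unique[where ?W1.0=V1 and ?W2.0=V2 and B=1, OF assms(1,2)])
      show "(CLINT x|M1. complex_of_real (V1 x * cos (\<theta>1 x)) * iexp (s * Y1 i x))
        = (CLINT x|M2. complex_of_real (V2 x * cos (\<theta>2 x)) * iexp (s * Y2 i x))" for s
        unfolding tr1 tr2 IHp IHm ..
    qed (use V eqV in \<open>auto simp: abs_mult mult_left_le\<close>)
    have D: "(\<integral>x. V1 x * sin (\<theta>1 x) * indicator (S i) (Y1 i x) \<partial>M1) = (\<integral>x. V2 x * sin (\<theta>2 x) * indicator (S i) (Y2 i x) \<partial>M2)"
    proof (rule signed_weighted_char_unique[where ?W1.0=V1 and ?W2.0=V2 and B=1, OF assms(1,2)])
      show "(CLINT x|M1. complex_of_real (V1 x * sin (\<theta>1 x)) * iexp (s * Y1 i x))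
        = (CLINT x|M2. complex_of_real (V2 x * sin (\<theta>2 x)) * iexp (s * Y2 i x))" for s
        unfolding tr1 tr2 IHp IHm ..
    qed (use V eqV in \<open>auto simp: abs_mult mult_left_le\<close>)
    have split: "(CLINT x|M. of_real (indicator A (Y x) * V x) * iexp (\<theta> x))
        = of_real (\<integral>x. V x * cos (\<theta> x) * indicator A (Y x) \<partial>M) + \<i> * of_real (\<integral>x. V x * sin (\<theta> x) * indicator A (Y x) \<partial>M)"
      if "prob_space M" "\<And>x. \<bar>V x\<bar> \<le> 1" and [measurable]: "V \<in> borel_measurable M" "\<theta> \<in> borel_measurable M"
        "Y \<in> borel_measurable M" "A \<in> sets borel"
      for V \<theta> Y :: "'c \<Rightarrow> real" and M and A :: "real set"
    proof -
      interpret prob_space M by fact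
      have *: "\<bar>V x\<bar> * \<bar>c\<bar> \<le> 1" if "\<bar>c\<bar> \<le> 1" for x c using that \<open>\<And>x. \<bar>V x\<bar> \<le> 1\<close>[of x]
        by (simp add: mult_le_one)
      have i: "integrable M (\<lambda>x. V x * cos (\<theta> x) * indicator A (Y x))" "integrable M (\<lambda>x. V x * sin (\<theta> x) * indicator A (Y x))"
        by (rule integrable_const_bound[where B=1]; auto simp: indicator_def abs_mult *)+
      have "of_real (\<integral>x. V x * cos (\<theta> x) * indicator A (Y x) \<partial>M) + \<i> * of_real (\<integral>x. V x * sin (\<theta> x) * indicator A (Y x) \<partial>M)
          = (CLINT x|M. of_real (V x * cos (\<theta> x) * indicator A (Y x)) + \<i> * of_real (V x * sin (\<theta> x) * indicator A (Y x)))"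
        by (simp only: integral_mult_right_zero integral_complex_of_real
          Bochner_Integration.integral_add[OF integrable_of_real[OF i(1)]
            integrable_mult_right[OF integrable_of_real[OF i(2)]]])
      also have "\<dots> = (CLINT x|M. of_real (indicator A (Y x) * V x) * iexp (\<theta> x))"
        by (intro Bochner_Integration.integral_cong refl)
          (simp add: exp_Euler cos_of_real sin_of_real algebra_simps)
      finally show ?thesis by simp
    qed
    have "(CLINT x|M1. of_real (indicator (S i) (Y1 i x) * V1 x) * iexp (\<theta>1 x))
        = (CLINT x|M2. of_real (indicator (S i) (Y2 i x) * V2 x) * iexp (\<theta>2 x))"
      by (simp only: C D split[OF assms(1) Vabs(1) \<open>V1 \<in> _\<close> \<open>\<theta>1 \<in> _\<close> \<open>Y1 i \<in> _\<close> \<open>S i \<in> _\<close>]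
        split[OF assms(2) Vabs(2) \<open>V2 \<in> _\<close> \<open>\<theta>2 \<in> _\<close> \<open>Y2 i \<in> _\<close> \<open>S i \<in> _\<close>])
    then show ?case
      using insert.hyps by (simp add: V1_def V2_def \<theta>1_def \<theta>2_def)
  qed
qed

text \<open>With all indicators inserted and zero frequencies, the preceding lemma says that the two
  laws agree on boxes, and these determine a measure on a finite product.\<close>

lemma joint_char_unique:
  fixes Y1 :: "'i \<Rightarrow> 'a \<Rightarrow> real" and Y2 :: "'i \<Rightarrow> 'b \<Rightarrow> real"
  assumes "prob_space M1" "prob_space M2" and J: "finite J"
    and m1: "\<And>j. j \<in> J \<Longrightarrow> Y1 j \<in> borel_measurable M1"
    and m2: "\<And>j. j \<in> J \<Longrightarrow> Y2 j \<in> borel_measurable M2"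
    and eq: "\<And>t. (CLINT x|M1. iexp (\<Sum>j\<in>J. t j * Y1 j x)) = (CLINT x|M2. iexp (\<Sum>j\<in>J. t j * Y2 j x))"
  shows "distr M1 (PiM J (\<lambda>_. borel)) (\<lambda>x. \<lambda>j\<in>J. Y1 j x) = distr M2 (PiM J (\<lambda>_. borel)) (\<lambda>x. \<lambda>j\<in>J. Y2 j x)"
    (is "?P = ?Q")
proof -
  interpret M1: prob_space M1 by fact
  interpret M2: prob_space M2 by fact
  have [measurable]: "(\<lambda>x. \<lambda>j\<in>J. Y1 j x) \<in> M1 \<rightarrow>\<^sub>M PiM J (\<lambda>_. borel)"
    "(\<lambda>x. \<lambda>j\<in>J. Y2 j x) \<in> M2 \<rightarrow>\<^sub>M PiM J (\<lambda>_. borel)"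
    using m1 m2 by (auto intro!: measurable_restrict)
  interpret P: prob_space ?P by (rule M1.prob_space_distr) simp
  have box: "emeasure (distr M (PiM J (\<lambda>_. borel)) (\<lambda>x. \<lambda>j\<in>J. Y j x)) (Pi\<^sub>E J S)
     = ennreal (\<integral>x. (\<Prod>j\<in>J. indicator (S j) (Y j x)) \<partial>M)"
    if "prob_space M" and m: "\<And>j. j \<in> J \<Longrightarrow> Y j \<in> borel_measurable M" and S: "\<And>j. j \<in> J \<Longrightarrow> S j \<in> sets borel"
    for M and Y :: "'i \<Rightarrow> 'c \<Rightarrow> real" and S
  proof -
    interpret prob_space M by fact
    have [measurable]: "(\<lambda>x. \<lambda>j\<in>J. Y j x) \<in> M \<rightarrow>\<^sub>M PiM J (\<lambda>_. borel)"
      using m by (auto intro!: measurable_restrict)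
    have [measurable]: "Pi\<^sub>E J S \<in> sets (PiM J (\<lambda>_. borel))"
      using S J by (auto intro!: sets_PiM_I_finite)
    have "emeasure (distr M (PiM J (\<lambda>_. borel)) (\<lambda>x. \<lambda>j\<in>J. Y j x)) (Pi\<^sub>E J S)
       = emeasure M ((\<lambda>x. \<lambda>j\<in>J. Y j x) -` Pi\<^sub>E J S \<inter> space M)" by (rule emeasure_distr) simp_all
    also have "\<dots> = ennreal (\<integral>x. indicat_real ((\<lambda>x. \<lambda>j\<in>J. Y j x) -` Pi\<^sub>E J S \<inter> space M) x \<partial>M)"
      by (simp add: emeasure_eq_measure)
    also have "(\<integral>x. indicat_real ((\<lambda>x. \<lambda>j\<in>J. Y j x) -` Pi\<^sub>E J S \<inter> space M) x \<partial>M)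
       = (\<integral>x. (\<Prod>j\<in>J. indicator (S j) (Y j x)) \<partial>M)"
    proof (rule Bochner_Integration.integral_cong[OF refl])
      fix x assume "x \<in> space M"
      then show "indicat_real ((\<lambda>x. \<lambda>j\<in>J. Y j x) -` Pi\<^sub>E J S \<inter> space M) x = (\<Prod>j\<in>J. indicator (S j) (Y j x))"
        using J by (auto simp: indicator_def PiE_iff)
    qed
    finally show ?thesis .
  qed
  show ?thesis
  proof (rule measure_eqI_PiM_finite[OF J, where M="\<lambda>_. borel" and A="\<lambda>_. \<Pi>\<^sub>E j\<in>J. UNIV"])
    fix S :: "'i \<Rightarrow> real set" assume S: "\<And>j. j \<in> J \<Longrightarrow> S j \<in> sets borel"
    have "complex_of_real (\<integral>x. (\<Prod>j\<in>J. indicator (S j) (Y1 j x)) \<partial>M1)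
        = complex_of_real (\<integral>x. (\<Prod>j\<in>J. indicator (S j) (Y2 j x)) \<partial>M2)"
      using joint_char_unique_boxes[OF assms S, where I=J and t="\<lambda>_. 0"]
      by (simp del: of_real_prod)
    then show "emeasure ?P (Pi\<^sub>E J S) = emeasure ?Q (Pi\<^sub>E J S)"
      using box[OF assms(1) m1 S] box[OF assms(2) m2 S] by (simp del: of_real_prod)
  qed (auto simp: space_PiM intro!: prod_algebraI_finite J)
qed

section \<open>Gaussian families\<close>

text \<open>A centred point mass sits at 0 and is treated as the normal law of variance 0, so that
  one formula covers both cases of \<open>gaussian_rv\<close>.\<close>

lemma gaussian_rv_moments:
  assumes "prob_space M" "gaussian_rv M Y" "(\<integral>x. Y x \<partial>M) = 0"
  shows "integrable M (\<lambda>x. (Y x)\<^sup>2)"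
    and "char (distr M borel Y) t = exp (- (t\<^sup>2 * (\<integral>x. (Y x)\<^sup>2 \<partial>M)) / 2)"
proof -
  interpret prob_space M by fact
  have Y[measurable]: "Y \<in> borel_measurable M" using assms(2) by (simp add: gaussian_rv_def)
  obtain \<mu> where "distr M borel Y = return borel \<mu> \<or>
        (\<exists>\<sigma>>0. distr M borel Y = density lborel (\<lambda>x. ennreal (normal_density \<mu> \<sigma> x)))"
    using assms(2) by (auto simp: gaussian_rv_def)
  then have "integrable M (\<lambda>x. (Y x)\<^sup>2) \<and> char (distr M borel Y) t = exp (- (t\<^sup>2 * (\<integral>x. (Y x)\<^sup>2 \<partial>M)) / 2)"
  proof (elim disjE exE conjE)
    assume d: "distr M borel Y = return borel \<mu>"
    have "(\<integral>x. Y x \<partial>M) = (\<integral>y. y \<partial>distr M borel Y)" by (subst integral_distr) auto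
    also have "\<dots> = \<mu>" unfolding d by (subst integral_return) auto
    finally have "\<mu> = 0" using assms(3) by simp
    have "AE y in distr M borel Y. y = 0" unfolding d \<open>\<mu> = 0\<close> by (subst AE_return) auto
    then have "AE x in M. (Y x)\<^sup>2 = 0" by (subst (asm) AE_distr_iff) auto
    then have "integrable M (\<lambda>x. (Y x)\<^sup>2)" "(\<integral>x. (Y x)\<^sup>2 \<partial>M) = 0"
      by (auto intro: integrableI_bounded_set integral_eq_zero_AE
          simp: integrable_cong_AE[of _ M "\<lambda>_. 0"])
    moreover have "char (distr M borel Y) t = 1"
      unfolding d \<open>\<mu> = 0\<close> char_def by (subst integral_return) auto
    ultimately show ?thesis by simp
  next
    fix \<sigma> :: real
    assume "0 < \<sigma>" and d: "distr M borel Y = density lborel (\<lambda>x. ennreal (normal_density \<mu> \<sigma> x))"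
    have D: "distributed M lborel Y (normal_density \<mu> \<sigma>)"
      unfolding distributed_def using d by (auto simp: distr_def cong: measurable_cong_sets)
    have "\<mu> = 0" using normal_distributed_expectation[OF \<open>0 < \<sigma>\<close> D] assms(3) by simp
    have var: "(\<integral>x. (Y x)\<^sup>2 \<partial>M) = \<sigma>\<^sup>2"
      using normal_distributed_variance[OF \<open>0 < \<sigma>\<close> D] assms(3) by simp
    \<comment> \<open>The integral of a non-integrable function is 0 by convention; the value
      \<open>\<sigma>\<^sup>2\<close> is not 0, so the square is integrable.\<close>
    then have int: "integrable M (\<lambda>x. (Y x)\<^sup>2)"
      using \<open>0 < \<sigma>\<close> not_integrable_integral_eq[of M "\<lambda>x. (Y x)\<^sup>2"] by fastforce
    have N: "distributed M lborel (\<lambda>x. (Y x - \<mu>) / \<sigma>) std_normal_density"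
      using normal_standard_normal_convert[OF \<open>0 < \<sigma>\<close>] D by simp
    have "char (distr M borel Y) t = (CLINT x|M. iexp (t * Y x))"
      unfolding char_def by (subst integral_distr) auto
    also have "\<dots> = (CLINT x|M. iexp ((t * \<sigma>) * ((Y x - \<mu>) / \<sigma>)))"
      using \<open>0 < \<sigma>\<close> \<open>\<mu> = 0\<close> by simp
    also have "\<dots> = char (distr M borel (\<lambda>x. (Y x - \<mu>) / \<sigma>)) (t * \<sigma>)"
      unfolding char_def by (subst integral_distr) auto
    also have "distr M borel (\<lambda>x. (Y x - \<mu>) / \<sigma>) = std_normal_distribution"
      using distributed_distr_eq_density[OF N] by (simp add: distr_def)
    finally show ?thesis using int var by (simp add: char_std_normal_distribution power_mult_distrib)
  qed
  then show "integrable M (\<lambda>x. (Y x)\<^sup>2)"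
    and "char (distr M borel Y) t = exp (- (t\<^sup>2 * (\<integral>x. (Y x)\<^sup>2 \<partial>M)) / 2)" by auto
qed

text \<open>The characteristic function is prescribed instead of a density, because the covariance
  may be singular; linear images are then computed from the quadratic form alone.\<close>

definition gaussian_family ::
  "'w measure \<Rightarrow> 'i set \<Rightarrow> ('i \<Rightarrow> 'w \<Rightarrow> real) \<Rightarrow> ('i \<Rightarrow> 'i \<Rightarrow> real) \<Rightarrow> bool" where
  "gaussian_family M J X C \<longleftrightarrow> prob_space M \<and> finite J \<and> (\<forall>j\<in>J. X j \<in> borel_measurable M) \<and>
     (\<forall>t. (CLINT x|M. iexp (\<Sum>j\<in>J. t j * X j x)) = exp (- (\<Sum>i\<in>J. \<Sum>j\<in>J. t i * t j * C i j) / 2))"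

lemma centered_gaussian_process_subset:
  "centered_gaussian_process T M Z \<Sigma> \<Longrightarrow> F \<subseteq> T \<Longrightarrow> centered_gaussian_process F M Z \<Sigma>"
  unfolding centered_gaussian_process_def by (meson subset_eq)

lemma centered_gaussian_process_rv:
  assumes "centered_gaussian_process T M Z \<Sigma>" "t \<in> T"
  shows "gaussian_rv M (Z t)" "Z t \<in> borel_measurable M" "integrable M (\<lambda>x. (Z t x)\<^sup>2)" "(\<integral>x. (Z t x)\<^sup>2 \<partial>M) = \<Sigma> t t"
    "(\<integral>x. Z t x \<partial>M) = 0"
proof -
  have "gaussian_rv M (\<lambda>\<omega>. \<Sum>t\<in>{t}. 1 * Z t \<omega>)"
    using assms unfolding centered_gaussian_process_def
    by (elim conjE allE[of _ "{t}"] allE[of _ "\<lambda>_. 1"]) simp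
  then show *: "gaussian_rv M (Z t)" by simp
  then show "Z t \<in> borel_measurable M" by (simp add: gaussian_rv_def)
  show "(\<integral>x. (Z t x)\<^sup>2 \<partial>M) = \<Sigma> t t" using assms by (auto simp: centered_gaussian_process_def power2_eq_square)
  show 0: "(\<integral>x. Z t x \<partial>M) = 0" using assms by (auto simp: centered_gaussian_process_def)
  show "integrable M (\<lambda>x. (Z t x)\<^sup>2)"
    by (rule gaussian_rv_moments(1)[OF _ * 0]) (use assms in \<open>auto simp: centered_gaussian_process_def\<close>)
qed

lemma (in prob_space) integrable_mult_of_squares:
  fixes f g :: "'a \<Rightarrow> real"
  assumes [measurable]: "f \<in> borel_measurable M" "g \<in> borel_measurable M"
    and "integrable M (\<lambda>x. (f x)\<^sup>2)" "integrable M (\<lambda>x. (g x)\<^sup>2)"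
  shows "integrable M (\<lambda>x. f x * g x)"
proof (rule Bochner_Integration.integrable_bound)
  show "integrable M (\<lambda>x. (f x)\<^sup>2 + (g x)\<^sup>2)" using assms by simp
  have "\<bar>a * b\<bar> \<le> a\<^sup>2 + b\<^sup>2" for a b :: real
  proof -
    have "0 \<le> (\<bar>a\<bar> - \<bar>b\<bar>)\<^sup>2" "0 \<le> \<bar>a\<bar> * \<bar>b\<bar>" by simp_all
    then show ?thesis unfolding abs_mult power2_diff power2_abs by linarith
  qed
  then show "AE x in M. norm (f x * g x) \<le> norm ((f x)\<^sup>2 + (g x)\<^sup>2)" by simp
qed simp

text \<open>The joint characteristic function at \<open>t\<close> is that of a single linear
  combination at 1, and the variance of this combination is the quadratic form of the
  covariance.\<close>

lemma gaussian_family_of_process: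
  assumes G: "centered_gaussian_process T M Z \<Sigma>" and J: "finite J" "J \<subseteq> T"
  shows "gaussian_family M J Z \<Sigma>"
  unfolding gaussian_family_def
proof (intro conjI ballI allI)
  show "prob_space M" using G by (simp add: centered_gaussian_process_def)
  then interpret prob_space M .
  show "finite J" by fact
  note rv = centered_gaussian_process_rv[OF G subsetD[OF J(2)]]
  show "Z j \<in> borel_measurable M" if "j \<in> J" for j using rv(2)[OF that] .
  fix t :: "'a \<Rightarrow> real"
  let ?Y = "\<lambda>x. \<Sum>j\<in>J. t j * Z j x"
  have g: "gaussian_rv M ?Y" using G J by (auto simp: centered_gaussian_process_def)
  then have [measurable]: "?Y \<in> borel_measurable M" by (simp add: gaussian_rv_def)
  have i: "integrable M (Z j)" if "j \<in> J" for j
  proof -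
    have "integrable M (\<lambda>x. 1 * Z j x)"
      by (rule integrable_mult_of_squares) (use rv that in auto)
    then show ?thesis by simp
  qed
  have m: "(\<integral>x. ?Y x \<partial>M) = 0"
    by (subst Bochner_Integration.integral_sum) (use i rv(5) in auto)
  have ij: "integrable M (\<lambda>x. Z i x * Z j x)" if "i \<in> J" "j \<in> J" for i j
    by (rule integrable_mult_of_squares) (use rv that in auto)
  have cov: "(\<integral>x. Z i x * Z j x \<partial>M) = \<Sigma> i j" if "i \<in> J" "j \<in> J" for i j
    using G that subsetD[OF J(2)] unfolding centered_gaussian_process_def by blast
  have "(\<integral>x. (?Y x)\<^sup>2 \<partial>M) = (\<integral>x. (\<Sum>i\<in>J. \<Sum>j\<in>J. t i * t j * (Z i x * Z j x)) \<partial>M)"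
    by (simp add: power2_eq_square sum_product mult_ac)
  also have "\<dots> = (\<Sum>i\<in>J. \<Sum>j\<in>J. t i * t j * \<Sigma> i j)"
    using ij cov by (simp add: Bochner_Integration.integral_sum Bochner_Integration.integrable_sum)
  finally have v: "(\<integral>x. (?Y x)\<^sup>2 \<partial>M) = (\<Sum>i\<in>J. \<Sum>j\<in>J. t i * t j * \<Sigma> i j)" .
  have "(CLINT x|M. iexp (?Y x)) = char (distr M borel ?Y) 1"
    unfolding char_def by (subst integral_distr) auto
  then show "(CLINT x|M. iexp (?Y x)) = exp (- (\<Sum>i\<in>J. \<Sum>j\<in>J. t i * t j * \<Sigma> i j) / 2)"
    using gaussian_rv_moments(2)[OF prob_space_axioms g m, of 1] v by simp
qed

lemma gaussian_family_law:
  fixes J :: "'i set"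
  assumes X: "gaussian_family M J X C" and Y: "gaussian_family N J Y C"
    and [measurable]: "Measurable.pred (PiM J (\<lambda>_. borel)) Q"
  shows "measure M {x\<in>space M. Q (\<lambda>j\<in>J. X j x)} = measure N {x\<in>space N. Q (\<lambda>j\<in>J. Y j x)}"
proof -
  let ?P = "PiM J (\<lambda>_. borel) :: ('i \<Rightarrow> real) measure"
  have eq: "distr M ?P (\<lambda>x. \<lambda>j\<in>J. X j x) = distr N ?P (\<lambda>x. \<lambda>j\<in>J. Y j x)"
    by (rule joint_char_unique) (use X Y in \<open>auto simp: gaussian_family_def\<close>)
  have *: "measure L {x\<in>space L. Q (\<lambda>j\<in>J. W j x)} = measure (distr L ?P (\<lambda>x. \<lambda>j\<in>J. W j x)) {z\<in>space ?P. Q z}"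
    if "\<And>j. j \<in> J \<Longrightarrow> W j \<in> borel_measurable L" for L :: "'d measure" and W
  proof -
    have m: "(\<lambda>x. \<lambda>j\<in>J. W j x) \<in> L \<rightarrow>\<^sub>M ?P" using that by (auto intro!: measurable_restrict)
    have "{z\<in>space ?P. Q z} \<in> sets ?P" by measurable
    then show ?thesis
      by (subst measure_distr[OF m]) (auto intro!: arg_cong2[where f=measure] simp: space_PiM)
  qed
  have "measure M {x\<in>space M. Q (\<lambda>j\<in>J. X j x)} = measure (distr M ?P (\<lambda>x. \<lambda>j\<in>J. X j x)) {z\<in>space ?P. Q z}"
    by (rule *) (use X in \<open>auto simp: gaussian_family_def\<close>)
  also have "\<dots> = measure N {x\<in>space N. Q (\<lambda>j\<in>J. Y j x)}"
    unfolding eq by (rule *[symmetric]) (use Y in \<open>auto simp: gaussian_family_def\<close>)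
  finally show ?thesis .
qed

text \<open>The two factors of the product space carry independent copies, so the characteristic
  function factorises and the quadratic forms add up. Both regression on one coordinate and rotation
  of two copies are of this form.\<close>

lemma gaussian_family_mix:
  assumes X: "gaussian_family M J X C" and I: "finite I"
  shows "gaussian_family (M \<Otimes>\<^sub>M M) I (\<lambda>i z. (\<Sum>j\<in>J. c i j * X j (fst z)) + (\<Sum>j\<in>J. d i j * X j (snd z)))
    (\<lambda>i k. \<Sum>j\<in>J. \<Sum>l\<in>J. (c i j * c k l + d i j * d k l) * C j l)"
  unfolding gaussian_family_def
proof (intro conjI ballI allI)
  have "prob_space M" using X by (simp add: gaussian_family_def)
  then interpret prob_space M .
  interpret P: pair_prob_space M M ..
  show "prob_space (M \<Otimes>\<^sub>M M)" by (rule P.prob_space_axioms)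
  show "finite I" by fact
  have [measurable]: "X j \<in> borel_measurable M" if "j \<in> J" for j
    using X that by (auto simp: gaussian_family_def)
  show "(\<lambda>z. (\<Sum>j\<in>J. c i j * X j (fst z)) + (\<Sum>j\<in>J. d i j * X j (snd z))) \<in> borel_measurable (M \<Otimes>\<^sub>M M)" for i
    by measurable
  fix t :: "'c \<Rightarrow> real"
  have ch: "(CLINT x|M. iexp (\<Sum>j\<in>J. s j * X j x)) = exp (- (\<Sum>i\<in>J. \<Sum>j\<in>J. s i * s j * C i j) / 2)" for s
    using X by (auto simp: gaussian_family_def)
  define u where "u = (\<lambda>j. \<Sum>i\<in>I. t i * c i j)"
  define v where "v = (\<lambda>j. \<Sum>i\<in>I. t i * d i j)"
  have lin: "(\<Sum>i\<in>I. t i * ((\<Sum>j\<in>J. c i j * x j) + (\<Sum>j\<in>J. d i j * y j)))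
      = (\<Sum>j\<in>J. u j * x j) + (\<Sum>j\<in>J. v j * y j)" for x y :: "'b \<Rightarrow> real"
    unfolding u_def v_def
    by (simp add: distrib_left sum.distrib sum_distrib_left sum_distrib_right mult.assoc
        sum.swap[of _ I J])
  have "(CLINT z|M \<Otimes>\<^sub>M M. iexp (\<Sum>i\<in>I. t i * ((\<Sum>j\<in>J. c i j * X j (fst z)) + (\<Sum>j\<in>J. d i j * X j (snd z)))))
     = (CLINT z|M \<Otimes>\<^sub>M M. iexp (\<Sum>j\<in>J. u j * X j (fst z)) * iexp (\<Sum>j\<in>J. v j * X j (snd z)))"
    unfolding lin by (simp add: distrib_left exp_add)
  also have "\<dots> = (CLINT x|M. CLINT y|M. iexp (\<Sum>j\<in>J. u j * X j x) * iexp (\<Sum>j\<in>J. v j * X j y))"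
  proof (subst P.integral_fst'[symmetric])
    show "integrable (M \<Otimes>\<^sub>M M) (\<lambda>z. iexp (\<Sum>j\<in>J. u j * X j (fst z)) * iexp (\<Sum>j\<in>J. v j * X j (snd z)))"
      by (rule P.integrable_const_bound[where B=1]) (auto simp: norm_mult)
  qed simp
  also have "\<dots> = (CLINT x|M. iexp (\<Sum>j\<in>J. u j * X j x)) * (CLINT y|M. iexp (\<Sum>j\<in>J. v j * X j y))"
    by (simp only: integral_mult_right_zero integral_mult_left_zero)
  also have "\<dots> = exp (- (\<Sum>i\<in>J. \<Sum>j\<in>J. u i * u j * C i j) / 2 + - (\<Sum>i\<in>J. \<Sum>j\<in>J. v i * v j * C i j) / 2)"
    unfolding ch exp_add of_real_mult ..
  also have "- (\<Sum>i\<in>J. \<Sum>j\<in>J. u i * u j * C i j) / 2 + - (\<Sum>i\<in>J. \<Sum>j\<in>J. v i * v j * C i j) / 2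
     = - (\<Sum>i\<in>I. \<Sum>k\<in>I. t i * t k * (\<Sum>j\<in>J. \<Sum>l\<in>J. (c i j * c k l + d i j * d k l) * C j l)) / 2"
  proof -
    have quad: "(\<Sum>j\<in>J. \<Sum>l\<in>J. (\<Sum>i\<in>I. t i * e i j) * (\<Sum>k\<in>I. t k * e k l) * C j l)
       = (\<Sum>i\<in>I. \<Sum>k\<in>I. t i * t k * (\<Sum>j\<in>J. \<Sum>l\<in>J. e i j * e k l * C j l))" for e :: "'c \<Rightarrow> 'b \<Rightarrow> real"
    proof -
      have "(\<Sum>i\<in>I. \<Sum>k\<in>I. t i * t k * (\<Sum>j\<in>J. \<Sum>l\<in>J. e i j * e k l * C j l))
        = (\<Sum>i\<in>I. \<Sum>k\<in>I. \<Sum>j\<in>J. \<Sum>l\<in>J. t i * e i j * (t k * e k l) * C j l)"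
        by (simp add: sum_distrib_left mult_ac)
      also have "\<dots> = (\<Sum>i\<in>I. \<Sum>j\<in>J. \<Sum>l\<in>J. \<Sum>k\<in>I. t i * e i j * (t k * e k l) * C j l)"
        by (intro sum.cong refl) (subst sum.swap, intro sum.cong refl, rule sum.swap)
      also have "\<dots> = (\<Sum>j\<in>J. \<Sum>l\<in>J. \<Sum>i\<in>I. \<Sum>k\<in>I. t i * e i j * (t k * e k l) * C j l)"
        by (subst sum.swap, intro sum.cong refl, rule sum.swap)
      also have "\<dots> = (\<Sum>j\<in>J. \<Sum>l\<in>J. (\<Sum>i\<in>I. t i * e i j) * (\<Sum>k\<in>I. t k * e k l) * C j l)"
        by (simp only: sum_product) (simp only: sum_distrib_right)
      finally show ?thesis by simp
    qed
    show ?thesis unfolding u_def v_def quad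
      by (simp add: distrib_left distrib_right sum.distrib add_divide_distrib)
  qed
  finally show "(CLINT z|M \<Otimes>\<^sub>M M. iexp (\<Sum>i\<in>I. t i * ((\<Sum>j\<in>J. c i j * X j (fst z)) + (\<Sum>j\<in>J. d i j * X j (snd z)))))
    = exp (- (\<Sum>i\<in>I. \<Sum>k\<in>I. t i * t k * (\<Sum>j\<in>J. \<Sum>l\<in>J. (c i j * c k l + d i j * d k l) * C j l)) / 2)"
    by simp
qed

section \<open>Anticoncentration of Gaussian maxima\<close>

lemma std_normal_interval_le:
  assumes "a \<le> b"
  shows "measure std_normal_distribution {a<..b} \<le> b - a"
proof -
  interpret real_distribution std_normal_distribution by (rule real_dist_normal_dist)
  have d: "std_normal_density x \<le> 1" for x
  proof -
    have "1 \<le> sqrt (2 * pi)" using pi_gt3 by (simp add: real_le_rsqrt)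
    then have "1 / sqrt (2 * pi) \<le> 1" by simp
    moreover have "exp (- x\<^sup>2 / 2) \<le> 1" by simp
    ultimately show ?thesis unfolding std_normal_density_def by (intro mult_le_one) auto
  qed
  have "emeasure std_normal_distribution {a<..b} = (\<integral>\<^sup>+x. ennreal (std_normal_density x) * indicator {a<..b} x \<partial>lborel)"
    by (subst emeasure_density) auto
  also have "\<dots> \<le> (\<integral>\<^sup>+x. indicator {a<..b} x \<partial>lborel)"
    using d by (intro nn_integral_mono) (auto simp: indicator_def ennreal_le_1)
  also have "\<dots> = ennreal (b - a)" using assms by simp
  finally show ?thesis using assms by (simp add: emeasure_eq_measure)
qed

lemma std_normal_tail_pos: "0 < measure std_normal_distribution {b<..}"
proof -
  interpret real_distribution std_normal_distribution by (rule real_dist_normal_dist)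
  have "emeasure std_normal_distribution {b<..} \<noteq> 0"
  proof
    assume "emeasure std_normal_distribution {b<..} = 0"
    then have "(\<integral>\<^sup>+x. ennreal (std_normal_density x) * indicator {b<..} x \<partial>lborel) = 0"
      by (subst (asm) emeasure_density) auto
    then have "AE x in lborel. ennreal (std_normal_density x) * indicator {b<..} x = 0"
      by (subst (asm) nn_integral_0_iff_AE) auto
    then have "AE x in lborel. x \<notin> {b<..}"
    proof eventually_elim
      case (elim x)
      have "0 < std_normal_density x" by (simp add: normal_density_pos)
      then show ?case using elim by (auto simp: indicator_def)
    qed
    then have "emeasure lborel {b<..} = 0"
      by (subst (asm) AE_iff_measurable[OF _ refl]) (auto simp: greaterThan_def)
    moreover have "emeasure lborel {b<..b+1} \<le> emeasure lborel {b<..}"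
      by (rule emeasure_mono) auto
    ultimately show False by simp
  qed
  then show ?thesis by (simp add: emeasure_eq_measure zero_less_measure_iff)
qed

lemma gaussian_family_cong:
  assumes "gaussian_family M J X C" "\<And>i j. i \<in> J \<Longrightarrow> j \<in> J \<Longrightarrow> C i j = C' i j"
    "\<And>i x. i \<in> J \<Longrightarrow> X i x = X' i x"
  shows "gaussian_family M J X' C'"
proof -
  have "X i = X' i" if "i \<in> J" for i using assms(3)[OF that] by auto
  then show ?thesis using assms unfolding gaussian_family_def
    by (simp cong: sum.cong)
qed

lemma gaussian_family_std_normal:
  assumes "gaussian_family M J X C" "i \<in> J" "C i i = 1" "A \<in> sets borel"
  shows "measure M {x\<in>space M. X i x \<in> A} = measure std_normal_distribution A"
proof -
  interpret prob_space M using assms(1) by (simp add: gaussian_family_def)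
  have [measurable]: "X i \<in> borel_measurable M" "finite J" using assms by (auto simp: gaussian_family_def)
  have "distr M borel (X i) = std_normal_distribution"
  proof (rule Levy_uniqueness)
    show "real_distribution (distr M borel (X i))" by (rule real_distribution_distr) simp
    show "real_distribution std_normal_distribution" by (rule real_dist_normal_dist)
    show "char (distr M borel (X i)) = char std_normal_distribution"
    proof
      fix t
      have "(CLINT x|M. iexp (\<Sum>j\<in>J. (if j = i then t else 0) * X j x))
         = exp (- (\<Sum>k\<in>J. \<Sum>j\<in>J. (if k = i then t else 0) * (if j = i then t else 0) * C k j) / 2)"
        using assms(1) unfolding gaussian_family_def
        by (elim conjE allE[of _ "\<lambda>j. if j = i then t else 0"])
      moreover have "(\<Sum>j\<in>J. (if j = i then t else 0) * X j x) = t * X i x" for x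
        using assms by (simp add: if_distrib[of "\<lambda>z. z * _"] \<open>finite J\<close> cong: if_cong)
      moreover have "(\<Sum>k\<in>J. \<Sum>j\<in>J. (if k = i then t else 0) * (if j = i then t else 0) * C k j) = t\<^sup>2"
        using assms by (simp add: if_distrib[of "\<lambda>z. z * _"] if_distrib[of "\<lambda>z. _ * z"] \<open>finite J\<close> power2_eq_square cong: if_cong)
      ultimately have "(CLINT x|M. iexp (t * X i x)) = exp (- t\<^sup>2 / 2)" by simp
      then show "char (distr M borel (X i)) t = char std_normal_distribution t"
        unfolding char_std_normal_distribution by (subst char_def, subst integral_distr) auto
    qed
  qed
  then have "measure std_normal_distribution A = measure (distr M borel (X i)) A" by simp
  also have "\<dots> = measure M {x\<in>space M. X i x \<in> A}"
    by (subst measure_distr) (use assms(4) in \<open>auto intro!: arg_cong2[where f=measure]\<close>)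
  finally show ?thesis by simp
qed

lemma sum_sum_delta2:
  fixes C :: "'i \<Rightarrow> 'i \<Rightarrow> real"
  assumes "finite J" "p \<in> J" "q \<in> J"
  shows "(\<Sum>l\<in>J. \<Sum>m\<in>J. (if l = p then u else 0) * (if m = q then v else 0) * C l m) = u * v * C p q"
  using assms by (simp add: if_distrib[of "\<lambda>z. z * _"] if_distrib[of "\<lambda>z. _ * z"] cong: if_cong)

lemma (in pair_sigma_finite) measure_Times:
  assumes "A \<in> sets M1" "B \<in> sets M2"
  shows "measure (M1 \<Otimes>\<^sub>M M2) (A \<times> B) = measure M1 A * measure M2 B"
  unfolding measure_def using M2.emeasure_pair_measure_Times[OF assms] by (simp add: enn2real_mult)

text \<open>Gaussian regression on the coordinate \<open>i\<close>: the residuals are independent of it.\<close>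

lemma gaussian_family_regression:
  assumes G: "gaussian_family M J X C" and i: "i \<in> J" "C i i = 1"
    and sym: "\<And>j k. j \<in> J \<Longrightarrow> k \<in> J \<Longrightarrow> C j k = C k j"
  shows "gaussian_family (M \<Otimes>\<^sub>M M) J (\<lambda>j z. C i j * X i (fst z) + (X j (snd z) - C i j * X i (snd z))) C"
proof (rule gaussian_family_cong)
  have J: "finite J" using G by (simp add: gaussian_family_def)
  \<comment> \<open>The multiple of coordinate \<open>i\<close> comes from the first copy;
    \<open>?d\<close> takes the coordinate \<open>j\<close> of the second copy and removes its
    regression on \<open>i\<close>.\<close>
  let ?c = "\<lambda>j l. if l = i then C i j else 0"
  let ?d = "\<lambda>j l. (if l = j then 1 else 0) - ?c j l"
  show "gaussian_family (M \<Otimes>\<^sub>M M) J (\<lambda>j z. (\<Sum>l\<in>J. ?c j l * X l (fst z)) + (\<Sum>l\<in>J. ?d j l * X l (snd z)))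
     (\<lambda>j k. \<Sum>l\<in>J. \<Sum>m\<in>J. (?c j l * ?c k m + ?d j l * ?d k m) * C l m)"
    by (rule gaussian_family_mix[OF G J])
  have one: "(\<Sum>l\<in>J. (if l = p then u else 0) * f l) = u * f p" if "p \<in> J" for p u and f :: "'b \<Rightarrow> real"
    using that J by (simp add: if_distrib[of "\<lambda>z. z * _"] cong: if_cong)
  fix j assume j: "j \<in> J"
  show "(\<Sum>l\<in>J. ?c j l * X l (fst z)) + (\<Sum>l\<in>J. ?d j l * X l (snd z))
      = C i j * X i (fst z) + (X j (snd z) - C i j * X i (snd z))" for z
    using i j by (simp add: left_diff_distrib sum_subtractf one)
  fix k assume k: "k \<in> J"
  have "(\<Sum>l\<in>J. \<Sum>m\<in>J. (?c j l * ?c k m + ?d j l * ?d k m) * C l m)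
     = (\<Sum>l\<in>J. \<Sum>m\<in>J. ?c j l * ?c k m * C l m) + ((\<Sum>l\<in>J. \<Sum>m\<in>J. (if l = j then 1 else 0) * (if m = k then 1 else 0) * C l m)
      - (\<Sum>l\<in>J. \<Sum>m\<in>J. (if l = j then 1 else 0) * ?c k m * C l m) - (\<Sum>l\<in>J. \<Sum>m\<in>J. ?c j l * (if m = k then 1 else 0) * C l m)
      + (\<Sum>l\<in>J. \<Sum>m\<in>J. ?c j l * ?c k m * C l m))"
    unfolding sum.distrib[symmetric] sum_subtractf[symmetric]
    by (intro sum.cong refl) (simp add: algebra_simps)
  \<comment> \<open>Besides \<open>C j k\<close> there are four terms equal to
    \<open>C i j * C i k\<close>, two of each sign, because \<open>C i i = 1\<close> and
    \<open>C\<close> is symmetric.\<close>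
  also have "\<dots> = C j k"
    unfolding sum_sum_delta2[OF J i(1) i(1)] sum_sum_delta2[OF J j k]
      sum_sum_delta2[OF J j i(1)] sum_sum_delta2[OF J i(1) k]
    using i sym[OF j i(1)] by (simp add: algebra_simps)
  finally show "(\<Sum>l\<in>J. \<Sum>m\<in>J. (?c j l * ?c k m + ?d j l * ?d k m) * C l m) = C j k" .
qed

text \<open>
  The density of the maximum divided by the normal density is nondecreasing: given that the
  coordinate \<open>i\<close> equals \<open>x\<close>, it is the maximum iff the residuals of the others are below
  \<open>(1 - C i j) x\<close>. Ties are broken by an enumeration.
\<close>

lemma gaussian_max_anticoncentration:
  assumes G: "gaussian_family M J X C" and one: "\<And>i. i \<in> J \<Longrightarrow> C i i = 1"
    and sym: "\<And>j k. j \<in> J \<Longrightarrow> k \<in> J \<Longrightarrow> C j k = C k j"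
    and le: "\<And>j k. j \<in> J \<Longrightarrow> k \<in> J \<Longrightarrow> C j k \<le> 1"
  shows "measure M {x\<in>space M. (\<exists>i\<in>J. a < X i x) \<and> (\<forall>j\<in>J. X j x \<le> b)} * measure std_normal_distribution {b<..}
     \<le> measure std_normal_distribution {a<..b}"
proof -
  interpret prob_space M using G by (simp add: gaussian_family_def)
  interpret P: pair_prob_space M M ..
  have J[simp]: "finite J" and [measurable]: "\<And>i. i \<in> J \<Longrightarrow> X i \<in> borel_measurable M"
    using G by (auto simp: gaussian_family_def)
  obtain f :: "'b \<Rightarrow> nat" where f: "inj_on f J"
    using finite_imp_inj_to_nat_seg[OF J] by metis
  \<comment> \<open>\<open>win i\<close> singles out the maximiser with the smallest number
    \<open>f i\<close>, so that for nonempty \<open>J\<close> there is exactly one winner.\<close>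
  define win where "win = (\<lambda>i (z::'b \<Rightarrow> real). \<forall>j\<in>J. z j \<le> z i \<and> (f j < f i \<longrightarrow> z j < z i))"
  \<comment> \<open>\<open>R i\<close> is the condition for \<open>i\<close> to win with its value
    frozen at \<open>b\<close>; below, \<open>W\<close> has the actual value instead.
    \<open>R i\<close> involves residuals only.\<close>
  define R where "R = (\<lambda>i y. \<forall>j\<in>J. X j y - C i j * X i y \<le> (1 - C i j) * b \<and>
      (f j < f i \<longrightarrow> X j y - C i j * X i y < (1 - C i j) * b))"
  define Q where "Q = (\<lambda>i. measure M {y\<in>space M. R i y})"
  define \<mu> where "\<mu> = (\<lambda>i A. measure M {x\<in>space M. X i x \<in> A \<and> win i (\<lambda>j. X j x)})"
  have win_meas: "{x\<in>space M. X i x \<in> A \<and> win i (\<lambda>j. X j x)} \<in> sets M" if "i \<in> J" and [measurable]: "A \<in> sets borel" for i A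
    unfolding win_def using that(1) by measurable
  have R_meas: "{y\<in>space M. R i y} \<in> sets M" if "i \<in> J" for i
    unfolding R_def using that by measurable
  define W where "W = (\<lambda>i A. {z\<in>space (M \<Otimes>\<^sub>M M). X i (fst z) \<in> A \<and>
      (\<forall>j\<in>J. X j (snd z) - C i j * X i (snd z) \<le> (1 - C i j) * X i (fst z) \<and>
        (f j < f i \<longrightarrow> X j (snd z) - C i j * X i (snd z) < (1 - C i j) * X i (fst z)))})"
  have law: "\<mu> i A = measure (M \<Otimes>\<^sub>M M) (W i A)"
    if i: "i \<in> J" and [measurable]: "A \<in> sets borel" for i A
  proof -
    have [measurable]: "Measurable.pred (PiM J (\<lambda>_. borel)) (\<lambda>z. z i \<in> A \<and> win i z)"
    proof -
      let ?P = "PiM J (\<lambda>_. borel) :: ('b \<Rightarrow> real) measure"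
      have c: "(\<lambda>z. z k) \<in> borel_measurable ?P" if "k \<in> J" for k
        using that by (rule measurable_component_singleton)
      have [measurable]: "Measurable.pred ?P (\<lambda>z. z j \<le> z i)" "Measurable.pred ?P (\<lambda>z. z j < z i)" if "j \<in> J" for j
        unfolding pred_def using borel_measurable_le[OF c[OF that] c[OF i]] borel_measurable_less[OF c[OF that] c[OF i]] .
      have [measurable]: "Measurable.pred ?P (\<lambda>z. z i \<in> A)"
        by (rule measurable_compose[OF c[OF i]]) measurable
      show ?thesis unfolding win_def by measurable
    qed
    let ?Y = "\<lambda>j z. C i j * X i (fst z) + (X j (snd z) - C i j * X i (snd z))"
    have "measure M {x\<in>space M. (\<lambda>j\<in>J. X j x) i \<in> A \<and> win i (\<lambda>j\<in>J. X j x)}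
      = measure (M \<Otimes>\<^sub>M M) {x\<in>space (M \<Otimes>\<^sub>M M). (\<lambda>j\<in>J. ?Y j x) i \<in> A \<and> win i (\<lambda>j\<in>J. ?Y j x)}"
      by (rule gaussian_family_law[OF G gaussian_family_regression[OF G i one[OF i] sym]]) (simp, simp, measurable)
    then show ?thesis
      unfolding \<mu>_def win_def W_def using i one[OF i]
      by (simp add: algebra_simps cong: if_cong)
  qed
  have n: "measure M {x\<in>space M. X i x \<in> A} = measure std_normal_distribution A" if "i \<in> J" "A \<in> sets borel" for i A
    using gaussian_family_std_normal[OF G that(1) one[OF that(1)] that(2)] .
  \<comment> \<open>As \<open>C i j\<close> is at most 1, the thresholds
    \<open>(1 - C i j) * x\<close> are nondecreasing in \<open>x\<close>. Hence winning with a value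
    at most \<open>b\<close> implies \<open>R i\<close>, and \<open>R i\<close> implies winning with
    any value above \<open>b\<close>. Since value and residuals live on different factors, both
    comparisons are with a product.\<close>
  have up: "\<mu> i {a<..b} \<le> measure std_normal_distribution {a<..b} * Q i" if i: "i \<in> J" for i
  proof -
    have E[measurable]: "{x\<in>space M. X i x \<in> {a<..b}} \<in> sets M" using i by measurable
    have "\<mu> i {a<..b} \<le> measure (M \<Otimes>\<^sub>M M) ({x\<in>space M. X i x \<in> {a<..b}} \<times> {y\<in>space M. R i y})"
      unfolding law[OF i, of "{a<..b}", OF greaterThanAtMost_borel]
    proof (rule P.finite_measure_mono)
      show "{x\<in>space M. X i x \<in> {a<..b}} \<times> {y\<in>space M. R i y} \<in> sets (M \<Otimes>\<^sub>M M)"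
        using R_meas[OF i] by measurable
      have mono: "(1 - C i j) * X i x \<le> (1 - C i j) * b" if "j \<in> J" "X i x \<le> b" for j x
        using le[OF i that(1)] that(2) by (intro mult_left_mono) auto
      show "W i {a<..b}
         \<subseteq> {x\<in>space M. X i x \<in> {a<..b}} \<times> {y\<in>space M. R i y}"
        using mono unfolding R_def W_def by (fastforce simp: space_pair_measure split: if_splits)
    qed
    also have "\<dots> = measure std_normal_distribution {a<..b} * Q i"
      using P.measure_Times[OF E R_meas[OF i]] n[OF i, of "{a<..b}"] by (simp add: Q_def)
    finally show ?thesis .
  qed
  have lo: "measure std_normal_distribution {b<..} * Q i \<le> \<mu> i {b<..}" if i: "i \<in> J" for i
  proof -
    have E[measurable]: "{x\<in>space M. X i x \<in> {b<..}} \<in> sets M" using i by measurable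
    have "measure std_normal_distribution {b<..} * Q i = measure (M \<Otimes>\<^sub>M M) ({x\<in>space M. X i x \<in> {b<..}} \<times> {y\<in>space M. R i y})"
      using P.measure_Times[OF E R_meas[OF i]] n[OF i, of "{b<..}"] by (simp add: Q_def)
    also have "\<dots> \<le> \<mu> i {b<..}"
      unfolding law[OF i, of "{b<..}", OF greaterThan_borel]
    proof (rule P.finite_measure_mono)
      show "W i {b<..} \<in> sets (M \<Otimes>\<^sub>M M)"
        unfolding W_def using i by measurable
      have mono: "(1 - C i j) * b \<le> (1 - C i j) * X i x" if "j \<in> J" "b < X i x" for j x
        using le[OF i that(1)] that(2) by (intro mult_left_mono) auto
      show "{x\<in>space M. X i x \<in> {b<..}} \<times> {y\<in>space M. R i y} \<subseteq> W i {b<..}"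
        using mono unfolding R_def W_def by (fastforce simp: space_pair_measure split: if_splits)
    qed
    finally show ?thesis .
  qed
  have ex_win: "\<exists>i\<in>J. win i z" if "J \<noteq> {}" for z
  proof -
    define m where "m = Max (z ` J)"
    have "m \<in> z ` J" unfolding m_def using that by simp
    then have ne: "f ` {i\<in>J. z i = m} \<noteq> {}" by auto
    define r where "r = Min (f ` {i\<in>J. z i = m})"
    have "r \<in> f ` {i\<in>J. z i = m}" unfolding r_def using ne by (intro Min_in) auto
    then obtain i where i: "i \<in> J" "z i = m" "f i = r" by auto
    have "z j \<le> m" if "j \<in> J" for j unfolding m_def using that by simp
    moreover have "r \<le> f j" if "j \<in> J" "z j = m" for j unfolding r_def using that by (intro Min_le) auto
    ultimately have "win i z" unfolding win_def using i by (metis leD less_eq_real_def)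
    then show ?thesis using i by auto
  qed
  have "measure M {x\<in>space M. (\<exists>i\<in>J. a < X i x) \<and> (\<forall>j\<in>J. X j x \<le> b)}
      \<le> measure M (\<Union>i\<in>J. {x\<in>space M. X i x \<in> {a<..b} \<and> win i (\<lambda>j. X j x)})"
  proof (rule finite_measure_mono)
    show "(\<Union>i\<in>J. {x\<in>space M. X i x \<in> {a<..b} \<and> win i (\<lambda>j. X j x)}) \<in> sets M"
      by (intro sets.finite_UN J win_meas) auto
    show "{x\<in>space M. (\<exists>i\<in>J. a < X i x) \<and> (\<forall>j\<in>J. X j x \<le> b)} \<subseteq> (\<Union>i\<in>J. {x\<in>space M. X i x \<in> {a<..b} \<and> win i (\<lambda>j. X j x)})"
    proof clarify
      fix x k assume x: "x \<in> space M" "k \<in> J" "a < X k x" "\<forall>j\<in>J. X j x \<le> b"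
      then obtain i where i: "i \<in> J" "win i (\<lambda>j. X j x)" using ex_win by auto
      then have "X k x \<le> X i x" using x(2) unfolding win_def by (metis less_imp_le)
      then show "x \<in> (\<Union>i\<in>J. {x\<in>space M. X i x \<in> {a<..b} \<and> win i (\<lambda>j. X j x)})"
        using x i by (intro UN_I[OF i(1)]) auto
    qed
  qed
  also have "\<dots> \<le> (\<Sum>i\<in>J. \<mu> i {a<..b})"
    unfolding \<mu>_def by (intro measure_UNION_le J win_meas) auto
  also have "\<dots> \<le> measure std_normal_distribution {a<..b} * (\<Sum>i\<in>J. Q i)"
    unfolding sum_distrib_left by (intro sum_mono up)
  finally have A: "measure M {x\<in>space M. (\<exists>i\<in>J. a < X i x) \<and> (\<forall>j\<in>J. X j x \<le> b)} \<le> \<dots>" .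
  \<comment> \<open>The numbers \<open>Q i\<close> are unknown and there may be many of them, but
    the winning events above \<open>b\<close> are disjoint; this bounds the sum of all
    \<open>Q i\<close> by the inverse of the normal tail.\<close>
  have "measure std_normal_distribution {b<..} * (\<Sum>i\<in>J. Q i) \<le> (\<Sum>i\<in>J. \<mu> i {b<..})"
    unfolding sum_distrib_left by (intro sum_mono lo)
  also have "\<dots> = measure M (\<Union>i\<in>J. {x\<in>space M. X i x \<in> {b<..} \<and> win i (\<lambda>j. X j x)})"
    unfolding \<mu>_def
  proof (rule finite_measure_finite_Union[symmetric])
    show "disjoint_family_on (\<lambda>i. {x \<in> space M. X i x \<in> {b<..} \<and> win i (\<lambda>j. X j x)}) J"
      unfolding disjoint_family_on_def win_def using f
      by (auto simp: inj_on_def split: if_splits) (metis linorder_neqE_nat not_less)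
  qed (rule J, intro image_subsetI win_meas, simp_all)
  also have "\<dots> \<le> 1" by (rule prob_le_1)
  finally have B: "measure std_normal_distribution {b<..} * (\<Sum>i\<in>J. Q i) \<le> 1" .
  have "measure M {x\<in>space M. (\<exists>i\<in>J. a < X i x) \<and> (\<forall>j\<in>J. X j x \<le> b)} * measure std_normal_distribution {b<..}
     \<le> (measure std_normal_distribution {a<..b} * (\<Sum>i\<in>J. Q i)) * measure std_normal_distribution {b<..}"
    by (rule mult_right_mono[OF A]) simp
  also have "\<dots> = measure std_normal_distribution {a<..b} * (measure std_normal_distribution {b<..} * (\<Sum>i\<in>J. Q i))"
    by (simp only: mult_ac)
  also have "\<dots> \<le> measure std_normal_distribution {a<..b} * 1"
    by (rule mult_left_mono[OF B]) simp
  finally show ?thesis by simp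
qed

section \<open>Levels reached by a Gaussian process\<close>

text \<open>
  Fernique's inequality: rotating two independent copies by \<open>\<pi>/4\<close> leaves their joint law
  unchanged; the constant only needs to be at least \<open>1 + sqrt 2\<close>.
\<close>

lemma gaussian_fernique:
  fixes Z :: "'i \<Rightarrow> 'w \<Rightarrow> real"
  assumes G: "gaussian_family M F Z C" and t: "0 \<le> t"
  defines "p \<equiv> \<lambda>s. measure M {x\<in>space M. \<exists>g\<in>F. s \<le> \<bar>Z g x\<bar>}"
  shows "(1 - p t) * p (5/2 * t) \<le> (p t)\<^sup>2"
proof -
  interpret prob_space M using G by (simp add: gaussian_family_def)
  interpret P: pair_prob_space M M ..
  have F[simp]: "finite F" and [measurable]: "\<And>g. g \<in> F \<Longrightarrow> Z g \<in> borel_measurable M"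
    using G by (auto simp: gaussian_family_def)
  let ?I = "F \<times> (UNIV :: bool set)"
  \<comment> \<open>The boolean names the copy; different copies are uncorrelated.\<close>
  define C' where "C' = (\<lambda>(g, b) (h, b'). if b = (b' :: bool) then C g h else 0)"
  have one: "(\<Sum>l\<in>F. (if l = p then u else 0) * f l) = u * f p" if "p \<in> F" for p u and f :: "'i \<Rightarrow> real"
    using that by (simp add: if_distrib[of "\<lambda>z. z * _"] cong: if_cong)
  have fam: "gaussian_family (M \<Otimes>\<^sub>M M) ?I (\<lambda>(g, b) z. u b * Z g (fst z) + v b * Z g (snd z)) C'"
    if uv: "u True * u True + v True * v True = 1" "u False * u False + v False * v False = 1"
      "u True * u False + v True * v False = 0" for u v :: "bool \<Rightarrow> real"
  proof (rule gaussian_family_cong)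
    let ?c = "\<lambda>gb l. if l = fst gb then u (snd gb) else 0"
    let ?d = "\<lambda>gb l. if l = fst gb then v (snd gb) else 0"
    show "gaussian_family (M \<Otimes>\<^sub>M M) ?I (\<lambda>i z. (\<Sum>l\<in>F. ?c i l * Z l (fst z)) + (\<Sum>l\<in>F. ?d i l * Z l (snd z)))
      (\<lambda>i k. \<Sum>l\<in>F. \<Sum>m\<in>F. (?c i l * ?c k m + ?d i l * ?d k m) * C l m)"
      by (rule gaussian_family_mix[OF G]) simp
    fix i assume i: "i \<in> ?I"
    then have i1: "fst i \<in> F" by auto
    show "(\<Sum>l\<in>F. ?c i l * Z l (fst z)) + (\<Sum>l\<in>F. ?d i l * Z l (snd z))
       = (case i of (g, b) \<Rightarrow> \<lambda>z. u b * Z g (fst z) + v b * Z g (snd z)) z" for z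
      using i1 by (simp add: one split: prod.split)
    fix k assume "k \<in> ?I"
    then have k1: "fst k \<in> F" by auto
    have "(\<Sum>l\<in>F. \<Sum>m\<in>F. (?c i l * ?c k m + ?d i l * ?d k m) * C l m)
       = (\<Sum>l\<in>F. \<Sum>m\<in>F. ?c i l * ?c k m * C l m) + (\<Sum>l\<in>F. \<Sum>m\<in>F. ?d i l * ?d k m * C l m)"
      by (simp only: distrib_right sum.distrib)
    also have "\<dots> = C' i k"
    proof -
      have "u (snd i) * u (snd k) + v (snd i) * v (snd k) = (if snd i = snd k then 1 else 0)"
        using uv by (cases "snd i"; cases "snd k") (simp_all add: mult.commute)
      then show ?thesis
        unfolding sum_sum_delta2[OF F i1 k1] distrib_right[symmetric]
        by (simp add: C'_def split: prod.split)
    qed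
    finally show "(\<Sum>l\<in>F. \<Sum>m\<in>F. (?c i l * ?c k m + ?d i l * ?d k m) * C l m) = C' i k" .
  qed
  \<comment> \<open>The rotation: \<open>True\<close> gets the difference of the two copies over
    \<open>sqrt 2\<close>, and \<open>False\<close> gets their sum over
    \<open>sqrt 2\<close>.\<close>
  define u v where "u = (\<lambda>b::bool. 1 / sqrt 2)" and "v = (\<lambda>b. if b then - 1 / sqrt 2 else 1 / sqrt 2)"
  define Q where "Q = (\<lambda>z::'i \<times> bool \<Rightarrow> real. (\<forall>g\<in>F. \<bar>z (g, True)\<bar> < t) \<and> (\<exists>g\<in>F. 5/2 * t \<le> \<bar>z (g, False)\<bar>))"
  have Q: "Measurable.pred (PiM ?I (\<lambda>_. borel)) Q"
  proof -
    have [measurable]: "(\<lambda>z. z (g, b)) \<in> borel_measurable (PiM ?I (\<lambda>_. borel :: real measure))" if "g \<in> F" for g b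
      using that by (intro measurable_component_singleton) auto
    have [measurable]: "Measurable.pred (PiM ?I (\<lambda>_. borel)) (\<lambda>z. \<bar>z (g, b)\<bar> < t)"
      "Measurable.pred (PiM ?I (\<lambda>_. borel)) (\<lambda>z. 5/2 * t \<le> \<bar>z (g, b)\<bar>)" if "g \<in> F" for g b
      using that by measurable
    show ?thesis unfolding Q_def by measurable
  qed
  have fam1: "gaussian_family (M \<Otimes>\<^sub>M M) ?I (\<lambda>(g, b) z. of_bool b * Z g (fst z) + of_bool (\<not> b) * Z g (snd z)) C'"
    by (rule fam) auto
  have fam2: "gaussian_family (M \<Otimes>\<^sub>M M) ?I (\<lambda>(g, b) z. u b * Z g (fst z) + v b * Z g (snd z)) C'"
    by (rule fam) (auto simp: u_def v_def)
  have sets: "{x\<in>space M. \<exists>g\<in>F. s \<le> \<bar>Z g x\<bar>} \<in> sets M" "{x\<in>space M. \<forall>g\<in>F. \<bar>Z g x\<bar> < s} \<in> sets M" for s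
    by measurable
  have "(1 - p t) = measure M {x\<in>space M. \<forall>g\<in>F. \<bar>Z g x\<bar> < t}"
  proof -
    have "{x\<in>space M. \<forall>g\<in>F. \<bar>Z g x\<bar> < t} = space M - {x\<in>space M. \<exists>g\<in>F. t \<le> \<bar>Z g x\<bar>}"
      by (auto simp: not_le[symmetric])
    then show ?thesis unfolding p_def using prob_compl[OF sets(1)] by simp
  qed
  then have "(1 - p t) * p (5/2 * t) = measure (M \<Otimes>\<^sub>M M)
     ({x\<in>space M. \<forall>g\<in>F. \<bar>Z g x\<bar> < t} \<times> {x\<in>space M. \<exists>g\<in>F. 5/2 * t \<le> \<bar>Z g x\<bar>})"
    unfolding p_def P.measure_Times[OF sets(2) sets(1)] by (simp only:)
  also have "{x\<in>space M. \<forall>g\<in>F. \<bar>Z g x\<bar> < t} \<times> {x\<in>space M. \<exists>g\<in>F. 5/2 * t \<le> \<bar>Z g x\<bar>}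
     = {z\<in>space (M \<Otimes>\<^sub>M M). Q (\<lambda>i\<in>?I. (case i of (g, b) \<Rightarrow> \<lambda>z. of_bool b * Z g (fst z) + of_bool (\<not> b) * Z g (snd z)) z)}"
    unfolding Q_def by (auto simp: space_pair_measure)
  also have "measure (M \<Otimes>\<^sub>M M) \<dots>
     = measure (M \<Otimes>\<^sub>M M) {z\<in>space (M \<Otimes>\<^sub>M M). Q (\<lambda>i\<in>?I. (case i of (g, b) \<Rightarrow> \<lambda>z. u b * Z g (fst z) + v b * Z g (snd z)) z)}"
    by (rule gaussian_family_law[OF fam1 fam2 Q])
  also have "\<dots> \<le> measure (M \<Otimes>\<^sub>M M) ({x\<in>space M. \<exists>g\<in>F. t \<le> \<bar>Z g x\<bar>} \<times> {x\<in>space M. \<exists>g\<in>F. t \<le> \<bar>Z g x\<bar>})"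
  proof (rule P.finite_measure_mono)
    show "{x\<in>space M. \<exists>g\<in>F. t \<le> \<bar>Z g x\<bar>} \<times> {x\<in>space M. \<exists>g\<in>F. t \<le> \<bar>Z g x\<bar>} \<in> sets (M \<Otimes>\<^sub>M M)"
      by (intro pair_measureI sets)
    have key: "t \<le> \<bar>a\<bar> \<and> t \<le> \<bar>b\<bar>"
      if "\<bar>1 / sqrt 2 * a + - 1 / sqrt 2 * b\<bar> < t" "5/2 * t \<le> \<bar>1 / sqrt 2 * a + 1 / sqrt 2 * b\<bar>" for a b :: real
    proof -
      have "1 / sqrt 2 * a + - 1 / sqrt 2 * b = (a - b) / sqrt 2" "1 / sqrt 2 * a + 1 / sqrt 2 * b = (a + b) / sqrt 2"
        by (simp_all add: field_simps)
      then have "\<bar>a - b\<bar> / sqrt 2 < t" "5/2 * t \<le> \<bar>a + b\<bar> / sqrt 2" using that by simp_all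
      then have "\<bar>a - b\<bar> < sqrt 2 * t" "5/2 * (sqrt 2 * t) \<le> \<bar>a + b\<bar>"
        by (simp_all add: field_simps)
      \<comment> \<open>Twice the smaller of |a| and |b| is at least |a + b| - |a - b|, which
        exceeds \<open>3/2 * sqrt 2 * t\<close>. This is at least \<open>2 * t\<close> because
        \<open>sqrt 2\<close> is at least 4/3.\<close>
      moreover have "4 * t \<le> 3 * (sqrt 2 * t)"
      proof -
        have "(4/3)\<^sup>2 \<le> (2::real)" by (simp add: power2_eq_square)
        then have "4/3 \<le> sqrt (2::real)" by (rule real_le_rsqrt)
        then have "4/3 * t \<le> sqrt 2 * t" using t by (rule mult_right_mono)
        then show ?thesis by simp
      qed
      ultimately show ?thesis by arith
    qed
    show "{z\<in>space (M \<Otimes>\<^sub>M M). Q (\<lambda>i\<in>?I. (case i of (g, b) \<Rightarrow> \<lambda>z. u b * Z g (fst z) + v b * Z g (snd z)) z)}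
      \<subseteq> {x\<in>space M. \<exists>g\<in>F. t \<le> \<bar>Z g x\<bar>} \<times> {x\<in>space M. \<exists>g\<in>F. t \<le> \<bar>Z g x\<bar>}"
    proof
      fix z assume "z \<in> {z\<in>space (M \<Otimes>\<^sub>M M). Q (\<lambda>i\<in>?I. (case i of (g, b) \<Rightarrow> \<lambda>z. u b * Z g (fst z) + v b * Z g (snd z)) z)}"
      then have z: "fst z \<in> space M" "snd z \<in> space M"
        and Qz: "Q (\<lambda>i\<in>?I. (case i of (g, b) \<Rightarrow> \<lambda>z. u b * Z g (fst z) + v b * Z g (snd z)) z)"
        by (auto simp: space_pair_measure)
      have lt: "\<bar>1 / sqrt 2 * Z g (fst z) + - 1 / sqrt 2 * Z g (snd z)\<bar> < t" if "g \<in> F" for g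
        using Qz that unfolding Q_def u_def v_def by force
      obtain g where g: "g \<in> F" "5/2 * t \<le> \<bar>1 / sqrt 2 * Z g (fst z) + 1 / sqrt 2 * Z g (snd z)\<bar>"
        using Qz unfolding Q_def u_def v_def by force
      have "t \<le> \<bar>Z g (fst z)\<bar> \<and> t \<le> \<bar>Z g (snd z)\<bar>" by (rule key[OF lt[OF g(1)] g(2)])
      then show "z \<in> {x\<in>space M. \<exists>g\<in>F. t \<le> \<bar>Z g x\<bar>} \<times> {x\<in>space M. \<exists>g\<in>F. t \<le> \<bar>Z g x\<bar>}"
        using g(1) z by (auto simp: mem_Times_iff)
    qed
  qed
  also have "\<dots> = (p t)\<^sup>2"
    unfolding p_def using P.measure_Times[OF sets(1) sets(1)] by (simp add: power2_eq_square)
  finally show ?thesis .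
qed

lemma gaussian_process_chebyshev:
  assumes G: "centered_gaussian_process T M Z \<Sigma>" and "g \<in> T" "\<Sigma> g g \<le> K" "0 < t"
  shows "measure M {x\<in>space M. t \<le> \<bar>Z g x\<bar>} \<le> K / t\<^sup>2"
proof -
  interpret prob_space M using G by (simp add: centered_gaussian_process_def)
  note rv = centered_gaussian_process_rv[OF G \<open>g \<in> T\<close>]
  have "{x\<in>space M. t \<le> \<bar>Z g x\<bar>} = {x\<in>space M. t\<^sup>2 \<le> (Z g x)\<^sup>2}"
    using \<open>0 < t\<close> by (auto simp: abs_le_square_iff[symmetric])
  then have "measure M {x\<in>space M. t \<le> \<bar>Z g x\<bar>} \<le> (\<integral>x. (Z g x)\<^sup>2 \<partial>M) / t\<^sup>2"
    using integral_Markov_inequality_measure[OF rv(3), of "space M" "t\<^sup>2"] \<open>0 < t\<close> by simp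
  also have "\<dots> \<le> K / t\<^sup>2" using rv(4) assms by (simp add: divide_right_mono)
  finally show ?thesis .
qed

text \<open>
  A minimal subfamily whose absolute maximum exceeds \<open>t\<close> with probability at least \<open>\<alpha>\<close> exceeds
  it with probability at most \<open>2 \<alpha>\<close>, so Fernique's inequality controls the overshoot.
\<close>

lemma gaussian_level_hit:
  assumes G: "centered_gaussian_process F M Z \<Sigma>" and F: "finite F"
    and K: "\<And>g. g \<in> F \<Longrightarrow> \<Sigma> g g \<le> K" and \<alpha>: "0 < \<alpha>" "\<alpha> \<le> 1/10" and t: "0 < t" "K \<le> \<alpha> * t\<^sup>2"
    and big: "\<alpha> \<le> measure M {x\<in>space M. \<exists>g\<in>F. t \<le> \<bar>Z g x\<bar>}"
  shows "\<alpha> / 2 \<le> measure M {x\<in>space M. \<exists>g\<in>F. t \<le> \<bar>Z g x\<bar> \<and> \<bar>Z g x\<bar> < 5/2 * t}"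
proof -
  interpret prob_space M using G by (simp add: centered_gaussian_process_def)
  have Zm[measurable]: "\<And>g. g \<in> F \<Longrightarrow> Z g \<in> borel_measurable M"
    using centered_gaussian_process_rv[OF G] by auto
  define p where "p = (\<lambda>A s. measure M {x\<in>space M. \<exists>g\<in>A. s \<le> \<bar>Z g x\<bar>})"
  obtain A where A: "A \<subseteq> F" "\<alpha> \<le> p A t" and least: "\<And>B. B \<subseteq> F \<Longrightarrow> \<alpha> \<le> p B t \<Longrightarrow> card A \<le> card B"
    using ex_has_least_nat[of "\<lambda>A. A \<subseteq> F \<and> \<alpha> \<le> p A t" F card] big by (auto simp: p_def)
  have fA: "finite A" using A F finite_subset by auto
  have Zm'[measurable]: "\<And>g. g \<in> A \<Longrightarrow> Z g \<in> borel_measurable M" using A by auto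
  have "A \<noteq> {}" using A \<alpha> by (auto simp: p_def)
  then obtain g where g: "g \<in> A" by auto
  let ?B = "A - {g}"
  have "card ?B < card A" using g fA by (rule card_Diff1_less[rotated])
  \<comment> \<open>Minimality puts the family without \<open>g\<close> below \<alpha>, and by
    Chebyshev's inequality the single member \<open>g\<close> adds at most
    \<open>K / t\<^sup>2\<close>, which is at most \<alpha>.\<close>
  then have "p ?B t < \<alpha>" using least[of ?B] A by force
  moreover have "p A t \<le> p ?B t + measure M {x\<in>space M. t \<le> \<bar>Z g x\<bar>}"
  proof -
    have "p A t \<le> measure M ({x\<in>space M. \<exists>h\<in>?B. t \<le> \<bar>Z h x\<bar>} \<union> {x\<in>space M. t \<le> \<bar>Z g x\<bar>})"
      unfolding p_def using fA g by (intro finite_measure_mono) (auto, measurable)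
    also have "\<dots> \<le> p ?B t + measure M {x\<in>space M. t \<le> \<bar>Z g x\<bar>}"
      unfolding p_def using fA g by (intro measure_Un_le) (auto, measurable)
    finally show ?thesis .
  qed
  moreover have "measure M {x\<in>space M. t \<le> \<bar>Z g x\<bar>} \<le> \<alpha>"
  proof -
    have "measure M {x\<in>space M. t \<le> \<bar>Z g x\<bar>} \<le> K / t\<^sup>2"
      using gaussian_process_chebyshev[OF G _ K t(1)] g A by auto
    also have "\<dots> \<le> \<alpha>" using t by (simp add: divide_le_eq)
    finally show ?thesis .
  qed
  ultimately have p2: "p A t \<le> 2 * \<alpha>" by simp
  have fern: "(1 - p A t) * p A (5/2 * t) \<le> (p A t)\<^sup>2"
    unfolding p_def by (rule gaussian_fernique[OF gaussian_family_of_process[OF G fA A(1)]]) (use t in simp)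
  have "0 \<le> p A (5/2 * t)" "0 \<le> p A t" by (auto simp: p_def)
  \<comment> \<open>Since \<open>p A t\<close> is at most 1/5, Fernique's inequality gives an
    overshoot of at most a quarter of \<open>p A t\<close>. Three quarters remain in the window,
    more than the half that is claimed.\<close>
  have "4/5 * p A (5/2 * t) \<le> (1 - p A t) * p A (5/2 * t)"
    using p2 \<alpha> \<open>0 \<le> p A (5/2 * t)\<close> by (intro mult_right_mono) auto
  also have "\<dots> \<le> p A t * p A t" using fern by (simp add: power2_eq_square)
  also have "\<dots> \<le> 1/5 * p A t" using p2 \<alpha> \<open>0 \<le> p A t\<close> by (intro mult_right_mono) auto
  finally have over: "p A (5/2 * t) \<le> p A t / 4" by simp
  have "p A t \<le> measure M ({x\<in>space M. \<exists>g\<in>F. t \<le> \<bar>Z g x\<bar> \<and> \<bar>Z g x\<bar> < 5/2 * t} \<union> {x\<in>space M. \<exists>g\<in>A. 5/2 * t \<le> \<bar>Z g x\<bar>})"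
    unfolding p_def
  proof (rule finite_measure_mono)
    show "{x \<in> space M. \<exists>g\<in>A. t \<le> \<bar>Z g x\<bar>}
     \<subseteq> {x \<in> space M. \<exists>g\<in>F. t \<le> \<bar>Z g x\<bar> \<and> \<bar>Z g x\<bar> < 5 / 2 * t} \<union> {x \<in> space M. \<exists>g\<in>A. 5 / 2 * t \<le> \<bar>Z g x\<bar>}"
      using A(1) by (auto simp: not_le[symmetric])
    show "{x \<in> space M. \<exists>g\<in>F. t \<le> \<bar>Z g x\<bar> \<and> \<bar>Z g x\<bar> < 5 / 2 * t} \<union> {x \<in> space M. \<exists>g\<in>A. 5 / 2 * t \<le> \<bar>Z g x\<bar>} \<in> events"
      using F fA by measurable
  qed
  also have "\<dots> \<le> measure M {x\<in>space M. \<exists>g\<in>F. t \<le> \<bar>Z g x\<bar> \<and> \<bar>Z g x\<bar> < 5/2 * t} + p A (5/2 * t)"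
    unfolding p_def using F fA by (intro measure_Un_le) measurable
  finally have "p A t - p A t / 4 \<le> measure M {x\<in>space M. \<exists>g\<in>F. t \<le> \<bar>Z g x\<bar> \<and> \<bar>Z g x\<bar> < 5/2 * t}"
    using over by simp
  then show ?thesis using A(2) \<alpha> by linarith
qed

section \<open>Paths that take few values up to unit errors\<close>

text \<open>A covering number condition: the values on \<open>F\<close> split into at most
  \<open>m\<close> groups of diameter at most 1. The grouping is a labelling from a finite function
  set, which makes the event a finite union and so measurable.\<close>

definition clustered :: "'i set \<Rightarrow> nat \<Rightarrow> ('i \<Rightarrow> real) \<Rightarrow> bool" where
  "clustered F m z \<longleftrightarrow> (\<exists>\<kappa>\<in>F \<rightarrow>\<^sub>E {..<m}. \<forall>g\<in>F. \<forall>h\<in>F. \<kappa> g = \<kappa> h \<longrightarrow> \<bar>z g - z h\<bar> \<le> 1)"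

lemma clustered_cong: "(\<And>g. g \<in> F \<Longrightarrow> z g = z' g) \<Longrightarrow> clustered F m z = clustered F m z'"
  unfolding clustered_def by simp

lemma pred_clustered:
  assumes "finite F" and [measurable]: "\<And>g. g \<in> F \<Longrightarrow> Z g \<in> borel_measurable M"
  shows "Measurable.pred M (\<lambda>x. clustered F m (\<lambda>g. Z g x))"
proof -
  have [measurable]: "Measurable.pred M (\<lambda>x. \<bar>Z g x - Z h x\<bar> \<le> 1)" if "g \<in> F" "h \<in> F" for g h
    using that by measurable
  have "finite (F \<rightarrow>\<^sub>E {..<m})" using assms(1) by (intro finite_PiE) auto
  then show ?thesis unfolding clustered_def using assms(1) by measurable
qed

text \<open>A window ends at 5/2 times its lower end, the constant of Fernique's inequality, and the
  next one begins at 3 times it. With \<open>t\<close> at least 4 the gap is at least 2, so members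
  in different windows carry different labels.\<close>

lemma clustered_levels_card:
  assumes "clustered F m z" and t: "4 \<le> (t::real)"
  shows "card {i. i < D \<and> (\<exists>g\<in>F. t * 3 ^ i \<le> \<bar>z g\<bar> \<and> \<bar>z g\<bar> < 5/2 * (t * 3 ^ i))} \<le> m" (is "card ?L \<le> m")
proof -
  obtain \<kappa> where \<kappa>: "\<kappa> \<in> F \<rightarrow>\<^sub>E {..<m}" "\<And>g h. g \<in> F \<Longrightarrow> h \<in> F \<Longrightarrow> \<kappa> g = \<kappa> h \<Longrightarrow> \<bar>z g - z h\<bar> \<le> 1"
    using assms(1) unfolding clustered_def by auto
  have "\<forall>i\<in>?L. \<exists>g. g \<in> F \<and> t * 3 ^ i \<le> \<bar>z g\<bar> \<and> \<bar>z g\<bar> < 5/2 * (t * 3 ^ i)" by auto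
  from bchoice[OF this] obtain G
    where G: "\<And>i. i \<in> ?L \<Longrightarrow> G i \<in> F \<and> t * 3 ^ i \<le> \<bar>z (G i)\<bar> \<and> \<bar>z (G i)\<bar> < 5/2 * (t * 3 ^ i)"
    by blast
  have less: False if "i \<in> ?L" "j \<in> ?L" "i < j" "\<kappa> (G i) = \<kappa> (G j)" for i j
  proof -
    have "\<bar>z (G i) - z (G j)\<bar> \<le> 1" using G that \<kappa>(2) by blast
    moreover have "\<bar>z (G i)\<bar> < 5/2 * (t * 3 ^ i)" "t * 3 ^ j \<le> \<bar>z (G j)\<bar>" using G that by auto
    moreover have "t * (3 * 3 ^ i) \<le> t * 3 ^ j"
      using t that(3) power_increasing[of "Suc i" j "3::real"] by (intro mult_left_mono) auto
    moreover have "4 * 1 \<le> t * 3 ^ i" using t by (intro mult_mono) auto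
    ultimately show False by linarith
  qed
  have "inj_on (\<lambda>i. \<kappa> (G i)) ?L"
  proof (rule inj_onI, rule ccontr)
    fix i j assume ij: "i \<in> ?L" "j \<in> ?L" "\<kappa> (G i) = \<kappa> (G j)" "i \<noteq> j"
    then consider "i < j" | "j < i" by linarith
    then show False using less[OF ij(1,2) _ ij(3)] less[OF ij(2,1) _ ij(3)[symmetric]] by cases
  qed
  moreover have "(\<lambda>i. \<kappa> (G i)) ` ?L \<subseteq> {..<m}" using G \<kappa>(1) by fastforce
  ultimately have "card ?L \<le> card {..<m}" by (intro card_inj_on_le) auto
  then show ?thesis by simp
qed

text \<open>
  If the process exceeded a high level, all lower levels would be hit, but a process that takes
  few values up to unit errors cannot hit many separated levels.
\<close>

lemma gaussian_clustered_bound: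
  assumes G: "centered_gaussian_process F M Z \<Sigma>" and F: "finite F"
    and K: "\<And>g. g \<in> F \<Longrightarrow> \<Sigma> g g \<le> K" and \<alpha>: "0 < \<alpha>" "\<alpha> \<le> 1/10" and t: "4 \<le> t" "K \<le> \<alpha> * t\<^sup>2"
    and cl: "1 - \<alpha> / 4 \<le> measure M {x\<in>space M. clustered F m (\<lambda>g. Z g x)}"
    and D: "4 * real m < \<alpha> * real D"
  shows "measure M {x\<in>space M. \<exists>g\<in>F. t * 3 ^ D \<le> \<bar>Z g x\<bar>} < \<alpha>"
proof (rule ccontr)
  assume "\<not> ?thesis"
  then have big: "\<alpha> \<le> measure M {x\<in>space M. \<exists>g\<in>F. t * 3 ^ D \<le> \<bar>Z g x\<bar>}" by simp
  interpret prob_space M using G by (simp add: centered_gaussian_process_def)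
  have Zm[measurable]: "\<And>g. g \<in> F \<Longrightarrow> Z g \<in> borel_measurable M"
    using centered_gaussian_process_rv[OF G] by auto
  define L where "L = (\<lambda>i. {x\<in>space M. \<exists>g\<in>F. t * 3 ^ i \<le> \<bar>Z g x\<bar> \<and> \<bar>Z g x\<bar> < 5/2 * (t * 3 ^ i)})"
  define U where "U = {x\<in>space M. \<not> clustered F m (\<lambda>g. Z g x)}"
  have L[measurable]: "L i \<in> sets M" for i unfolding L_def using F by measurable
  have clm[measurable]: "Measurable.pred M (\<lambda>x. clustered F m (\<lambda>g. Z g x))"
    by (rule pred_clustered[OF F Zm])
  have U[measurable]: "U \<in> sets M" unfolding U_def by measurable
  have PU: "measure M U \<le> \<alpha> / 4"
  proof -
    have "U = space M - {x\<in>space M. clustered F m (\<lambda>g. Z g x)}" by (auto simp: U_def)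
    then have "measure M U = 1 - measure M {x\<in>space M. clustered F m (\<lambda>g. Z g x)}"
      by (simp add: prob_compl)
    then show ?thesis using cl by simp
  qed
  have hit: "\<alpha> / 2 \<le> measure M (L i)" if "i < D" for i
    unfolding L_def
  proof (rule gaussian_level_hit[OF G F K \<alpha>])
    show "0 < t * 3 ^ i" using t by simp
    have "(1::real) \<le> 3 ^ i" by simp
    then have le: "t \<le> t * 3 ^ i" using t by (simp add: mult_le_cancel_left1)
    then have "t\<^sup>2 \<le> (t * 3 ^ i)\<^sup>2" using t by (intro power_mono) auto
    then have "\<alpha> * t\<^sup>2 \<le> \<alpha> * (t * 3 ^ i)\<^sup>2" using \<alpha> by (intro mult_left_mono) auto
    then show "K \<le> \<alpha> * (t * 3 ^ i)\<^sup>2" using t(2) by linarith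
    have "t * 3 ^ i \<le> t * 3 ^ D" using t that by (intro mult_left_mono power_increasing) auto
    then have "{x\<in>space M. \<exists>g\<in>F. t * 3 ^ D \<le> \<bar>Z g x\<bar>} \<subseteq> {x\<in>space M. \<exists>g\<in>F. t * 3 ^ i \<le> \<bar>Z g x\<bar>}"
      by force
    moreover have "{x\<in>space M. \<exists>g\<in>F. t * 3 ^ i \<le> \<bar>Z g x\<bar>} \<in> sets M" using F by measurable
    ultimately show "\<alpha> \<le> measure M {x\<in>space M. \<exists>g\<in>F. t * 3 ^ i \<le> \<bar>Z g x\<bar>}"
      using big by (meson finite_measure_mono order_trans)
  qed
  \<comment> \<open>Double counting of the expected number of windows hit: it is at least
    \<open>D * \<alpha> / 2\<close>, but at most \<open>m\<close> on clustered paths and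
    \<open>D\<close> on the others, whose probability is at most
    \<open>\<alpha> / 4\<close>.\<close>
  have "real D * (\<alpha> / 2) = (\<Sum>i<D. \<alpha> / 2)" by simp
  also have "\<dots> \<le> (\<Sum>i<D. measure M (L i))" by (intro sum_mono hit) simp
  also have "\<dots> = (\<integral>x. (\<Sum>i<D. indicator (L i) x) \<partial>M)" by (simp add: less_top[symmetric])
  also have "\<dots> \<le> (\<integral>x. real m + real D * indicator U x \<partial>M)"
  proof (rule integral_mono)
    show "integrable M (\<lambda>x. \<Sum>i<D. indicat_real (L i) x)" by (simp add: less_top[symmetric])
    show "integrable M (\<lambda>x. real m + real D * indicat_real U x)" by (simp add: less_top[symmetric])
    fix x assume x: "x \<in> space M"
    have "(\<Sum>i<D. indicat_real (L i) x) = real (card {i. i < D \<and> x \<in> L i})"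
      by (simp add: indicator_def sum.If_cases Int_def)
    also have "\<dots> \<le> real m + real D * indicator U x"
    proof (cases "x \<in> U")
      case True
      have "card {i. i < D \<and> x \<in> L i} \<le> card {..<D}" by (intro card_mono) auto
      then show ?thesis using True by simp
    next
      case False
      then have "clustered F m (\<lambda>g. Z g x)" using x by (simp add: U_def)
      from clustered_levels_card[OF this t(1), of D] have "card {i. i < D \<and> x \<in> L i} \<le> m"
        using x by (simp add: L_def)
      then show ?thesis using False by simp
    qed
    finally show "(\<Sum>i<D. indicat_real (L i) x) \<le> real m + real D * indicator U x" .
  qed
  also have "\<dots> = real m + real D * measure M U" by (simp add: less_top[symmetric] prob_space)
  also have "\<dots> \<le> real m + real D * (\<alpha> / 4)" using PU by (intro add_left_mono mult_left_mono) auto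
  finally show False using D by (simp add: algebra_simps)
qed

text \<open>\<open>z\<close> is half the difference of the two shifted paths, so
  \<open>\<beta>\<close> cancels. Pairs of labels, coded as
  \<open>\<kappa> g * m + \<kappa>' g\<close>, serve as new labels; within a class the two errors
  are averaged and stay at most 1.\<close>

lemma clustered_symmetric:
  assumes "clustered F m (\<lambda>g. z g + \<beta> g)" "clustered F m (\<lambda>g. - z g + \<beta> g)"
  shows "clustered F (m * m) z"
proof -
  obtain \<kappa> where \<kappa>: "\<kappa> \<in> F \<rightarrow>\<^sub>E {..<m}" "\<And>g h. g \<in> F \<Longrightarrow> h \<in> F \<Longrightarrow> \<kappa> g = \<kappa> h \<Longrightarrow> \<bar>(z g + \<beta> g) - (z h + \<beta> h)\<bar> \<le> 1"
    using assms(1) unfolding clustered_def by auto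
  obtain \<kappa>' where \<kappa>': "\<kappa>' \<in> F \<rightarrow>\<^sub>E {..<m}" "\<And>g h. g \<in> F \<Longrightarrow> h \<in> F \<Longrightarrow> \<kappa>' g = \<kappa>' h \<Longrightarrow> \<bar>(- z g + \<beta> g) - (- z h + \<beta> h)\<bar> \<le> 1"
    using assms(2) unfolding clustered_def by auto
  have lt: "\<kappa> g < m" "\<kappa>' g < m" if "g \<in> F" for g using \<kappa>(1) \<kappa>'(1) that by auto
  have "\<kappa> g * m + \<kappa>' g < m * m" if "g \<in> F" for g
  proof -
    have "\<kappa> g * m + \<kappa>' g < Suc (\<kappa> g) * m" using lt[OF that] by simp
    also have "\<dots> \<le> m * m" using lt[OF that] by (intro mult_le_mono1) simp
    finally show ?thesis .
  qed
  then have "(\<lambda>g\<in>F. \<kappa> g * m + \<kappa>' g) \<in> F \<rightarrow>\<^sub>E {..<m * m}" by auto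
  moreover have "\<bar>z g - z h\<bar> \<le> 1" if "g \<in> F" "h \<in> F" "\<kappa> g * m + \<kappa>' g = \<kappa> h * m + \<kappa>' h" for g h
  proof -
    have "(\<kappa> g * m + \<kappa>' g) div m = \<kappa> g" "(\<kappa> h * m + \<kappa>' h) div m = \<kappa> h"
      using lt[OF that(1)] lt[OF that(2)] by simp_all
    then have "\<kappa> g = \<kappa> h" using that(3) by simp
    moreover from this have "\<kappa>' g = \<kappa>' h" using that(3) by simp
    ultimately show ?thesis using \<kappa>(2)[OF that(1,2)] \<kappa>'(2)[OF that(1,2)] by linarith
  qed
  ultimately show ?thesis unfolding clustered_def by (intro bexI[of _ "\<lambda>g\<in>F. \<kappa> g * m + \<kappa>' g"]) auto
qed

text \<open>Symmetry of the law removes an arbitrary deterministic shift.\<close>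

lemma gaussian_clustered_shift:
  assumes G: "gaussian_family M F Z C"
    and cl: "1 - \<delta> \<le> measure M {x\<in>space M. clustered F m (\<lambda>g. Z g x + \<beta> g)}"
  shows "1 - 2 * \<delta> \<le> measure M {x\<in>space M. clustered F (m * m) (\<lambda>g. Z g x)}"
proof -
  interpret prob_space M using G by (simp add: gaussian_family_def)
  have F: "finite F" and Zm[measurable]: "\<And>g. g \<in> F \<Longrightarrow> Z g \<in> borel_measurable M"
    using G by (auto simp: gaussian_family_def)
  have N: "gaussian_family M F (\<lambda>g x. - Z g x) C"
    unfolding gaussian_family_def
  proof (intro conjI ballI allI prob_space_axioms F)
    fix t
    show "(CLINT x|M. iexp (\<Sum>j\<in>F. t j * - Z j x)) = exp (- (\<Sum>i\<in>F. \<Sum>j\<in>F. t i * t j * C i j) / 2)"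
      using G unfolding gaussian_family_def
      by (elim conjE allE[of _ "\<lambda>j. - t j"]) simp
  qed simp
  let ?Q = "\<lambda>z. clustered F m (\<lambda>g. z g + \<beta> g)"
  have Q: "Measurable.pred (PiM F (\<lambda>_. borel)) ?Q"
  proof (rule pred_clustered[OF F])
    fix g assume "g \<in> F"
    then have "(\<lambda>z. z g) \<in> borel_measurable (PiM F (\<lambda>_. borel :: real measure))"
      by (rule measurable_component_singleton)
    then show "(\<lambda>z. z g + \<beta> g) \<in> borel_measurable (PiM F (\<lambda>_. borel :: real measure))" by simp
  qed
  have res: "?Q (\<lambda>g\<in>F. W g) = clustered F m (\<lambda>g. W g + \<beta> g)" for W
    by (rule clustered_cong) simp
  have "measure M {x\<in>space M. ?Q (\<lambda>g\<in>F. Z g x)} = measure M {x\<in>space M. ?Q (\<lambda>g\<in>F. - Z g x)}"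
    by (rule gaussian_family_law[OF G N Q])
  then have cl': "1 - \<delta> \<le> measure M {x\<in>space M. clustered F m (\<lambda>g. - Z g x + \<beta> g)}"
    using cl unfolding res by simp
  have [measurable]: "Measurable.pred M (\<lambda>x. clustered F m (\<lambda>g. Z g x + \<beta> g))"
    "Measurable.pred M (\<lambda>x. clustered F m (\<lambda>g. - Z g x + \<beta> g))"
    "Measurable.pred M (\<lambda>x. clustered F (m * m) (\<lambda>g. Z g x))"
    by (rule pred_clustered[OF F]; measurable)+
  let ?A = "{x\<in>space M. clustered F m (\<lambda>g. Z g x + \<beta> g)}"
  let ?B = "{x\<in>space M. clustered F m (\<lambda>g. - Z g x + \<beta> g)}"
  have A: "?A \<in> fmeasurable M" unfolding fmeasurable_eq_sets by measurable
  have B: "?B \<in> fmeasurable M" unfolding fmeasurable_eq_sets by measurable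
  have "measure M (?A \<union> ?B) \<le> 1" by (rule prob_le_1)
  moreover have "measure M (?A \<union> ?B) + measure M (?A \<inter> ?B) = measure M ?A + measure M ?B"
    using measure_Un3[OF A B] by linarith
  moreover have "measure M (?A \<inter> ?B) \<le> measure M {x\<in>space M. clustered F (m * m) (\<lambda>g. Z g x)}"
  proof (rule finite_measure_mono)
    show "?A \<inter> ?B \<subseteq> {x\<in>space M. clustered F (m * m) (\<lambda>g. Z g x)}"
      by (auto intro: clustered_symmetric[where \<beta>=\<beta>])
  qed measurable
  ultimately show ?thesis using cl cl' by linarith
qed

section \<open>Bounded processes\<close>

lemma linf_bounded:
  assumes "y \<in> mspace (linf T)"
  obtains B where "\<And>t. t \<in> T \<Longrightarrow> \<bar>y t\<bar> \<le> B"
proof -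
  have "T = {} \<or> (\<exists>c B. \<forall>x\<in>T. mdist euclidean_metric c (y x) \<le> B)"
    using assms unfolding linf_def by (rule funspace_imp_bounded)
  then consider "T = {}" | c B where "\<forall>x\<in>T. dist c (y x) \<le> B" by auto
  then show ?thesis
  proof cases
    case 1
    then show ?thesis using that[of 0] by auto
  next
    case 2
    have "\<bar>y t\<bar> \<le> \<bar>c\<bar> + B" if "t \<in> T" for t
      using 2[rule_format, OF that] by (auto simp: dist_real_def)
    then show ?thesis using that by blast
  qed
qed

lemma linf_dist_le:
  assumes "y \<in> mspace (linf T)" "z \<in> mspace (linf T)" "t \<in> T"
  shows "\<bar>y t - z t\<bar> \<le> mdist (linf T) y z"
proof -
  have E: "Metric_space (UNIV :: real set) dist"
    using Metric_space_mspace_mdist[of "euclidean_metric :: real metric"] by simp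
  have yz: "y \<in> Metric_space.fspace (UNIV :: real set) dist T" "z \<in> Metric_space.fspace (UNIV :: real set) dist T"
    using assms by (simp_all add: linf_def)
  have "dist (y t) (z t) \<le> (SUP u\<in>T. dist (y u) (z u))"
    using assms(3) by (intro cSUP_upper Metric_space.bdd_above_dist[OF E yz]) auto
  also have "\<dots> = mdist (linf T) y z"
    using yz assms(3) by (auto simp: linf_def Metric_space.fdist_def[OF E])
  finally show ?thesis by (simp add: dist_real_def)
qed

text \<open>Lipschitz functionals are continuous for the supremum distance. Openness of their
  preimages feeds a compactness argument, measurability the integrals over the limit law.\<close>

lemma
  fixes q :: "('a \<Rightarrow> real) \<Rightarrow> real"
  assumes "\<And>y z. y \<in> mspace (linf T) \<Longrightarrow> z \<in> mspace (linf T) \<Longrightarrow> \<bar>q y - q z\<bar> \<le> L * mdist (linf T) y z"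
  shows linf_lipschitz_open: "open U \<Longrightarrow> openin (mtopology_of (linf T)) {y \<in> mspace (linf T). q y \<in> U}"
    and linf_lipschitz_measurable: "q \<in> borel_measurable (linf_borel T)"
proof -
  have "Lipschitz_continuous_map (linf T) euclidean_metric q"
    unfolding Lipschitz_continuous_map_def using assms by (auto simp: dist_real_def)
  then have c: "continuous_map (mtopology_of (linf T)) euclidean q"
    using Lipschitz_continuous_imp_continuous_map by fastforce
  show op: "openin (mtopology_of (linf T)) {y \<in> mspace (linf T). q y \<in> U}" if "open U" for U
    using openin_continuous_map_preimage[OF c, of U] that by simp
  have sub: "{U. openin (mtopology_of (linf T)) U} \<subseteq> Pow (mspace (linf T))"
    using openin_subset by fastforce
  show "q \<in> borel_measurable (linf_borel T)"
  proof (rule borel_measurableI)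
    fix U :: "real set" assume "open U"
    then have "{y \<in> mspace (linf T). q y \<in> U} \<in> sets (linf_borel T)"
      using op unfolding linf_borel_def by (auto simp: sets_measure_of[OF sub])
    moreover have "space (linf_borel T) = mspace (linf T)"
      unfolding linf_borel_def by (rule space_measure_of[OF sub])
    ultimately show "q -` U \<inter> space (linf_borel T) \<in> sets (linf_borel T)"
      by (simp add: vimage_def Int_def conj_commute)
  qed
qed

lemma space_linf_borel: "space (linf_borel T) = mspace (linf T)"
  unfolding linf_borel_def by (rule space_measure_of) (use openin_subset in fastforce)

lemma tight_random_element_path:
  assumes "tight_random_element T N Z"
  shows "prob_space N" "sample_path T Z \<in> N \<rightarrow>\<^sub>M linf_borel T"
    and "x \<in> space N \<Longrightarrow> sample_path T Z x \<in> mspace (linf T)"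
proof -
  show "prob_space N" and m: "sample_path T Z \<in> N \<rightarrow>\<^sub>M linf_borel T"
    using assms by (auto simp: tight_random_element_def)
  show "sample_path T Z x \<in> mspace (linf T)" if "x \<in> space N"
    using measurable_space[OF m that] by (simp add: space_linf_borel)
qed

section \<open>The studentized infimum as a functional of the path\<close>

text \<open>A real \<open>INF\<close> is a genuine infimum only over a nonempty family that is
  bounded below; hence the recurring assumptions \<open>T \<noteq> {}\<close>, \<open>y\<close> in
  \<open>linf T\<close> and a positive lower bound on \<open>s\<close>.\<close>

definition studentized_inf :: "'a set \<Rightarrow> ('a \<Rightarrow> real) \<Rightarrow> ('a \<Rightarrow> real) \<Rightarrow> real" where
  "studentized_inf T s y = (INF t\<in>T. y t / s t)"

lemma studentized_inf_bdd:
  assumes "y \<in> mspace (linf T)" "0 < b" "\<And>t. t \<in> T \<Longrightarrow> b \<le> s t"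
  shows "bdd_below ((\<lambda>t. y t / s t) ` T)"
proof -
  obtain B where B: "\<And>t. t \<in> T \<Longrightarrow> \<bar>y t\<bar> \<le> B" using linf_bounded[OF assms(1)] by blast
  have "- (B / b) \<le> y t / s t" if "t \<in> T" for t
  proof -
    have "\<bar>y t / s t\<bar> = \<bar>y t\<bar> / s t" using assms(2) assms(3)[OF that] by (simp add: abs_divide)
    also have "\<dots> \<le> B / b" using B[OF that] assms(2) assms(3)[OF that] by (intro frac_le) auto
    finally show ?thesis by linarith
  qed
  then show ?thesis by (rule bdd_belowI2)
qed

lemma studentized_inf_le:
  assumes "y \<in> mspace (linf T)" "0 < b" "\<And>t. t \<in> T \<Longrightarrow> b \<le> s t" "t \<in> T"
  shows "studentized_inf T s y \<le> y t / s t"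
  unfolding studentized_inf_def using studentized_inf_bdd[OF assms(1-3)] assms(4) by (intro cINF_lower) auto

lemma studentized_inf_less:
  assumes "T \<noteq> {}" "studentized_inf T s y < r"
  shows "\<exists>t\<in>T. y t / s t < r"
  using assms cInf_lessD[of "(\<lambda>t. y t / s t) ` T" r] unfolding studentized_inf_def by auto

lemma studentized_inf_lipschitz:
  assumes T: "T \<noteq> {}" and y: "y \<in> mspace (linf T)" and z: "z \<in> mspace (linf T)"
    and b: "0 < b" "\<And>t. t \<in> T \<Longrightarrow> b \<le> s t"
  shows "\<bar>studentized_inf T s y - studentized_inf T s z\<bar> \<le> (1 / b) * mdist (linf T) y z"
proof -
  have *: "studentized_inf T s y - mdist (linf T) y z / b \<le> studentized_inf T s z"
    if y: "y \<in> mspace (linf T)" and z: "z \<in> mspace (linf T)" for y z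
    unfolding studentized_inf_def[of T s z]
  proof (rule cINF_greatest[OF T])
    fix t assume t: "t \<in> T"
    have "\<bar>y t - z t\<bar> / s t \<le> mdist (linf T) y z / b"
      using linf_dist_le[OF y z t] b(1) b(2)[OF t] by (intro frac_le) auto
    moreover have "\<bar>y t / s t - z t / s t\<bar> = \<bar>y t - z t\<bar> / s t"
      using b(1) b(2)[OF t] by (simp add: diff_divide_distrib[symmetric] abs_divide)
    ultimately show "studentized_inf T s y - mdist (linf T) y z / b \<le> z t / s t"
      using studentized_inf_le[where s=s, OF y b t] by linarith
  qed
  have "mdist (linf T) y z = mdist (linf T) z y" by (rule mdist_commute)
  then show ?thesis using *[OF y z] *[OF z y] by simp
qed

section \<open>Outer expectations and the bounded Lipschitz distance\<close>

text \<open>The constant 1 is a majorant and every majorant has integral at least -1, so the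
  \<open>Inf\<close> in the outer expectation is a genuine infimum.\<close>

lemma outer_expectation_BL1:
  assumes "prob_space M" "\<And>\<omega>. \<omega> \<in> space M \<Longrightarrow> sample_path T Y \<omega> \<in> mspace (linf T)" "h \<in> BL1 T"
  shows "\<bar>outer_expectation M (\<lambda>\<omega>. h (sample_path T Y \<omega>))\<bar> \<le> 1"
    and "bdd_below {(\<integral>\<omega>. U \<omega> \<partial>M) | U. integrable M U \<and> (\<forall>\<omega>\<in>space M. h (sample_path T Y \<omega>) \<le> U \<omega>)}"
    and "{(\<integral>\<omega>. U \<omega> \<partial>M) | U. integrable M U \<and> (\<forall>\<omega>\<in>space M. h (sample_path T Y \<omega>) \<le> U \<omega>)} \<noteq> {}"
proof -
  interpret prob_space M by fact
  have h: "\<bar>h (sample_path T Y \<omega>)\<bar> \<le> 1" if "\<omega> \<in> space M" for \<omega>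
    using assms(2)[OF that] assms(3) by (auto simp: BL1_def)
  let ?S = "{(\<integral>\<omega>. U \<omega> \<partial>M) | U. integrable M U \<and> (\<forall>\<omega>\<in>space M. h (sample_path T Y \<omega>) \<le> U \<omega>)}"
  have one: "1 \<in> ?S"
    using h by (auto intro!: exI[of _ "\<lambda>_. 1"] simp: prob_space abs_le_iff)
  have lb: "- 1 \<le> x" if "x \<in> ?S" for x
  proof -
    obtain U where U: "x = (\<integral>\<omega>. U \<omega> \<partial>M)" "integrable M U" "\<And>\<omega>. \<omega> \<in> space M \<Longrightarrow> h (sample_path T Y \<omega>) \<le> U \<omega>"
      using \<open>x \<in> ?S\<close> by auto
    have "(\<integral>\<omega>. - 1 \<partial>M) \<le> (\<integral>\<omega>. U \<omega> \<partial>M)"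
      by (rule integral_mono) (use U h in \<open>auto simp: abs_le_iff intro: order_trans[of "-1"]\<close>)
    then show ?thesis using U by (simp add: prob_space)
  qed
  show bdd: "bdd_below ?S" using lb by (rule bdd_belowI)
  show "?S \<noteq> {}" using one by blast
  have "Inf ?S \<le> 1" using one bdd by (rule cInf_lower)
  moreover have "- 1 \<le> Inf ?S" using one lb by (intro cInf_greatest) auto
  ultimately show "\<bar>outer_expectation M (\<lambda>\<omega>. h (sample_path T Y \<omega>))\<bar> \<le> 1"
    unfolding outer_expectation_def by (simp add: abs_le_iff)
qed

lemma BL1_measurable:
  assumes "h \<in> BL1 T"
  shows "h \<in> borel_measurable (linf_borel T)"
  by (rule linf_lipschitz_measurable[where L=1]) (use assms in \<open>auto simp: BL1_def\<close>)

text \<open>A real \<open>SUP\<close> dominates its terms only if they are bounded; here both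
  expectations have absolute value at most 1, so 2 is a bound.\<close>

lemma bl_distance_upper:
  assumes M: "prob_space M" "\<And>\<omega>. \<omega> \<in> space M \<Longrightarrow> sample_path T Y \<omega> \<in> mspace (linf T)"
    and Z: "tight_random_element T N Z" and h: "h \<in> BL1 T"
  shows "\<bar>outer_expectation M (\<lambda>\<omega>. h (sample_path T Y \<omega>)) - (\<integral>v. h (sample_path T Z v) \<partial>N)\<bar> \<le> bl_distance T M Y N Z"
  unfolding bl_distance_def
proof (rule cSUP_upper[OF h])
  note path = tight_random_element_path[OF Z]
  interpret N: prob_space N by (rule path)
  show "bdd_above ((\<lambda>h. \<bar>outer_expectation M (\<lambda>\<omega>. h (sample_path T Y \<omega>)) - (\<integral>v. h (sample_path T Z v) \<partial>N)\<bar>) ` BL1 T)"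
  proof (rule bdd_aboveI2)
    fix h assume h: "h \<in> BL1 T"
    have [measurable]: "(\<lambda>v. h (sample_path T Z v)) \<in> borel_measurable N"
      using path(2) BL1_measurable[OF h] by (rule measurable_compose)
    have b: "\<bar>h (sample_path T Z v)\<bar> \<le> 1" if "v \<in> space N" for v
      using path(3)[OF that] h by (auto simp: BL1_def)
    have int: "integrable N (\<lambda>v. h (sample_path T Z v))"
      by (rule N.integrable_const_bound[where B=1]) (use b in auto)
    have "\<bar>\<integral>v. h (sample_path T Z v) \<partial>N\<bar> \<le> (\<integral>v. \<bar>h (sample_path T Z v)\<bar> \<partial>N)"
      by (rule integral_abs_bound)
    also have "\<dots> \<le> (\<integral>v. 1 \<partial>N)" by (rule integral_mono) (use int b in auto)
    finally have "\<bar>\<integral>v. h (sample_path T Z v) \<partial>N\<bar> \<le> 1" by (simp add: N.prob_space)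
    then show "\<bar>outer_expectation M (\<lambda>\<omega>. h (sample_path T Y \<omega>)) - (\<integral>v. h (sample_path T Z v) \<partial>N)\<bar> \<le> 2"
      using outer_expectation_BL1(1)[OF M h] by linarith
  qed
qed

text \<open>Markov's inequality for outer expectations: \<open>h / L\<close> belongs to
  \<open>BL1\<close>, and any measurable majorant of it is at least \<open>1 / L\<close> on
  \<open>A\<close>, so \<open>L\<close> times its integral bounds the outer probability. The
  majorant is then chosen nearly optimal.\<close>

lemma outer_prob_le_bl_distance:
  assumes M: "prob_space M" "\<And>\<omega>. \<omega> \<in> space M \<Longrightarrow> sample_path T Y \<omega> \<in> mspace (linf T)"
    and Z: "tight_random_element T N Z" and L: "1 \<le> L"
    and h01: "\<And>y. y \<in> mspace (linf T) \<Longrightarrow> 0 \<le> h y \<and> h y \<le> 1"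
    and lip: "\<And>y z. y \<in> mspace (linf T) \<Longrightarrow> z \<in> mspace (linf T) \<Longrightarrow> \<bar>h y - h z\<bar> \<le> L * mdist (linf T) y z"
    and A: "A \<subseteq> space M" "\<And>\<omega>. \<omega> \<in> A \<Longrightarrow> h (sample_path T Y \<omega>) = 1"
  shows "outer_measure_of M A \<le> ennreal ((\<integral>v. h (sample_path T Z v) \<partial>N) + L * bl_distance T M Y N Z)"
proof -
  interpret prob_space M by fact
  let ?h = "\<lambda>y. h y / L"
  have "?h \<in> BL1 T"
  proof -
    have "\<bar>h y / L\<bar> \<le> 1" if "y \<in> mspace (linf T)" for y
      using h01[OF that] L by (simp add: divide_le_eq abs_divide)
    moreover have "\<bar>h y / L - h z / L\<bar> \<le> mdist (linf T) y z" if "y \<in> mspace (linf T)" "z \<in> mspace (linf T)" for y z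
      using lip[OF that] L by (simp add: diff_divide_distrib[symmetric] abs_divide divide_le_eq mult.commute)
    ultimately show ?thesis by (auto simp: BL1_def)
  qed
  note bl = bl_distance_upper[OF M Z this] and oe = outer_expectation_BL1[OF M this]
  let ?E = "outer_expectation M (\<lambda>\<omega>. ?h (sample_path T Y \<omega>))"
  have EL: "L * ?E \<le> (\<integral>v. h (sample_path T Z v) \<partial>N) + L * bl_distance T M Y N Z"
  proof -
    have "?E \<le> (\<integral>v. h (sample_path T Z v) \<partial>N) / L + bl_distance T M Y N Z"
      using bl by simp
    then have "L * ?E \<le> L * ((\<integral>v. h (sample_path T Z v) \<partial>N) / L + bl_distance T M Y N Z)"
      using L by (intro mult_left_mono) auto
    then show ?thesis using L by (simp add: distrib_left)
  qed
  show ?thesis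
  proof (rule ennreal_le_epsilon)
    fix e :: real assume e: "0 < e"
    have "Inf {(\<integral>\<omega>. U \<omega> \<partial>M) | U. integrable M U \<and> (\<forall>\<omega>\<in>space M. ?h (sample_path T Y \<omega>) \<le> U \<omega>)} < ?E + e / L"
      using e L unfolding outer_expectation_def by simp
    from cInf_lessD[OF oe(3) this] obtain U where
      U: "integrable M U" "\<And>\<omega>. \<omega> \<in> space M \<Longrightarrow> ?h (sample_path T Y \<omega>) \<le> U \<omega>" "(\<integral>\<omega>. U \<omega> \<partial>M) < ?E + e / L"
      by auto
    have [measurable]: "U \<in> borel_measurable M" using U(1) by simp
    have U0: "0 \<le> U \<omega>" if "\<omega> \<in> space M" for \<omega>
    proof -
      have "0 \<le> ?h (sample_path T Y \<omega>)" using h01[OF M(2)[OF that]] L by simp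
      then show ?thesis using U(2)[OF that] by linarith
    qed
    have "A \<subseteq> {\<omega>\<in>space M. 1 / L \<le> U \<omega>}"
    proof
      fix \<omega> assume "\<omega> \<in> A"
      then show "\<omega> \<in> {\<omega>\<in>space M. 1 / L \<le> U \<omega>}" using A(1) A(2) U(2)[of \<omega>] by auto
    qed
    then have "outer_measure_of M A \<le> emeasure M {\<omega>\<in>space M. 1 / L \<le> U \<omega>}"
      using outer_measure_of_mono[of A "{\<omega>\<in>space M. 1 / L \<le> U \<omega>}" M] by simp
    also have "\<dots> = ennreal (measure M {\<omega>\<in>space M. 1 / L \<le> U \<omega>})" by (rule emeasure_eq_measure)
    also have "measure M {\<omega>\<in>space M. 1 / L \<le> U \<omega>} \<le> (\<integral>\<omega>. U \<omega> \<partial>M) / (1 / L)"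
      using L U0 by (intro integral_Markov_inequality_measure[OF U(1), of "{}"]) (auto intro!: AE_I2)
    also have "\<dots> = L * (\<integral>\<omega>. U \<omega> \<partial>M)" by simp
    also have "\<dots> \<le> L * (?E + e / L)" using U(3) L by (intro mult_left_mono) auto
    also have "\<dots> = L * ?E + e" using L by (simp add: distrib_left)
    finally have "outer_measure_of M A \<le> ennreal (L * ?E + e)"
      by (simp add: ennreal_leI)
    also have "\<dots> \<le> ennreal ((\<integral>v. h (sample_path T Z v) \<partial>N) + L * bl_distance T M Y N Z + e)"
      using EL by (intro ennreal_leI) simp
    \<comment> \<open>\<open>ennreal\<close> truncates negative numbers to 0, so the sum is split
      only after a case distinction on the sign.\<close>
    also have "\<dots> \<le> ennreal ((\<integral>v. h (sample_path T Z v) \<partial>N) + L * bl_distance T M Y N Z) + ennreal e"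
      using e by (cases "0 \<le> (\<integral>v. h (sample_path T Z v) \<partial>N) + L * bl_distance T M Y N Z")
        (auto intro: ennreal_leI simp: ennreal_neg)
    finally show "outer_measure_of M A \<le> ennreal ((\<integral>v. h (sample_path T Z v) \<partial>N) + L * bl_distance T M Y N Z) + ennreal e" .
  qed
qed

text \<open>The cutoff function is \<open>1\<close> on the set of paths with few values and vanishes at distance \<open>1/2\<close> from it.\<close>

lemma clustered_of_finite_range:
  assumes M: "prob_space M" "\<And>\<omega>. \<omega> \<in> space M \<Longrightarrow> sample_path T Y \<omega> \<in> mspace (linf T)"
    and Z: "tight_random_element T N Z" and F: "finite F" "F \<subseteq> T"
    and ran: "\<And>\<omega>. \<omega> \<in> space M \<Longrightarrow> finite ((\<lambda>t. Y t \<omega> + \<beta> t) ` T) \<and> card ((\<lambda>t. Y t \<omega> + \<beta> t) ` T) \<le> m"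
    and Zm: "\<And>g. g \<in> F \<Longrightarrow> Z g \<in> borel_measurable N"
  shows "1 - 2 * bl_distance T M Y N Z \<le> measure N {x\<in>space N. clustered F m (\<lambda>g. Z g x + \<beta> g)}"
proof -
  interpret prob_space M by fact
  note path = tight_random_element_path[OF Z]
  interpret N: prob_space N by (rule path)
  define A where "A = {z \<in> mspace (linf T). finite ((\<lambda>t. z t + \<beta> t) ` T) \<and> card ((\<lambda>t. z t + \<beta> t) ` T) \<le> m}"
  have YA: "sample_path T Y \<omega> \<in> A" if "\<omega> \<in> space M" for \<omega>
  proof -
    have "(\<lambda>t. sample_path T Y \<omega> t + \<beta> t) ` T = (\<lambda>t. Y t \<omega> + \<beta> t) ` T"
      by (auto simp: sample_path_def)
    then show ?thesis using M(2)[OF that] ran[OF that] by (simp add: A_def)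
  qed
  then have A0: "A \<noteq> {}" using not_empty by blast
  define d where "d = (\<lambda>y. INF z\<in>A. mdist (linf T) y z)"
  define h where "h = (\<lambda>y. max 0 (1 - 2 * d y))"
  have bdd: "bdd_below ((\<lambda>z. mdist (linf T) y z) ` A)" for y by (rule bdd_belowI2[of _ 0]) simp
  have d0: "0 \<le> d y" for y unfolding d_def using A0 by (intro cINF_greatest) auto
  have dle: "d y \<le> mdist (linf T) y z" if "z \<in> A" for y z
    unfolding d_def using bdd that by (rule cINF_lower)
  have tri: "d y - mdist (linf T) y z \<le> d z" if y: "y \<in> mspace (linf T)" and z: "z \<in> mspace (linf T)" for y z
    unfolding d_def
  proof (rule cINF_greatest[OF A0])
    fix w assume w: "w \<in> A"
    then have "w \<in> mspace (linf T)" by (simp add: A_def)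
    then have "mdist (linf T) y w \<le> mdist (linf T) y z + mdist (linf T) z w"
      using y z by (intro mdist_triangle) auto
    then show "(INF z\<in>A. mdist (linf T) y z) - mdist (linf T) y z \<le> mdist (linf T) z w"
      using dle[OF w, of y] unfolding d_def by linarith
  qed
  have lip: "\<bar>h y - h z\<bar> \<le> 2 * mdist (linf T) y z" if "y \<in> mspace (linf T)" "z \<in> mspace (linf T)" for y z
    using tri[OF that] tri[OF that(2,1)] unfolding h_def by (simp add: mdist_commute[of "linf T" z y])
  have h01: "0 \<le> h y \<and> h y \<le> 1" for y using d0[of y] by (simp add: h_def)
  have h1: "h (sample_path T Y \<omega>) = 1" if "\<omega> \<in> space M" for \<omega>
  proof -
    have "mdist (linf T) (sample_path T Y \<omega>) (sample_path T Y \<omega>) = 0"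
      using M(2)[OF that] by simp
    then show ?thesis using dle[OF YA[OF that], of "sample_path T Y \<omega>"] d0[of "sample_path T Y \<omega>"] by (simp add: h_def)
  qed
  \<comment> \<open>The cutoff is 1 on every sample path, so the transfer inequality is applied to
    the sure event. The factor 2 is the Lipschitz constant of the cutoff.\<close>
  have "outer_measure_of M (space M) \<le> ennreal ((\<integral>v. h (sample_path T Z v) \<partial>N) + 2 * bl_distance T M Y N Z)"
    by (rule outer_prob_le_bl_distance[OF M Z _ h01 lip]) (use h1 in auto)
  then have "1 \<le> (\<integral>v. h (sample_path T Z v) \<partial>N) + 2 * bl_distance T M Y N Z"
    by (simp add: emeasure_space_1)
  moreover have "(\<integral>v. h (sample_path T Z v) \<partial>N) \<le> measure N {x\<in>space N. clustered F m (\<lambda>g. Z g x + \<beta> g)}"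
  proof -
    have [measurable]: "Measurable.pred N (\<lambda>x. clustered F m (\<lambda>g. Z g x + \<beta> g))"
      by (rule pred_clustered[OF F(1), of "\<lambda>g x. Z g x + \<beta> g"]) (use Zm in simp)
    have "h \<in> borel_measurable (linf_borel T)" using lip by (rule linf_lipschitz_measurable)
    then have [measurable]: "(\<lambda>v. h (sample_path T Z v)) \<in> borel_measurable N"
      using path(2) by (rule measurable_compose[rotated])
    have "(\<integral>v. h (sample_path T Z v) \<partial>N) \<le> (\<integral>v. indicator {x\<in>space N. clustered F m (\<lambda>g. Z g x + \<beta> g)} v \<partial>N)"
    proof (rule integral_mono)
      show "integrable N (\<lambda>v. h (sample_path T Z v))"
        by (rule N.integrable_const_bound[where B=1]) (use h01 in auto)
      show "integrable N (\<lambda>v. indicat_real {x\<in>space N. clustered F m (\<lambda>g. Z g x + \<beta> g)} v)"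
        by (simp add: less_top[symmetric])
      fix v assume v: "v \<in> space N"
      show "h (sample_path T Z v) \<le> indicator {x\<in>space N. clustered F m (\<lambda>g. Z g x + \<beta> g)} v"
      proof (cases "h (sample_path T Z v) = 0")
        case False
        then have "d (sample_path T Z v) < 1/2" by (auto simp: h_def max_def split: if_splits)
        then obtain z where z: "z \<in> A" "mdist (linf T) (sample_path T Z v) z < 1/2"
          using A0 cInf_lessD[of "(\<lambda>z. mdist (linf T) (sample_path T Z v) z) ` A" "1/2"] unfolding d_def by auto
        have zm: "z \<in> mspace (linf T)" using z by (simp add: A_def)
        \<comment> \<open>A cutoff that is not 0 provides a path \<open>z\<close> in
          \<open>A\<close> at distance below 1/2. Where the shifted \<open>z\<close> takes equal
          values, the shifted \<open>Z\<close> differs by at most 1/2 + 1/2, the unit allowed in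
          \<open>clustered\<close>.\<close>
        have close: "\<bar>Z t v - z t\<bar> \<le> 1/2" if "t \<in> T" for t
          using linf_dist_le[OF path(3)[OF v] zm that] z(2) that by (simp add: sample_path_def)
        have "finite ((\<lambda>t. z t + \<beta> t) ` T)" "card ((\<lambda>t. z t + \<beta> t) ` T) \<le> card {..<m}" using z by (simp_all add: A_def)
        then obtain e where e: "e ` ((\<lambda>t. z t + \<beta> t) ` T) \<subseteq> {..<m}" "inj_on e ((\<lambda>t. z t + \<beta> t) ` T)"
          using card_le_inj[of "(\<lambda>t. z t + \<beta> t) ` T" "{..<m}"] by auto
        have "clustered F m (\<lambda>g. Z g v + \<beta> g)"
          unfolding clustered_def
        proof (intro bexI[of _ "\<lambda>t\<in>F. e (z t + \<beta> t)"] ballI impI)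
          show "(\<lambda>t\<in>F. e (z t + \<beta> t)) \<in> F \<rightarrow>\<^sub>E {..<m}" using e(1) F(2) by auto
          fix g g' assume gg: "g \<in> F" "g' \<in> F" and "(\<lambda>t\<in>F. e (z t + \<beta> t)) g = (\<lambda>t\<in>F. e (z t + \<beta> t)) g'"
          then have "e (z g + \<beta> g) = e (z g' + \<beta> g')" by simp
          then have "z g + \<beta> g = z g' + \<beta> g'" by (rule inj_onD[OF e(2)]) (use gg F in auto)
          moreover have "\<bar>Z g v - z g\<bar> \<le> 1/2" "\<bar>Z g' v - z g'\<bar> \<le> 1/2" using close gg F by auto
          ultimately show "\<bar>Z g v + \<beta> g - (Z g' v + \<beta> g')\<bar> \<le> 1" by linarith
        qed
        then show ?thesis using v h01[of "sample_path T Z v"] by simp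
      qed simp
    qed
    then show ?thesis by (simp add: Int_absorb2)
  qed
  ultimately show ?thesis by linarith
qed

text \<open>Collects the losses: a distance of \<open>\<alpha> / 16\<close> costs the probability
  \<open>\<alpha> / 8\<close> in the transfer, and symmetrisation doubles this to
  \<open>\<alpha> / 4\<close> and squares the number of values.\<close>

lemma gaussian_limit_level_bound:
  assumes M: "prob_space M" "\<And>\<omega>. \<omega> \<in> space M \<Longrightarrow> sample_path T Y \<omega> \<in> mspace (linf T)"
    and Z: "tight_random_element T N Z" and G: "centered_gaussian_process T N Z \<Sigma>"
    and F: "finite F" "F \<subseteq> T"
    and ran: "\<And>\<omega>. \<omega> \<in> space M \<Longrightarrow> finite ((\<lambda>t. Y t \<omega> + \<beta> t) ` T) \<and> card ((\<lambda>t. Y t \<omega> + \<beta> t) ` T) \<le> m"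
    and K: "\<And>g. g \<in> T \<Longrightarrow> \<Sigma> g g \<le> K" and \<alpha>: "0 < \<alpha>" "\<alpha> \<le> 1/10" and t: "4 \<le> t" "K \<le> \<alpha> * t\<^sup>2"
    and bl: "bl_distance T M Y N Z \<le> \<alpha> / 16"
    and D: "4 * real (m * m) < \<alpha> * real D"
  shows "measure N {x\<in>space N. \<exists>g\<in>F. t * 3 ^ D \<le> \<bar>Z g x\<bar>} < \<alpha>"
proof (rule gaussian_clustered_bound[OF centered_gaussian_process_subset[OF G F(2)] F(1) _ \<alpha> t _ D])
  show "\<And>g. g \<in> F \<Longrightarrow> \<Sigma> g g \<le> K" using K F by auto
  have "1 - \<alpha> / 8 \<le> measure N {x\<in>space N. clustered F m (\<lambda>g. Z g x + \<beta> g)}"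
    using clustered_of_finite_range[where \<beta>=\<beta>, OF M Z F ran] bl centered_gaussian_process_rv(2)[OF G] F(2) by force
  from gaussian_clustered_shift[OF gaussian_family_of_process[OF G F] this]
  show "1 - \<alpha> / 4 \<le> measure N {x\<in>space N. clustered F (m * m) (\<lambda>g. Z g x)}" by simp
qed

section \<open>Finite subfamilies and anticoncentration of the infimum\<close>

text \<open>The sets \<open>U f\<close> of paths that are minimised at \<open>f\<close> up to
  \<open>\<delta>\<close> are open and cover all bounded paths. A compact set that carries most of
  the law needs finitely many of them.\<close>

lemma tight_studentized_inf_finite:
  assumes Z: "tight_random_element T N Z" and T: "T \<noteq> {}"
    and b: "0 < b" "\<And>t. t \<in> T \<Longrightarrow> b \<le> s t" and pos: "0 < \<epsilon>" "0 < \<delta>"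
  obtains F where "finite F" "F \<subseteq> T"
    "measure N {v\<in>space N. \<not> (\<exists>f\<in>F. Z f v / s f < studentized_inf T s (sample_path T Z v) + \<delta>)} \<le> \<epsilon>"
proof -
  note path = tight_random_element_path[OF Z]
  interpret prob_space N by (rule path)
  obtain K where K: "compactin (mtopology_of (linf T)) K"
    "1 - \<epsilon> \<le> measure N {v\<in>space N. sample_path T Z v \<in> K}"
    using Z pos(1) unfolding tight_random_element_def by blast
  define q where "q = (\<lambda>f y. y f / s f - studentized_inf T s y)"
  have lip: "\<bar>q f y - q f z\<bar> \<le> (2 / b) * mdist (linf T) y z"
    if f: "f \<in> T" and yz: "y \<in> mspace (linf T)" "z \<in> mspace (linf T)" for f y z
  proof -
    have "\<bar>y f / s f - z f / s f\<bar> = \<bar>y f - z f\<bar> / s f"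
      using b(1) b(2)[OF f] by (simp add: diff_divide_distrib[symmetric] abs_divide)
    also have "\<dots> \<le> mdist (linf T) y z / b"
      using linf_dist_le[OF yz f] b(1) b(2)[OF f] by (intro frac_le) auto
    finally show ?thesis
      using studentized_inf_lipschitz[where s=s, OF T yz b] unfolding q_def by simp
  qed
  define U where "U = (\<lambda>f. {y \<in> mspace (linf T). q f y \<in> {..<\<delta>}})"
  have "\<exists>\<F>. finite \<F> \<and> \<F> \<subseteq> U ` T \<and> K \<subseteq> \<Union>\<F>"
  proof (rule compactinD[OF K(1)])
    show "openin (mtopology_of (linf T)) V" if V: "V \<in> U ` T" for V
    proof -
      obtain f where "f \<in> T" "V = U f" using V by auto
      then show ?thesis unfolding U_def using linf_lipschitz_open[OF lip[OF \<open>f \<in> T\<close>], of "{..<\<delta>}"] by simp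
    qed
    show "K \<subseteq> \<Union> (U ` T)"
    proof
      fix y assume "y \<in> K"
      then have "y \<in> mspace (linf T)" using compactin_subset_topspace[OF K(1)] by auto
      moreover obtain f where "f \<in> T" "y f / s f < studentized_inf T s y + \<delta>"
        using studentized_inf_less[OF T, of s y "studentized_inf T s y + \<delta>"] pos by auto
      ultimately show "y \<in> \<Union> (U ` T)" by (auto simp: U_def q_def diff_less_eq algebra_simps)
    qed
  qed
  then obtain F where F: "F \<subseteq> T" "finite F" "K \<subseteq> \<Union> (U ` F)"
    by (auto simp: ex_finite_subset_image)
  let ?B = "{v\<in>space N. \<not> (\<exists>f\<in>F. Z f v / s f < studentized_inf T s (sample_path T Z v) + \<delta>)}"
  have "measure N ?B \<le> \<epsilon>"
  proof (cases "{v\<in>space N. sample_path T Z v \<in> K} \<in> sets N")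
    case True
    have "?B \<subseteq> space N - {v\<in>space N. sample_path T Z v \<in> K}"
    proof
      fix v assume v: "v \<in> ?B"
      have "sample_path T Z v \<notin> K"
      proof
        assume "sample_path T Z v \<in> K"
        then obtain f where f: "f \<in> F" "q f (sample_path T Z v) < \<delta>" using F(3) by (auto simp: U_def)
        then have "Z f v / s f < studentized_inf T s (sample_path T Z v) + \<delta>"
          using F(1) by (auto simp: q_def sample_path_def)
        then show False using v f by auto
      qed
      then show "v \<in> space N - {v\<in>space N. sample_path T Z v \<in> K}" using v by auto
    qed
    then have "measure N ?B \<le> measure N (space N - {v\<in>space N. sample_path T Z v \<in> K})"
      using True by (intro finite_measure_mono) auto
    also have "\<dots> = 1 - measure N {v\<in>space N. sample_path T Z v \<in> K}" using True by (rule prob_compl)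
    finally show ?thesis using K(2) by simp
  next
    \<comment> \<open>A set that is not measurable has \<open>measure\<close> 0, so tightness then
      forces \<open>\<epsilon>\<close> to be at least 1.\<close>
    case False
    then have "1 \<le> \<epsilon>" using K(2) by (simp add: measure_notin_sets)
    then show ?thesis using prob_le_1 order_trans by blast
  qed
  then show ?thesis using that F by blast
qed

lemma studentized_inf_measurable:
  assumes Z: "tight_random_element T N Z" and T: "T \<noteq> {}"
    and b: "0 < b" "\<And>t. t \<in> T \<Longrightarrow> b \<le> s t"
  shows "(\<lambda>v. studentized_inf T s (sample_path T Z v)) \<in> borel_measurable N"
proof -
  have "studentized_inf T s \<in> borel_measurable (linf_borel T)"
    using studentized_inf_lipschitz[where s=s, OF T _ _ b] by (rule linf_lipschitz_measurable)
  then show ?thesis using tight_random_element_path(2)[OF Z] by (rule measurable_compose[rotated])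
qed

text \<open>The infimum is minus the supremum of the standardised variables \<open>X f\<close>. If
  it lies in \<open>[c, c + \<eta>)\<close>, all \<open>X f\<close> are at most \<open>- c\<close>,
  and outside a small event one of the finitely many chosen ones exceeds
  \<open>- c - \<eta> - \<delta>\<close>. The normal density is at most 1, so the bound for maxima
  gives the claim.\<close>

lemma studentized_inf_anticoncentration:
  assumes Z: "tight_random_element T N Z" and G: "centered_gaussian_process T N Z \<Sigma>" and T: "T \<noteq> {}"
    and l: "0 < l" "\<And>t. t \<in> T \<Longrightarrow> l \<le> \<Sigma> t t" and \<eta>: "0 < \<eta>"
  defines "\<phi> \<equiv> \<lambda>v. studentized_inf T (\<lambda>t. sqrt (\<Sigma> t t)) (sample_path T Z v)"
  shows "measure N {v\<in>space N. c \<le> \<phi> v \<and> \<phi> v < c + \<eta>} * measure std_normal_distribution {- c<..} \<le> \<eta>"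
proof (rule field_le_epsilon)
  fix e :: real assume "0 < e"
  \<comment> \<open>One \<open>\<delta>\<close> widens the band, the other is the probability that
    no chosen coordinate nearly attains the infimum.\<close>
  define \<delta> where "\<delta> = e / 2"
  have \<delta>: "0 < \<delta>" using \<open>0 < e\<close> by (simp add: \<delta>_def)
  let ?s = "\<lambda>t. sqrt (\<Sigma> t t)"
  let ?q = "measure std_normal_distribution {- c<..}"
  have b: "0 < sqrt l" "\<And>t. t \<in> T \<Longrightarrow> sqrt l \<le> ?s t" using l by auto
  have s: "0 < ?s t" "0 < \<Sigma> t t" if "t \<in> T" for t using l(1) l(2)[OF that] by auto
  note path = tight_random_element_path[OF Z]
  interpret prob_space N by (rule path)
  interpret std: real_distribution std_normal_distribution by (rule real_dist_normal_dist)
  obtain F where F: "finite F" "F \<subseteq> T"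
    and bad: "measure N {v\<in>space N. \<not> (\<exists>f\<in>F. Z f v / ?s f < studentized_inf T ?s (sample_path T Z v) + \<delta>)} \<le> \<delta>"
    by (rule tight_studentized_inf_finite[where s="?s", OF Z T b \<delta> \<delta>])
  have \<phi>m[measurable]: "\<phi> \<in> borel_measurable N"
    unfolding \<phi>_def by (rule studentized_inf_measurable[OF Z T b])
  have Zm[measurable]: "Z f \<in> borel_measurable N" if "f \<in> F" for f
    using centered_gaussian_process_rv(2)[OF G] F that by auto
  define X where "X = (\<lambda>f v. - Z f v / ?s f)"
  define C where "C = (\<lambda>f h. \<Sigma> f h / (?s f * ?s h))"
  have fam: "gaussian_family N F X C"
    unfolding gaussian_family_def
  proof (intro conjI ballI allI prob_space_axioms F(1))
    show "X j \<in> borel_measurable N" if "j \<in> F" for j using that unfolding X_def by measurable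
    fix t
    have "(CLINT v|N. iexp (\<Sum>j\<in>F. (- t j / ?s j) * Z j v))
       = exp (- (\<Sum>i\<in>F. \<Sum>j\<in>F. (- t i / ?s i) * (- t j / ?s j) * \<Sigma> i j) / 2)"
      using gaussian_family_of_process[OF G F] unfolding gaussian_family_def
      by (elim conjE allE[of _ "\<lambda>j. - t j / ?s j"])
    then show "(CLINT v|N. iexp (\<Sum>j\<in>F. t j * X j v)) = exp (- (\<Sum>i\<in>F. \<Sum>j\<in>F. t i * t j * C i j) / 2)"
      by (simp add: X_def C_def)
  qed
  have C1: "C f f = 1" if "f \<in> F" for f
    using s[of f] F that by (auto simp: C_def)
  have cov: "\<Sigma> f h = (\<integral>v. Z f v * Z h v \<partial>N)" if "f \<in> F" "h \<in> F" for f h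
    using G that subsetD[OF F(2)] unfolding centered_gaussian_process_def by simp
  have Csym: "C f h = C h f" if "f \<in> F" "h \<in> F" for f h
    using cov[OF that] cov[OF that(2,1)] by (simp add: C_def mult.commute)
  \<comment> \<open>Correlations are at most 1 because the squared distance of the standardised
    variables has expectation \<open>2 - 2 * C f h\<close>.\<close>
  have Cle: "C f h \<le> 1" if fh: "f \<in> F" "h \<in> F" for f h
  proof -
    have fT: "f \<in> T" "h \<in> T" using F fh by auto
    note rf = centered_gaussian_process_rv[OF G fT(1)] and rh = centered_gaussian_process_rv[OF G fT(2)]
    have i: "integrable N (\<lambda>v. Z f v * Z h v)"
      by (rule integrable_mult_of_squares) (use rf rh in auto)
    have "0 \<le> (\<integral>v. (Z f v / ?s f - Z h v / ?s h)\<^sup>2 \<partial>N)" by simp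
    also have "\<dots> = (\<integral>v. (Z f v)\<^sup>2 / \<Sigma> f f + (Z h v)\<^sup>2 / \<Sigma> h h - 2 / (?s f * ?s h) * (Z f v * Z h v) \<partial>N)"
      using s[OF fT(1)] s[OF fT(2)]
      by (intro Bochner_Integration.integral_cong refl) (simp add: power2_diff power_divide)
    also have "\<dots> = \<Sigma> f f / \<Sigma> f f + \<Sigma> h h / \<Sigma> h h - 2 / (?s f * ?s h) * \<Sigma> f h"
      using rf(3,4) rh(3,4) i cov[OF fh] by simp
    also have "\<dots> = 2 - 2 * C f h" using s[OF fT(1)] s[OF fT(2)] by (simp add: C_def)
    finally show ?thesis by simp
  qed
  let ?E = "{v\<in>space N. (\<exists>f\<in>F. - c - (\<eta> + \<delta>) < X f v) \<and> (\<forall>f\<in>F. X f v \<le> - c)}"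
  let ?B = "{v\<in>space N. \<not> (\<exists>f\<in>F. Z f v / ?s f < \<phi> v + \<delta>)}"
  have [measurable]: "?E \<in> sets N" "?B \<in> sets N" unfolding X_def using F(1) by measurable
  have E: "measure N ?E * ?q \<le> \<eta> + \<delta>"
  proof -
    have "measure N ?E * ?q \<le> measure std_normal_distribution {- c - (\<eta> + \<delta>)<..- c}"
      by (rule gaussian_max_anticoncentration[OF fam C1 Csym Cle])
    also have "\<dots> \<le> - c - (- c - (\<eta> + \<delta>))" using \<eta> \<delta> by (intro std_normal_interval_le) simp
    finally show ?thesis by simp
  qed
  have sub: "{v\<in>space N. c \<le> \<phi> v \<and> \<phi> v < c + \<eta>} \<subseteq> ?E \<union> ?B"
  proof
    fix v assume v: "v \<in> {v\<in>space N. c \<le> \<phi> v \<and> \<phi> v < c + \<eta>}"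
    show "v \<in> ?E \<union> ?B"
    proof (cases "v \<in> ?B")
      case False
      then obtain f where f: "f \<in> F" "Z f v / ?s f < \<phi> v + \<delta>" using v by auto
      then have "- c - (\<eta> + \<delta>) < X f v" using v by (simp add: X_def)
      moreover have "X h v \<le> - c" if "h \<in> F" for h
      proof -
        have "\<phi> v \<le> sample_path T Z v h / ?s h"
          unfolding \<phi>_def using v that F by (intro studentized_inf_le[where s="?s", OF path(3) b]) auto
        then show ?thesis using v that F by (auto simp: X_def sample_path_def)
      qed
      ultimately show ?thesis using v f by auto
    qed simp
  qed
  have "measure N {v\<in>space N. c \<le> \<phi> v \<and> \<phi> v < c + \<eta>} \<le> measure N (?E \<union> ?B)"
    by (rule finite_measure_mono[OF sub]) measurable
  also have "\<dots> \<le> measure N ?E + measure N ?B" by (rule measure_Un_le) measurable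
  also have "\<dots> \<le> measure N ?E + \<delta>" using bad by (simp add: \<phi>_def)
  finally have "measure N {v\<in>space N. c \<le> \<phi> v \<and> \<phi> v < c + \<eta>} * ?q \<le> (measure N ?E + \<delta>) * ?q"
    by (intro mult_right_mono) auto
  also have "\<dots> = measure N ?E * ?q + \<delta> * ?q" by (rule distrib_right)
  also have "\<dots> \<le> (\<eta> + \<delta>) + \<delta> * 1"
    using E \<delta> std.prob_le_1 by (intro add_mono mult_left_mono) auto
  finally show "measure N {v\<in>space N. c \<le> \<phi> v \<and> \<phi> v < c + \<eta>} * ?q \<le> \<eta> + e" by (simp add: \<delta>_def)
qed

section \<open>Quantiles of laws on the line\<close>

text \<open>As \<alpha> lies strictly between the limits of the distribution function, the
  \<open>Inf\<close> is genuine. Left of it the distribution function is below \<alpha>, and the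
  mass of the open half-line is its left limit.\<close>

lemma (in real_distribution) quantile_props:
  assumes \<alpha>: "0 < \<alpha>" "\<alpha> < 1"
  shows measure_less_quantile: "measure M {..<quantile M \<alpha>} \<le> \<alpha>"
    and quantile_le: "\<alpha> \<le> measure M {..x} \<Longrightarrow> quantile M \<alpha> \<le> x"
    and quantile_ge: "(\<And>x. \<alpha> \<le> measure M {..x} \<Longrightarrow> r \<le> x) \<Longrightarrow> r \<le> quantile M \<alpha>"
proof -
  have "\<forall>\<^sub>F x in at_bot. cdf M x < \<alpha>" using order_tendstoD(2)[OF cdf_lim_at_bot \<alpha>(1)] .
  then obtain y where y: "\<And>x. x \<le> y \<Longrightarrow> cdf M x < \<alpha>" by (auto simp: eventually_at_bot_linorder)
  have bdd: "bdd_below {x. \<alpha> \<le> measure M {..x}}"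
  proof (rule bdd_belowI)
    fix x assume "x \<in> {x. \<alpha> \<le> measure M {..x}}"
    then show "y \<le> x" using y[of x] by (force simp: cdf_def)
  qed
  have "\<forall>\<^sub>F x in at_top. \<alpha> < cdf M x" using order_tendstoD(1)[OF cdf_lim_at_top_prob \<alpha>(2)] .
  then obtain z where "\<alpha> < cdf M z" by (auto simp: eventually_at_top_linorder)
  then have ne: "{x. \<alpha> \<le> measure M {..x}} \<noteq> {}" by (auto simp: cdf_def intro: less_imp_le)
  show le: "quantile M \<alpha> \<le> x" if "\<alpha> \<le> measure M {..x}" for x
    unfolding quantile_def using that bdd by (intro cInf_lower) auto
  show "r \<le> quantile M \<alpha>" if "\<And>x. \<alpha> \<le> measure M {..x} \<Longrightarrow> r \<le> x"
    unfolding quantile_def using that ne by (intro cInf_greatest) auto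
  show "measure M {..<quantile M \<alpha>} \<le> \<alpha>"
  proof (rule tendsto_upperbound[OF cdf_at_left])
    show "\<forall>\<^sub>F x in at_left (quantile M \<alpha>). cdf M x \<le> \<alpha>"
      unfolding eventually_at_left_field
    proof (intro exI[of _ "quantile M \<alpha> - 1"] conjI allI impI)
      fix x assume "x < quantile M \<alpha>"
      then show "cdf M x \<le> \<alpha>" using le[of x] by (force simp: cdf_def)
    qed simp
  qed simp
qed

section \<open>Quantiles of the studentized infimum\<close>

text \<open>The infimum is at most any one coordinate, which has variance 1 after studentization;
  Chebyshev's inequality gives a bound that depends on \<alpha> alone.\<close>

lemma studentized_inf_quantile_upper:
  assumes Z: "tight_random_element T N Z" and G: "centered_gaussian_process T N Z \<Sigma>" and T: "T \<noteq> {}"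
    and l: "0 < l" "\<And>t. t \<in> T \<Longrightarrow> l \<le> \<Sigma> t t" and \<alpha>: "0 < \<alpha>" "\<alpha> < 1"
  defines "\<phi> \<equiv> \<lambda>v. studentized_inf T (\<lambda>t. sqrt (\<Sigma> t t)) (sample_path T Z v)"
  shows "quantile (distr N borel \<phi>) \<alpha> \<le> 1 / sqrt (1 - \<alpha>)"
proof -
  let ?s = "\<lambda>t. sqrt (\<Sigma> t t)"
  have b: "0 < sqrt l" "\<And>t. t \<in> T \<Longrightarrow> sqrt l \<le> ?s t" using l by auto
  note path = tight_random_element_path[OF Z]
  interpret prob_space N by (rule path)
  have \<phi>m[measurable]: "\<phi> \<in> borel_measurable N"
    unfolding \<phi>_def by (rule studentized_inf_measurable[OF Z T b])
  interpret \<mu>: real_distribution "distr N borel \<phi>" by (rule real_distribution_distr) simp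
  obtain g where g: "g \<in> T" using T by auto
  have Zm[measurable]: "Z g \<in> borel_measurable N" by (rule centered_gaussian_process_rv(2)[OF G g])
  have s: "0 < ?s g" "0 < \<Sigma> g g" using l(1) l(2)[OF g] by auto
  define t where "t = ?s g / sqrt (1 - \<alpha>)"
  have t: "0 < t" using s \<alpha> by (simp add: t_def)
  have "measure N {v\<in>space N. t \<le> \<bar>Z g v\<bar>} \<le> \<Sigma> g g / t\<^sup>2"
    by (rule gaussian_process_chebyshev[OF G g order_refl t])
  also have "\<dots> = 1 - \<alpha>" using s \<alpha> by (simp add: t_def power_divide)
  finally have "1 - (1 - \<alpha>) \<le> 1 - measure N {v\<in>space N. t \<le> \<bar>Z g v\<bar>}" by simp
  also have "\<dots> = measure N (space N - {v\<in>space N. t \<le> \<bar>Z g v\<bar>})" by (rule prob_compl[symmetric]) measurable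
  also have "\<dots> \<le> measure N {v\<in>space N. \<phi> v \<le> 1 / sqrt (1 - \<alpha>)}"
  proof (rule finite_measure_mono)
    show "space N - {v\<in>space N. t \<le> \<bar>Z g v\<bar>} \<subseteq> {v\<in>space N. \<phi> v \<le> 1 / sqrt (1 - \<alpha>)}"
    proof
      fix v assume v: "v \<in> space N - {v\<in>space N. t \<le> \<bar>Z g v\<bar>}"
      then have "Z g v < t" by auto
      then have "Z g v / ?s g \<le> t / ?s g" using s by (intro divide_right_mono) auto
      also have "\<dots> = 1 / sqrt (1 - \<alpha>)" using s by (simp add: t_def)
      finally have "sample_path T Z v g / ?s g \<le> 1 / sqrt (1 - \<alpha>)" using g by (simp add: sample_path_def)
      moreover have "\<phi> v \<le> sample_path T Z v g / ?s g"
        unfolding \<phi>_def using v g by (intro studentized_inf_le[where s="?s", OF path(3) b]) auto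
      ultimately show "v \<in> {v\<in>space N. \<phi> v \<le> 1 / sqrt (1 - \<alpha>)}" using v by auto
    qed
  qed measurable
  also have "\<dots> = measure (distr N borel \<phi>) {..1 / sqrt (1 - \<alpha>)}"
    by (subst measure_distr) (auto intro!: arg_cong2[where f=measure])
  finally show ?thesis by (intro \<mu>.quantile_le[OF \<alpha>]) simp
qed

text \<open>The mass \<alpha> is split: one half pays for passing to a finite subfamily with slack
  1, which is the 1 in the bound, and less than the other half is left for some member of it to
  reach \<open>R\<close> in absolute value.\<close>

lemma studentized_inf_quantile_lower:
  assumes Z: "tight_random_element T N Z" and G: "centered_gaussian_process T N Z \<Sigma>" and T: "T \<noteq> {}"
    and l: "0 < l" "\<And>t. t \<in> T \<Longrightarrow> l \<le> \<Sigma> t t" and \<alpha>: "0 < \<alpha>" "\<alpha> < 1"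
    and R: "0 \<le> R" "\<And>F. finite F \<Longrightarrow> F \<subseteq> T \<Longrightarrow> measure N {v\<in>space N. \<exists>g\<in>F. R \<le> \<bar>Z g v\<bar>} < \<alpha> / 2"
  defines "\<phi> \<equiv> \<lambda>v. studentized_inf T (\<lambda>t. sqrt (\<Sigma> t t)) (sample_path T Z v)"
  shows "- (R / sqrt l + 1) \<le> quantile (distr N borel \<phi>) \<alpha>"
proof -
  let ?s = "\<lambda>t. sqrt (\<Sigma> t t)"
  have b: "0 < sqrt l" "\<And>t. t \<in> T \<Longrightarrow> sqrt l \<le> ?s t" using l by auto
  note path = tight_random_element_path[OF Z]
  interpret prob_space N by (rule path)
  have \<phi>m[measurable]: "\<phi> \<in> borel_measurable N"
    unfolding \<phi>_def by (rule studentized_inf_measurable[OF Z T b])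
  interpret \<mu>: real_distribution "distr N borel \<phi>" by (rule real_distribution_distr) simp
  have \<alpha>2: "0 < \<alpha> / 2" using \<alpha> by simp
  obtain F where F: "finite F" "F \<subseteq> T"
    and bad: "measure N {v\<in>space N. \<not> (\<exists>f\<in>F. Z f v / ?s f < studentized_inf T ?s (sample_path T Z v) + 1)} \<le> \<alpha> / 2"
    by (rule tight_studentized_inf_finite[where s="?s", OF Z T b \<alpha>2 zero_less_one])
  have Zm[measurable]: "Z f \<in> borel_measurable N" if "f \<in> F" for f
    using centered_gaussian_process_rv(2)[OF G] F that by auto
  let ?B = "{v\<in>space N. \<not> (\<exists>f\<in>F. Z f v / ?s f < \<phi> v + 1)}" and ?E = "{v\<in>space N. \<exists>g\<in>F. R \<le> \<bar>Z g v\<bar>}"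
  have [measurable]: "?B \<in> sets N" "?E \<in> sets N" using F(1) by measurable
  show ?thesis
  proof (rule \<mu>.quantile_ge[OF \<alpha>], rule ccontr)
    fix x assume x: "\<alpha> \<le> measure (distr N borel \<phi>) {..x}" and "\<not> - (R / sqrt l + 1) \<le> x"
    then have xR: "x + 1 \<le> - (R / sqrt l)" by simp
    have "measure (distr N borel \<phi>) {..x} = measure N {v\<in>space N. \<phi> v \<le> x}"
      by (subst measure_distr) (auto intro!: arg_cong2[where f=measure])
    also have "\<dots> \<le> measure N (?E \<union> ?B)"
    proof (rule finite_measure_mono)
      show "{v\<in>space N. \<phi> v \<le> x} \<subseteq> ?E \<union> ?B"
      proof
        fix v assume v: "v \<in> {v\<in>space N. \<phi> v \<le> x}"
        show "v \<in> ?E \<union> ?B"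
        proof (cases "v \<in> ?B")
          case False
          then obtain f where f: "f \<in> F" "Z f v / ?s f < \<phi> v + 1" using v by auto
          then have fT: "f \<in> T" using F by auto
          have s: "0 < ?s f" using b(1) b(2)[OF fT] by linarith
          have "Z f v / ?s f < - (R / sqrt l)" using f v xR by simp
          then have "Z f v < - (R / sqrt l) * ?s f" using s by (simp only: pos_divide_less_eq)
          moreover have "R / sqrt l * sqrt l \<le> R / sqrt l * ?s f"
            using R(1) b(1) b(2)[OF fT] by (intro mult_left_mono) auto
          ultimately have "R \<le> \<bar>Z f v\<bar>" using b(1) by simp
          then show ?thesis using v f by auto
        qed simp
      qed
    qed measurable
    also have "\<dots> \<le> measure N ?E + measure N ?B" by (rule measure_Un_le) measurable
    also have "\<dots> < \<alpha> / 2 + \<alpha> / 2" using R(2)[OF F] bad unfolding \<phi>_def by (intro add_less_le_mono) auto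
    finally show False using x by simp
  qed
qed

text \<open>The half-line splits at the quantile: at most \<alpha> lies strictly below, and
  anticoncentration handles the rest. The tail beyond minus the quantile is at least the tail beyond
  \<open>B\<close>, which makes the bound uniform.\<close>

lemma studentized_inf_near_quantile:
  assumes Z: "tight_random_element T N Z" and G: "centered_gaussian_process T N Z \<Sigma>" and T: "T \<noteq> {}"
    and l: "0 < l" "\<And>t. t \<in> T \<Longrightarrow> l \<le> \<Sigma> t t" and \<alpha>: "0 < \<alpha>" "\<alpha> < 1" and \<eta>: "0 < \<eta>"
  defines "\<phi> \<equiv> \<lambda>v. studentized_inf T (\<lambda>t. sqrt (\<Sigma> t t)) (sample_path T Z v)"
  assumes B: "- B \<le> quantile (distr N borel \<phi>) \<alpha>"
  shows "measure N {v\<in>space N. \<phi> v < quantile (distr N borel \<phi>) \<alpha> + \<eta>}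
     \<le> \<alpha> + \<eta> / measure std_normal_distribution {B<..}"
proof -
  let ?s = "\<lambda>t. sqrt (\<Sigma> t t)"
  have b: "0 < sqrt l" "\<And>t. t \<in> T \<Longrightarrow> sqrt l \<le> ?s t" using l by auto
  note path = tight_random_element_path[OF Z]
  interpret prob_space N by (rule path)
  interpret std: real_distribution std_normal_distribution by (rule real_dist_normal_dist)
  have \<phi>m[measurable]: "\<phi> \<in> borel_measurable N"
    unfolding \<phi>_def by (rule studentized_inf_measurable[OF Z T b])
  interpret \<mu>: real_distribution "distr N borel \<phi>" by (rule real_distribution_distr) simp
  define c where "c = quantile (distr N borel \<phi>) \<alpha>"
  let ?q = "\<lambda>b. measure std_normal_distribution {b<..}"
  let ?E = "{v\<in>space N. c \<le> \<phi> v \<and> \<phi> v < c + \<eta>}"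
  have "measure N {v\<in>space N. \<phi> v < c + \<eta>} \<le> measure N ({v\<in>space N. \<phi> v < c} \<union> ?E)"
    by (rule finite_measure_mono) auto
  also have "\<dots> \<le> measure N {v\<in>space N. \<phi> v < c} + measure N ?E"
    by (rule measure_Un_le) measurable
  also have "measure N {v\<in>space N. \<phi> v < c} = measure (distr N borel \<phi>) {..<c}"
    by (subst measure_distr) (auto intro!: arg_cong2[where f=measure])
  also have "\<dots> \<le> \<alpha>" unfolding c_def by (rule \<mu>.measure_less_quantile[OF \<alpha>])
  also have "measure N ?E \<le> \<eta> / ?q (- c)"
  proof -
    have "measure N ?E * ?q (- c) \<le> \<eta>"
      unfolding \<phi>_def by (rule studentized_inf_anticoncentration[OF Z G T l \<eta>])
    then show ?thesis by (simp only: pos_le_divide_eq[OF std_normal_tail_pos])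
  qed
  also have "\<dots> \<le> \<eta> / ?q B"
    using B \<eta> std_normal_tail_pos
    by (intro divide_left_mono std.finite_measure_mono mult_pos_pos) (auto simp: c_def)
  finally show ?thesis by (simp add: c_def)
qed

section \<open>From the limit process to the sample\<close>

lemma outer_measure_of_Un_le:
  assumes "A \<subseteq> space M" "B \<subseteq> space M"
  shows "outer_measure_of M (A \<union> B) \<le> outer_measure_of M A + outer_measure_of M B"
proof -
  obtain E where E: "E \<in> sets M" "A \<subseteq> E" "outer_measure_of M A = emeasure M E"
    using outer_measure_of_attain[OF assms(1)] by auto
  obtain F where F: "F \<in> sets M" "B \<subseteq> F" "outer_measure_of M B = emeasure M F"
    using outer_measure_of_attain[OF assms(2)] by auto
  have "outer_measure_of M (A \<union> B) \<le> outer_measure_of M (E \<union> F)"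
    by (rule outer_measure_of_mono) (use E F in auto)
  also have "\<dots> = emeasure M (E \<union> F)" using E F by simp
  also have "\<dots> \<le> emeasure M E + emeasure M F" by (rule emeasure_subadditive) (use E F in auto)
  finally show ?thesis using E F by simp
qed

text \<open>The bounded Lipschitz distance does not control indicators, so the one of
  \<open>\<le> c\<close> is replaced by a ramp that falls from 1 to 0 on
  \<open>[c, c + \<eta>]\<close>. Its slope \<open>1 / \<eta>\<close> times the Lipschitz constant
  \<open>1 / b\<close> of the infimum is the quantity that \<open>L\<close> dominates.\<close>

lemma studentized_inf_outer_prob:
  assumes M: "prob_space M" "\<And>\<omega>. \<omega> \<in> space M \<Longrightarrow> sample_path T Y \<omega> \<in> mspace (linf T)"
    and Z: "tight_random_element T N Z" and T: "T \<noteq> {}"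
    and b: "0 < b" "\<And>t. t \<in> T \<Longrightarrow> b \<le> s t" and \<eta>: "0 < \<eta>" and L: "1 \<le> L" "1 / (\<eta> * b) \<le> L"
  shows "outer_measure_of M {\<omega>\<in>space M. studentized_inf T s (sample_path T Y \<omega>) \<le> c}
     \<le> ennreal (measure N {v\<in>space N. studentized_inf T s (sample_path T Z v) < c + \<eta>} + L * bl_distance T M Y N Z)"
proof -
  note path = tight_random_element_path[OF Z]
  interpret N: prob_space N by (rule path)
  let ?\<phi> = "studentized_inf T s"
  define h where "h = (\<lambda>y. min 1 (max 0 ((c + \<eta> - ?\<phi> y) / \<eta>)))"
  have h01: "0 \<le> h y \<and> h y \<le> 1" for y by (simp add: h_def)
  have lip: "\<bar>h y - h z\<bar> \<le> L * mdist (linf T) y z" if "y \<in> mspace (linf T)" "z \<in> mspace (linf T)" for y z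
  proof -
    have "\<bar>h y - h z\<bar> \<le> \<bar>(c + \<eta> - ?\<phi> y) / \<eta> - (c + \<eta> - ?\<phi> z) / \<eta>\<bar>"
      unfolding h_def by (auto simp: min_def max_def)
    also have "\<dots> = \<bar>?\<phi> y - ?\<phi> z\<bar> / \<eta>"
      using \<eta> by (simp add: diff_divide_distrib[symmetric] abs_divide abs_minus_commute)
    also have "\<dots> \<le> (1 / b * mdist (linf T) y z) / \<eta>"
      using studentized_inf_lipschitz[where s=s, OF T that b] \<eta> by (intro divide_right_mono) auto
    also have "\<dots> = 1 / (\<eta> * b) * mdist (linf T) y z" by simp
    also have "\<dots> \<le> L * mdist (linf T) y z" using L(2) by (intro mult_right_mono) auto
    finally show ?thesis .
  qed
  have \<phi>m[measurable]: "(\<lambda>v. ?\<phi> (sample_path T Z v)) \<in> borel_measurable N"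
    by (rule studentized_inf_measurable[OF Z T b])
  have "(\<integral>v. h (sample_path T Z v) \<partial>N) \<le> (\<integral>v. indicator {v\<in>space N. ?\<phi> (sample_path T Z v) < c + \<eta>} v \<partial>N)"
  proof (rule integral_mono)
    show "integrable N (\<lambda>v. h (sample_path T Z v))"
      unfolding h_def by (rule N.integrable_const_bound[where B=1]) auto
    show "h (sample_path T Z v) \<le> indicator {v\<in>space N. ?\<phi> (sample_path T Z v) < c + \<eta>} v" if "v \<in> space N" for v
      using h01[of "sample_path T Z v"] that \<eta> by (auto simp: indicator_def h_def max_def divide_le_0_iff)
  qed (simp add: less_top[symmetric])
  also have "\<dots> = measure N {v\<in>space N. ?\<phi> (sample_path T Z v) < c + \<eta>}" by (simp add: Int_absorb2)
  finally have le: "(\<integral>v. h (sample_path T Z v) \<partial>N) \<le> \<dots>" .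
  have "outer_measure_of M {\<omega>\<in>space M. ?\<phi> (sample_path T Y \<omega>) \<le> c}
      \<le> ennreal ((\<integral>v. h (sample_path T Z v) \<partial>N) + L * bl_distance T M Y N Z)"
  proof (rule outer_prob_le_bl_distance[OF M Z L(1) h01 lip])
    fix \<omega> assume "\<omega> \<in> {\<omega>\<in>space M. ?\<phi> (sample_path T Y \<omega>) \<le> c}"
    then have "\<eta> \<le> c + \<eta> - ?\<phi> (sample_path T Y \<omega>)" by simp
    then have "1 \<le> (c + \<eta> - ?\<phi> (sample_path T Y \<omega>)) / \<eta>" using \<eta> by (simp add: pos_le_divide_eq)
    then show "h (sample_path T Y \<omega>) = 1" by (simp add: h_def)
  qed auto
  then show ?thesis using le by (meson add_right_mono ennreal_leI order_trans)
qed

text \<open>For a fixed sample the average depends on the policy only through the set of units it selects.\<close>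

lemma policy_average_range:
  assumes "\<And>i. i < n \<Longrightarrow> covariate_of (dat n i \<omega>) \<in> \<X>" "G \<subseteq> policies \<X>"
  shows "finite ((\<lambda>g. r * policy_average v dat n g \<omega>) ` G) \<and> card ((\<lambda>g. r * policy_average v dat n g \<omega>) ` G) \<le> 2 ^ n"
proof -
  let ?f = "\<lambda>A. r * ((\<Sum>i\<in>A. v n i \<omega>) / real n)"
  have "(\<lambda>g. r * policy_average v dat n g \<omega>) ` G \<subseteq> ?f ` Pow {..<n}"
  proof (rule image_subsetI)
    fix g assume "g \<in> G"
    then have g: "g x \<in> {0, 1}" if "x \<in> \<X>" for x
      using assms(2) that by (auto simp: policies_def)
    let ?A = "{i\<in>{..<n}. g (covariate_of (dat n i \<omega>)) = 1}"
    have "(\<Sum>i<n. v n i \<omega> * g (covariate_of (dat n i \<omega>))) = (\<Sum>i<n. if g (covariate_of (dat n i \<omega>)) = 1 then v n i \<omega> else 0)"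
      by (rule sum.cong) (use g assms(1) in fastforce)+
    also have "\<dots> = (\<Sum>i\<in>?A. v n i \<omega>)" by (rule sum.inter_filter[symmetric]) simp
    finally show "r * policy_average v dat n g \<omega> \<in> ?f ` Pow {..<n}"
      unfolding policy_average_def by (intro image_eqI[of _ _ ?A]) auto
  qed
  moreover have "card (?f ` Pow {..<n}) \<le> 2 ^ n"
    using card_image_le[of "Pow {..<n}" ?f] by (simp add: card_Pow)
  ultimately show ?thesis
    by (meson card_mono finite_Pow_iff finite_imageI finite_lessThan finite_subset order_trans)
qed

text \<open>The relative error of the square root is at most that of \<open>x\<close>, since
  \<open>x - a\<close> is the difference of the roots times their sum. The critical value
  \<open>c\<close> can have either sign, so the ratio is controlled from both sides.\<close>

lemma sqrt_ratio_bound: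
  assumes "0 < l" "l \<le> a" "0 < x" "\<bar>x - a\<bar> \<le> \<epsilon>" "\<bar>c\<bar> \<le> B"
  shows "c * sqrt x / sqrt a \<le> c + B * \<epsilon> / l"
proof -
  have a: "0 < a" "0 < sqrt a" using assms by auto
  have "\<bar>sqrt x / sqrt a - 1\<bar> = \<bar>sqrt x - sqrt a\<bar> / sqrt a"
  proof -
    have "sqrt x / sqrt a - 1 = (sqrt x - sqrt a) / sqrt a" using a by (simp add: diff_divide_distrib)
    then show ?thesis using a by (simp add: abs_divide)
  qed
  also have "\<dots> \<le> \<bar>x - a\<bar> / a"
  proof -
    have "\<bar>x - a\<bar> = \<bar>sqrt x - sqrt a\<bar> * (sqrt x + sqrt a)"
    proof -
      have "x - a = (sqrt x - sqrt a) * (sqrt x + sqrt a)" using assms a by (simp add: algebra_simps)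
      then show ?thesis using assms a by (simp add: abs_mult)
    qed
    also have "\<dots> \<ge> \<bar>sqrt x - sqrt a\<bar> * sqrt a" using assms by (intro mult_left_mono) auto
    finally have "\<bar>sqrt x - sqrt a\<bar> * sqrt a / (sqrt a * sqrt a) \<le> \<bar>x - a\<bar> / (sqrt a * sqrt a)"
      using a by (intro divide_right_mono) auto
    moreover have "\<bar>sqrt x - sqrt a\<bar> * sqrt a / (sqrt a * sqrt a) = \<bar>sqrt x - sqrt a\<bar> / sqrt a"
      by (rule mult_divide_mult_cancel_right) (use a in simp)
    ultimately show ?thesis using a by simp
  qed
  also have "\<dots> \<le> \<epsilon> / l" using assms by (intro frac_le) auto
  finally have r: "\<bar>sqrt x / sqrt a - 1\<bar> \<le> \<epsilon> / l" .
  have "c * (sqrt x / sqrt a - 1) \<le> \<bar>c\<bar> * \<bar>sqrt x / sqrt a - 1\<bar>" by (metis abs_ge_self abs_mult)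
  also have "\<dots> \<le> B * (\<epsilon> / l)" using r assms by (intro mult_mono) auto
  finally show ?thesis by (simp add: algebra_simps)
qed

section \<open>The estimated class\<close>

lemma critical_value_studentized_inf:
  "critical_value G N Z \<Sigma> \<alpha>
     = quantile (distr N borel (\<lambda>v. studentized_inf G (\<lambda>g. sqrt (\<Sigma> g g)) (sample_path G Z v))) \<alpha>"
proof -
  have "studentized_inf G s (sample_path G Z v) = (INF g\<in>G. Z g v / s g)" for s v
    unfolding studentized_inf_def sample_path_def by (intro INF_cong) auto
  then show ?thesis unfolding critical_value_def by simp
qed

text \<open>
  The hypotheses do not state that the limit processes are uniformly tight over \<open>\<P>\<close>, which the
  anticoncentration needs. It follows from closeness to the estimate at a single sample size \<open>n\<close>.
\<close>

lemma uniform_critical_value_bound: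
  fixes G :: "('p::finite) policy set"
  assumes G: "G \<subseteq> policies \<X>" "G \<noteq> {}" and iid: "iid_sampling \<X> \<P> S Pn dat"
    and gp: "\<And>P. P \<in> \<P> \<Longrightarrow> centered_gaussian_process G (NB P) (GB P) (\<Sigma>B P)"
    and wc: "uniform_weak_convergence G \<P> Pn
       (\<lambda>P n g \<omega>. sqrt (real n) * (policy_average Cs dat n g \<omega> - budget g P)) NB GB"
    and K: "\<And>P g. P \<in> \<P> \<Longrightarrow> g \<in> G \<Longrightarrow> \<Sigma>B P g g \<le> K"
    and l: "0 < l" "\<And>P g. P \<in> \<P> \<Longrightarrow> g \<in> G \<Longrightarrow> l \<le> \<Sigma>B P g g"
    and \<alpha>: "0 < \<alpha>" "\<alpha> < 1"
  shows "\<exists>B\<ge>0. \<forall>P\<in>\<P>. \<bar>critical_value G (NB P) (GB P) (\<Sigma>B P) \<alpha>\<bar> \<le> B"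
proof -
  let ?Y = "\<lambda>P n g \<omega>. sqrt (real n) * (policy_average Cs dat n g \<omega> - budget g P)"
  \<comment> \<open>The lower bound for the quantile asks for \<open>\<alpha> / 2\<close>; the level
    bound requires at most 1/10.\<close>
  define \<alpha>0 where "\<alpha>0 = min (\<alpha> / 2) (1 / 10)"
  have \<alpha>0: "0 < \<alpha>0" "\<alpha>0 \<le> 1/10" "\<alpha>0 \<le> \<alpha> / 2" using \<alpha> by (auto simp: \<alpha>0_def)
  have "\<forall>\<^sub>F n in sequentially. \<forall>P\<in>\<P>. dist (bl_distance G (Pn P n) (?Y P n) (NB P) (GB P)) 0 < \<alpha>0 / 16"
    using wc \<alpha>0 unfolding uniform_weak_convergence_def by (intro uniform_limitD) auto
  then obtain n where n: "\<And>P. P \<in> \<P> \<Longrightarrow> dist (bl_distance G (Pn P n) (?Y P n) (NB P) (GB P)) 0 < \<alpha>0 / 16"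
    by (auto simp: eventually_sequentially)
  define m where "m = (2::nat) ^ n"
  obtain D where D: "4 * real (m * m) / \<alpha>0 < real D" using reals_Archimedean2 by blast
  define t where "t = max 4 (sqrt (max 0 K / \<alpha>0))"
  have t: "4 \<le> t" "K \<le> \<alpha>0 * t\<^sup>2"
  proof -
    have "max 0 K / \<alpha>0 = (sqrt (max 0 K / \<alpha>0))\<^sup>2" using \<alpha>0 by simp
    also have "\<dots> \<le> t\<^sup>2" using \<alpha>0 by (intro power_mono) (auto simp: t_def)
    finally show "K \<le> \<alpha>0 * t\<^sup>2" using \<alpha>0 by (simp add: pos_divide_le_eq mult.commute)
  qed (simp add: t_def)
  define R where "R = t * 3 ^ D"
  have R0: "0 \<le> R" using t by (simp add: R_def)
  have level: "measure (NB P) {v\<in>space (NB P). \<exists>g\<in>F. R \<le> \<bar>GB P g v\<bar>} < \<alpha> / 2"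
    if P: "P \<in> \<P>" and F: "finite F" "F \<subseteq> G" for P F
  proof -
    have M: "prob_space (Pn P n)" and S: "sets (Pn P n) = sets (S n)"
      using iid P by (auto simp: iid_sampling_def)
    have path: "sample_path G (?Y P n) \<omega> \<in> mspace (linf G)" if "\<omega> \<in> space (Pn P n)" for \<omega>
      using wc P that unfolding uniform_weak_convergence_def by blast
    have Z: "tight_random_element G (NB P) (GB P)"
      using wc P unfolding uniform_weak_convergence_def by blast
    have "measure (NB P) {v\<in>space (NB P). \<exists>g\<in>F. t * 3 ^ D \<le> \<bar>GB P g v\<bar>} < \<alpha>0"
    \<comment> \<open>The shift \<open>\<beta>\<close> undoes the centring: what remains is the
      scaled average, which has at most \<open>2 ^ n\<close> values over the class, whatever
      \<open>P\<close> is.\<close>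
    proof (rule gaussian_limit_level_bound[where \<beta>="\<lambda>g. sqrt (real n) * budget g P" and m=m and K=K,
          OF M path Z gp[OF P] F _ K[OF P] \<alpha>0(1,2) t])
      fix \<omega> assume "\<omega> \<in> space (Pn P n)"
      then have "\<omega> \<in> space (S n)" using sets_eq_imp_space_eq[OF S] by simp
      then have "dat n i \<omega> \<in> space (datum_space \<X>)" if "i < n" for i
        using iid that by (auto simp: iid_sampling_def intro: measurable_space)
      then have "covariate_of (dat n i \<omega>) \<in> \<X>" if "i < n" for i
        using that by (fastforce simp: datum_space_def space_pair_measure space_restrict_space mem_Times_iff)
      from policy_average_range[of n dat \<omega> \<X> G "sqrt (real n)" Cs, OF this G(1)]
      show "finite ((\<lambda>g. ?Y P n g \<omega> + sqrt (real n) * budget g P) ` G) \<and>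
          card ((\<lambda>g. ?Y P n g \<omega> + sqrt (real n) * budget g P) ` G) \<le> m"
        by (simp add: right_diff_distrib m_def)
    next
      show "bl_distance G (Pn P n) (?Y P n) (NB P) (GB P) \<le> \<alpha>0 / 16" using n[OF P] by (simp add: dist_real_def)
      show "4 * real (m * m) < \<alpha>0 * real D" using D \<alpha>0 by (simp add: pos_divide_less_eq mult.commute)
    qed
    then show ?thesis using \<alpha>0 by (simp add: R_def)
  qed
  define B where "B = max (R / sqrt l + 1) (1 / sqrt (1 - \<alpha>))"
  show ?thesis
  proof (intro exI[of _ B] conjI ballI)
    have "0 \<le> R / sqrt l" using R0 l by simp
    then show "0 \<le> B" unfolding B_def by (intro max.coboundedI1) simp
    fix P assume P: "P \<in> \<P>"
    have Z: "tight_random_element G (NB P) (GB P)"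
      using wc P unfolding uniform_weak_convergence_def by blast
    have "- (R / sqrt l + 1) \<le> critical_value G (NB P) (GB P) (\<Sigma>B P) \<alpha>"
      unfolding critical_value_studentized_inf
      by (rule studentized_inf_quantile_lower[OF Z gp[OF P] G(2) l(1) l(2)[OF P] \<alpha> R0 level[OF P]])
    moreover have "critical_value G (NB P) (GB P) (\<Sigma>B P) \<alpha> \<le> 1 / sqrt (1 - \<alpha>)"
      unfolding critical_value_studentized_inf
      by (rule studentized_inf_quantile_upper[OF Z gp[OF P] G(2) l(1) l(2)[OF P] \<alpha>])
    moreover have "R / sqrt l + 1 \<le> B" "1 / sqrt (1 - \<alpha>) \<le> B" by (simp_all add: B_def)
    ultimately show "\<bar>critical_value G (NB P) (GB P) (\<Sigma>B P) \<alpha>\<bar> \<le> B" by linarith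
  qed
qed

text \<open>Infeasibility allows \<open>k\<close> to be replaced by the larger true budget, so the
  centred estimate satisfies the same inequality. Exchanging the estimated for the true standard
  deviation multiplies \<open>c\<close> by a ratio close to 1.\<close>

lemma estimated_infeasible_imp:
  assumes path: "sample_path G (\<lambda>g \<omega>. sqrt (real n) * (policy_average Cs dat n g \<omega> - budget g P)) \<omega> \<in> mspace (linf G)"
    and l: "0 < l" "\<And>g. g \<in> G \<Longrightarrow> l \<le> \<Sigma> g g"
    and close: "\<And>g. g \<in> G \<Longrightarrow> \<bar>\<Sigma>h n g g \<omega> - \<Sigma> g g\<bar> \<le> \<epsilon>" and \<epsilon>: "\<epsilon> < l" "\<bar>c\<bar> \<le> B" "B * \<epsilon> / l \<le> \<eta>"
    and ne: "estimated_class G k dat Cs \<Sigma>h c n \<omega> \<inter> infeasible_class G k P \<noteq> {}"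
  shows "studentized_inf G (\<lambda>g. sqrt (\<Sigma> g g))
      (sample_path G (\<lambda>g \<omega>. sqrt (real n) * (policy_average Cs dat n g \<omega> - budget g P)) \<omega>) \<le> c + \<eta>"
proof -
  obtain g where g: "g \<in> G" and est: "sqrt (real n) * (policy_average Cs dat n g \<omega> - k) / sqrt (\<Sigma>h n g g \<omega>) \<le> c"
    and inf: "k < budget g P"
    using ne unfolding estimated_class_def infeasible_class_def by auto
  let ?Y = "sqrt (real n) * (policy_average Cs dat n g \<omega> - budget g P)"
  \<comment> \<open>At a nonpositive variance estimate the quotient would be 0 or have the opposite
    sign, and the defining inequality would give no bound; \<open>\<epsilon> < l\<close> excludes
    this.\<close>
  have pos: "0 < \<Sigma>h n g g \<omega>" using close[OF g] l(2)[OF g] \<epsilon>(1) by linarith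
  have s: "0 < sqrt (\<Sigma> g g)" using l(1) l(2)[OF g] by simp
  have "?Y \<le> sqrt (real n) * (policy_average Cs dat n g \<omega> - k)" using inf by (intro mult_left_mono) auto
  also have "\<dots> \<le> c * sqrt (\<Sigma>h n g g \<omega>)" using est pos by (simp add: pos_divide_le_eq)
  finally have "?Y / sqrt (\<Sigma> g g) \<le> c * sqrt (\<Sigma>h n g g \<omega>) / sqrt (\<Sigma> g g)"
    using s by (intro divide_right_mono) auto
  also have "\<dots> \<le> c + B * \<epsilon> / l" by (rule sqrt_ratio_bound[OF l(1) l(2)[OF g] pos close[OF g] \<epsilon>(2)])
  also have "\<dots> \<le> c + \<eta>" using \<epsilon>(3) by simp
  finally have Y: "?Y / sqrt (\<Sigma> g g) \<le> c + \<eta>" .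
  have "0 < sqrt l" using l(1) by simp
  then have "studentized_inf G (\<lambda>g. sqrt (\<Sigma> g g))
      (sample_path G (\<lambda>g \<omega>. sqrt (real n) * (policy_average Cs dat n g \<omega> - budget g P)) \<omega>)
    \<le> sample_path G (\<lambda>g \<omega>. sqrt (real n) * (policy_average Cs dat n g \<omega> - budget g P)) \<omega> g / sqrt (\<Sigma> g g)"
    by (intro studentized_inf_le[where b="sqrt l", OF path]) (use l g in auto)
  also have "\<dots> = ?Y / sqrt (\<Sigma> g g)" using g by (simp add: sample_path_def)
  finally show ?thesis using Y by simp
qed

theorem theorem3p1:
  fixes \<X> :: "(real ^ 'p) set"
    and G :: "'p policy set"
    and \<P> :: "'p datum measure set"
    and k \<alpha> :: real
    and S :: "nat \<Rightarrow> 's measure"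
    and Pn :: "'p datum measure \<Rightarrow> nat \<Rightarrow> 's measure"
    and dat :: "nat \<Rightarrow> nat \<Rightarrow> 's \<Rightarrow> 'p datum"
    and \<tau>s Cs :: "nat \<Rightarrow> nat \<Rightarrow> 's \<Rightarrow> real"
    and \<Sigma>h :: "nat \<Rightarrow> 'p policy \<Rightarrow> 'p policy \<Rightarrow> 's \<Rightarrow> real"
    and NW :: "'p datum measure \<Rightarrow> 'u measure"
    and GW :: "'p datum measure \<Rightarrow> 'p policy \<Rightarrow> 'u \<Rightarrow> real"
    and NB :: "'p datum measure \<Rightarrow> 'v measure"
    and GB :: "'p datum measure \<Rightarrow> 'p policy \<Rightarrow> 'v \<Rightarrow> real"
    and \<Sigma>W \<Sigma>B :: "'p datum measure \<Rightarrow> 'p policy \<Rightarrow> 'p policy \<Rightarrow> real"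
  assumes "G \<subseteq> policies \<X>"
    and "\<forall>P\<in>\<P>. data_distribution \<X> G P"
    and "iid_sampling \<X> \<P> S Pn dat"
    and "estimation_quality G \<P> S Pn dat \<tau>s Cs \<Sigma>h NW GW \<Sigma>W NB GB \<Sigma>B"
    and "0 < \<alpha>" and "\<alpha> < 1"
  shows "limsup (\<lambda>n. SUP P\<in>\<P>. outer_measure_of (Pn P n)
           {\<omega> \<in> space (Pn P n).
              estimated_class G k dat Cs \<Sigma>h (critical_value G (NB P) (GB P) (\<Sigma>B P) \<alpha>) n \<omega>
                \<inter> infeasible_class G k P \<noteq> {}})
         \<le> ennreal \<alpha>"
proof (cases "G = {}")
  \<comment> \<open>Over the empty class the infimum in the critical value is a mere default, but
    then no policy can be selected.\<close>
  case True
  then have "estimated_class G k dat Cs \<Sigma>h c n \<omega> = {}" for c n \<omega> by (simp add: estimated_class_def)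
  then have "(SUP P\<in>\<P>. outer_measure_of (Pn P n)
           {\<omega> \<in> space (Pn P n).
              estimated_class G k dat Cs \<Sigma>h (critical_value G (NB P) (GB P) (\<Sigma>B P) \<alpha>) n \<omega>
                \<inter> infeasible_class G k P \<noteq> {}}) \<le> ennreal \<alpha>" for n
    by (intro SUP_least) simp
  then show ?thesis by (intro Limsup_bounded) simp
next
  case False
  let ?Y = "\<lambda>P n g \<omega>. sqrt (real n) * (policy_average Cs dat n g \<omega> - budget g P)"
  let ?c = "\<lambda>P. critical_value G (NB P) (GB P) (\<Sigma>B P) \<alpha>"
  let ?s = "\<lambda>P g. sqrt (\<Sigma>B P g g)"
  let ?E = "\<lambda>P n. {\<omega> \<in> space (Pn P n). estimated_class G k dat Cs \<Sigma>h (?c P) n \<omega> \<inter> infeasible_class G k P \<noteq> {}}"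
  note \<alpha> = assms(5,6)
  have gp: "\<And>P. P \<in> \<P> \<Longrightarrow> centered_gaussian_process G (NB P) (GB P) (\<Sigma>B P)"
    and wc: "uniform_weak_convergence G \<P> Pn ?Y NB GB"
    and bnd: "bounded_nondegenerate_covariances G \<P> \<Sigma>B"
    and cons: "uniformly_consistent G \<P> Pn \<Sigma>h \<Sigma>B"
    using assms(4) unfolding estimation_quality_def by blast+
  have M: "prob_space (Pn P n)" if "P \<in> \<P>" for P n
    using assms(3) that by (auto simp: iid_sampling_def)
  have path: "sample_path G (?Y P n) \<omega> \<in> mspace (linf G)" if "P \<in> \<P>" "\<omega> \<in> space (Pn P n)" for P n \<omega>
    using wc that unfolding uniform_weak_convergence_def by blast
  have Z: "tight_random_element G (NB P) (GB P)" if "P \<in> \<P>" for P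
    using wc that unfolding uniform_weak_convergence_def by blast
  obtain K where "\<forall>P\<in>\<P>. \<forall>s\<in>G. \<forall>t\<in>G. \<bar>\<Sigma>B P s t\<bar> \<le> K"
    using bnd unfolding bounded_nondegenerate_covariances_def by blast
  then have K: "\<Sigma>B P g g \<le> K" if "P \<in> \<P>" "g \<in> G" for P g using that by (meson abs_le_D1)
  obtain l where l: "0 < l" "\<And>P g. P \<in> \<P> \<Longrightarrow> g \<in> G \<Longrightarrow> l \<le> \<Sigma>B P g g"
    using bnd unfolding bounded_nondegenerate_covariances_def by blast
  have "\<exists>B\<ge>0. \<forall>P\<in>\<P>. \<bar>?c P\<bar> \<le> B"
    by (rule uniform_critical_value_bound[OF assms(1) False assms(3) gp wc K l \<alpha>])
  then obtain B where B: "0 \<le> B" "\<And>P. P \<in> \<P> \<Longrightarrow> \<bar>?c P\<bar> \<le> B" by blast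
  define q where "q = measure std_normal_distribution {B<..}"
  have q: "0 < q" unfolding q_def by (rule std_normal_tail_pos)
  show ?thesis
  proof (rule ennreal_le_epsilon)
    fix e :: real assume e: "0 < e"
    \<comment> \<open>The slack \<open>e\<close> is shared equally by the band near the quantile,
      the bounded Lipschitz distance and the variance estimate. The band has width
      \<open>2 * \<eta>\<close>, one \<open>\<eta>\<close> for the variance error and one for the
      ramp.\<close>
    define \<eta> where "\<eta> = e * q / 6"
    have \<eta>: "0 < \<eta>" "2 * \<eta> / q = e / 3" using e q by (simp_all add: \<eta>_def)
    \<comment> \<open>\<open>l / 2\<close> keeps the estimated variances positive; the second term
      makes \<open>B * \<epsilon> / l\<close> at most \<open>\<eta>\<close>, with
      \<open>B + 1\<close> as \<open>B\<close> may be 0.\<close>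
    define \<epsilon> where "\<epsilon> = min (l / 2) (\<eta> * l / (B + 1))"
    have \<epsilon>: "0 < \<epsilon>" "\<epsilon> < l" using l(1) \<eta>(1) B(1) by (auto simp: \<epsilon>_def)
    have \<epsilon>B: "B * \<epsilon> / l \<le> \<eta>"
    proof -
      have "B * \<epsilon> \<le> (B + 1) * (\<eta> * l / (B + 1))" using B(1) \<epsilon> by (intro mult_mono) (auto simp: \<epsilon>_def)
      also have "\<dots> = \<eta> * l" using B(1) by simp
      finally show ?thesis using l(1) by (simp add: pos_divide_le_eq)
    qed
    define L where "L = max 1 (1 / (\<eta> * sqrt l))"
    have L: "1 \<le> L" "1 / (\<eta> * sqrt l) \<le> L" by (auto simp: L_def)
    let ?bad = "\<lambda>P n. {\<omega> \<in> space (Pn P n). (SUP (s, t)\<in>G \<times> G. ereal \<bar>\<Sigma>h n s t \<omega> - \<Sigma>B P s t\<bar>) > ereal \<epsilon>}"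
    have "\<forall>\<^sub>F n in sequentially. \<forall>P\<in>\<P>. dist (bl_distance G (Pn P n) (?Y P n) (NB P) (GB P)) 0 < e / 3 / L"
      using wc e L unfolding uniform_weak_convergence_def by (intro uniform_limitD) auto
    moreover have "\<forall>\<^sub>F n in sequentially. \<forall>P\<in>\<P>. dist (enn2real (outer_measure_of (Pn P n) (?bad P n))) 0 < e / 3"
      using cons e \<epsilon>(1) unfolding uniformly_consistent_def by (intro uniform_limitD) auto
    ultimately have "\<forall>\<^sub>F n in sequentially. (SUP P\<in>\<P>. outer_measure_of (Pn P n) (?E P n)) \<le> ennreal \<alpha> + ennreal e"
    proof eventually_elim
      case (elim n)
      show ?case
      proof (rule SUP_least)
        fix P assume P: "P \<in> \<P>"
        interpret Pn: prob_space "Pn P n" by (rule M[OF P])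
        let ?\<phi> = "studentized_inf G (?s P)"
        let ?A = "{\<omega>\<in>space (Pn P n). ?\<phi> (sample_path G (?Y P n) \<omega>) \<le> ?c P + \<eta>}"
        have b: "0 < sqrt l" "\<And>g. g \<in> G \<Longrightarrow> sqrt l \<le> ?s P g" using l(1) l(2)[OF P] by auto
        have sub: "?E P n \<subseteq> ?A \<union> ?bad P n"
        proof
          fix \<omega> assume \<omega>: "\<omega> \<in> ?E P n"
          show "\<omega> \<in> ?A \<union> ?bad P n"
          proof (cases "\<omega> \<in> ?bad P n")
            case False
            then have sup: "(SUP (s, t)\<in>G \<times> G. ereal \<bar>\<Sigma>h n s t \<omega> - \<Sigma>B P s t\<bar>) \<le> ereal \<epsilon>" using \<omega> by auto
            have close: "\<bar>\<Sigma>h n g g \<omega> - \<Sigma>B P g g\<bar> \<le> \<epsilon>" if "g \<in> G" for g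
            proof -
              have "ereal \<bar>\<Sigma>h n g g \<omega> - \<Sigma>B P g g\<bar> \<le> (SUP (s, t)\<in>G \<times> G. ereal \<bar>\<Sigma>h n s t \<omega> - \<Sigma>B P s t\<bar>)"
                using that by (intro SUP_upper2[of "(g, g)"]) auto
              then have "ereal \<bar>\<Sigma>h n g g \<omega> - \<Sigma>B P g g\<bar> \<le> ereal \<epsilon>" using sup by (rule order_trans)
              then show ?thesis by simp
            qed
            have "?\<phi> (sample_path G (?Y P n) \<omega>) \<le> ?c P + \<eta>"
            proof (rule estimated_infeasible_imp[where \<Sigma>="\<Sigma>B P", OF path[OF P] l(1) l(2)[OF P]])
              show "estimated_class G k dat Cs \<Sigma>h (?c P) n \<omega> \<inter> infeasible_class G k P \<noteq> {}" using \<omega> by auto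
            qed (use \<omega> close \<epsilon>(2) B(2)[OF P] \<epsilon>B in auto)
            then show ?thesis using \<omega> by auto
          qed simp
        qed
        have "outer_measure_of (Pn P n) (?E P n) \<le> outer_measure_of (Pn P n) (?A \<union> ?bad P n)"
          by (rule outer_measure_of_mono[OF sub])
        also have "\<dots> \<le> outer_measure_of (Pn P n) ?A + outer_measure_of (Pn P n) (?bad P n)"
          by (rule outer_measure_of_Un_le) auto
        also have "\<dots> \<le> ennreal (\<alpha> + 2 * (e / 3)) + ennreal (e / 3)"
        proof (rule add_mono)
          have "outer_measure_of (Pn P n) ?A \<le> ennreal (measure (NB P) {v\<in>space (NB P). ?\<phi> (sample_path G (GB P) v) < ?c P + \<eta> + \<eta>}
              + L * bl_distance G (Pn P n) (?Y P n) (NB P) (GB P))"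
            by (rule studentized_inf_outer_prob[OF Pn.prob_space_axioms path[OF P] Z[OF P] False b \<eta>(1) L])
          also have "\<dots> \<le> ennreal (\<alpha> + 2 * (e / 3))"
          proof (rule ennreal_leI)
            have "measure (NB P) {v\<in>space (NB P). ?\<phi> (sample_path G (GB P) v) < ?c P + 2 * \<eta>} \<le> \<alpha> + 2 * \<eta> / q"
              unfolding q_def critical_value_studentized_inf
            proof (rule studentized_inf_near_quantile[OF Z[OF P] gp[OF P] False l(1) l(2)[OF P] \<alpha>])
              show "0 < 2 * \<eta>" using \<eta> by simp
              show "- B \<le> quantile (distr (NB P) borel (\<lambda>v. ?\<phi> (sample_path G (GB P) v))) \<alpha>"
                using B(2)[OF P] unfolding critical_value_studentized_inf by (simp add: abs_le_iff)
            qed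
            moreover have "L * bl_distance G (Pn P n) (?Y P n) (NB P) (GB P) \<le> e / 3"
            proof -
              have "bl_distance G (Pn P n) (?Y P n) (NB P) (GB P) \<le> e / 3 / L"
                using elim(1) P by (force simp: dist_real_def)
              then have "L * bl_distance G (Pn P n) (?Y P n) (NB P) (GB P) \<le> L * (e / 3 / L)"
                using L by (intro mult_left_mono) auto
              then show ?thesis using L by simp
            qed
            ultimately show "measure (NB P) {v\<in>space (NB P). ?\<phi> (sample_path G (GB P) v) < ?c P + \<eta> + \<eta>}
              + L * bl_distance G (Pn P n) (?Y P n) (NB P) (GB P) \<le> \<alpha> + 2 * (e / 3)"
              unfolding \<eta>(2) by (simp add: algebra_simps)
          qed
          finally show "outer_measure_of (Pn P n) ?A \<le> ennreal (\<alpha> + 2 * (e / 3))" .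
          \<comment> \<open>\<open>enn2real\<close> maps infinity to 0, so finiteness is checked
            before its smallness is carried back to the outer measure.\<close>
          have "outer_measure_of (Pn P n) (?bad P n) \<le> outer_measure_of (Pn P n) (space (Pn P n))"
            by (rule outer_measure_of_mono) auto
          also have "\<dots> = 1" by (simp add: Pn.emeasure_space_1)
          finally have "outer_measure_of (Pn P n) (?bad P n) = ennreal (enn2real (outer_measure_of (Pn P n) (?bad P n)))"
            by (intro ennreal_enn2real[symmetric]) (auto simp: less_top[symmetric] top_unique)
          also have "\<dots> \<le> ennreal (e / 3)"
            using elim(2) P by (intro ennreal_leI) (force simp: dist_real_def)
          finally show "outer_measure_of (Pn P n) (?bad P n) \<le> ennreal (e / 3)" .
        qed
        also have "\<dots> = ennreal \<alpha> + ennreal e"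
          using \<alpha> e by (simp flip: ennreal_plus)
        finally show "outer_measure_of (Pn P n) (?E P n) \<le> ennreal \<alpha> + ennreal e" .
      qed
    qed
    then show "limsup (\<lambda>n. SUP P\<in>\<P>. outer_measure_of (Pn P n) (?E P n)) \<le> ennreal \<alpha> + ennreal e"
      by (rule Limsup_bounded)
  qed
qed

end
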